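(* Let $k=\big[\frac1{1-\alpha}\big]$ be the integer part of $\frac1{1-\alpha}$. The following holds. (i) For $c=c^{cj}$ there exists a unique $\beta^{cj}\in(0,+\infty)$ such that $\beta^{cj}=\beta_0(c^{cj})=\beta_1(c^{cj})$. (ii) At the critical point $(\beta,c)=(\beta^{cj},c^{cj})$ there is a Chapman–Jouguet reactive wave of special type. (iii) The union of the graphs $\{(\beta_0(c),c)\}$ and $\{(\beta_1(c),c)\}$ with the point $(\beta^{cj},c^{cj})$ is a simple curve $(B)$ in the $(\beta,c)$ parameter space, of class $C^k$. The mapping $\tilde c:\beta\mapsto c$ defined by the curve $(B)$ locally around $(\beta^{cj},c^{cj})$ has a quadratic minimum at $\beta^{cj}$, i.e. $\tilde c'(\beta^{cj})=0$ and $\tilde c''(\beta^{cj})>0$. (iv) For $c=c^{cj}$ and every $\beta\in(0,\beta^{cj})$ there is a Chapman–Jouguet reactive wave with a bump.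
   Context: Fix real numbers $q_0>0$, $K>0$, $0\le\alpha<1$ and $T_i$ with $0<T_i<\sqrt{2q_0}$. The function $\varphi:[0,\infty)\to[0,\infty)$ vanishes on $[0,T_i)$ and is $C^\infty$ and positive on $[T_i,\infty)$ (hence discontinuous at $T_i$); moreover $\psi(V)=\varphi(1/V)$ extends smoothly to $V=0$ with $\psi(0)>0$. (Examples: $\varphi(T)=H(T-T_i)$ with $H$ the Heaviside function, and $\varphi(T)=H(T-T_i)e^{-T_a/T}$ with $T_a>0$.) Notation: $c^{cj}=\sqrt{2q_0}$, $c_*=\frac{T_i^2+2q_0}{2T_i}$, and for $c\ge c^{cj}$, $T_0(c)=c+\sqrt{c^2-2q_0}$, $T_1(c)=c-\sqrt{c^2-2q_0}$. For $\beta>0$ and $c\ge c^{cj}$, a solution (reactive traveling wave of speed $c$ with viscosity $\beta$) is a pair $(T,Z)\in C^1(\mathbb R)\times C^0(\mathbb R)$ for which there is $\ell\in(0,\infty)$ with: - $T(0)=T_i$, $T(\xi)<T_i$ for $\xi>0$, $T(\xi)>T_i$ for $\xi<0$; - for $\xi>0$: $Z\equiv1$, $\beta T_\xi=-cT+\frac{T^2}{2}$, and $T(\xi)\to0$ as $\xi\to+\infty$; - for $-\ell<\xi<0$ (reaction zone): $Z>0$, $\beta T_\xi=-cT+\frac{T^2}2+q_0(1-Z)$, $Z_\xi=K\varphi(T)Z^\alpha$, with $Z(0)=1$ and $Z(-\ell)=0$; - for $\xi<-\ell$: $Z\equiv0$, $\beta T_\xi=-cT+\frac{T^2}2+q_0$,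 and $T(\xi)$ has a finite limit $T_-$ as $\xi\to-\infty$ (necessarily $T_-\in\{T_0(c),T_1(c)\}$). A solution is strong if $T_-=T_0(c)$ and weak if $T_-=T_1(c)$; when $c=c^{cj}$ both notions coincide ($T_-=\sqrt{2q_0}$) and the solution is called Chapman–Jouguet. A strong (respectively weak) solution is of special type if $T\equiv T_0(c)$ (respectively $T\equiv T_1(c)$) on $\{\xi\le-\ell\}$; a Chapman–Jouguet solution is of special type if $T\equiv\sqrt{2q_0}$ on $\{\xi\le-\ell\}$. A Chapman–Jouguet wave with a bump is a Chapman–Jouguet solution with $T$ non-monotonic, having a maximum (bump) inside the reaction zone, and $T(\xi)\to\sqrt{2q_0}$ algebraically as $\xi\to-\infty$. For $c\in[c^{cj},\infty)$, $\beta_0(c)$ denotes the unique $\beta>0$ for which there is a solution of speed $c$ with $T\equiv T_0(c)$ on $\{\xi\le-\ell\}$; for $c\in[c^{cj},c_* )$, $\beta_1(c)$ denotes the unique $\beta>0$ for which there is a solution of speed $c$ with $T\equiv T_1(c)$ on $\{\xi\le-\ell\}$. *)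

theory Defs
  imports "HOL-Analysis.Analysis" "HOL-Library.Landau_Symbols"
begin

section \<open>Differentiability classes\<close>

text \<open>Derivatives are taken within the set, hence they are one-sided at end points.\<close>

definition Ck_on :: "nat \<Rightarrow> (real \<Rightarrow> 'a::real_normed_vector) \<Rightarrow> real set \<Rightarrow> bool" where
  "Ck_on k f S \<longleftrightarrow>
     (\<exists>D :: nat \<Rightarrow> real \<Rightarrow> 'a.
        (\<forall>x\<in>S. D 0 x = f x) \<and>
        (\<forall>i<k. \<forall>x\<in>S. (D i has_vector_derivative D (Suc i) x) (at x within S)) \<and>
        continuous_on S (D k))"

definition smooth_on :: "(real \<Rightarrow> 'a::real_normed_vector) \<Rightarrow> real set \<Rightarrow> bool" where
  "smooth_on f S \<longleftrightarrow> (\<forall>k. Ck_on k f S)"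

text \<open>Image of an open interval under an injective regular (nowhere vanishing velocity)
  parametrization of class \<open>C\<^sup>k\<close>. Regularity makes this a condition on the curve itself:
  without it, curves with corners would admit smooth parametrizations.\<close>

definition simple_Ck_curve :: "nat \<Rightarrow> (real \<times> real) set \<Rightarrow> bool" where
  "simple_Ck_curve k B \<longleftrightarrow>
     (\<exists>(I :: real set) (\<gamma> :: real \<Rightarrow> real \<times> real).
        open I \<and> is_interval I \<and> I \<noteq> {} \<and>
        Ck_on k \<gamma> I \<and> (\<forall>t\<in>I. vector_derivative \<gamma> (at t) \<noteq> 0) \<and>
        inj_on \<gamma> I \<and> \<gamma> ` I = B)"

section \<open>Kinetics and characteristic values\<close>

text \<open>The extension \<open>\<psi>\<close> of \<open>V \<mapsto> \<phi> (1 / V)\<close> is only required to be smooth up to \<open>V = 1 / Ti\<close>,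
  beyond which \<open>\<phi> (1 / V)\<close> vanishes; only the values of \<open>\<phi>\<close> on nonnegative arguments matter.\<close>

definition ignition_kinetics :: "real \<Rightarrow> (real \<Rightarrow> real) \<Rightarrow> bool" where
  "ignition_kinetics Ti \<phi> \<longleftrightarrow>
     (\<forall>T. 0 \<le> T \<and> T < Ti \<longrightarrow> \<phi> T = 0) \<and>
     (\<forall>T\<ge>Ti. \<phi> T > 0) \<and>
     smooth_on \<phi> {Ti..} \<and>
     (\<exists>\<psi>. smooth_on \<psi> {0..1 / Ti} \<and> (\<forall>V\<in>{0<..1 / Ti}. \<psi> V = \<phi> (1 / V)) \<and> \<psi> 0 > 0)"

definition c_cj :: "real \<Rightarrow> real" where
  "c_cj q0 = sqrt (2 * q0)"

definition c_star :: "real \<Rightarrow> real \<Rightarrow> real" where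
  "c_star q0 Ti = (Ti\<^sup>2 + 2 * q0) / (2 * Ti)"

definition T0 :: "real \<Rightarrow> real \<Rightarrow> real" where
  "T0 q0 c = c + sqrt (c\<^sup>2 - 2 * q0)"

definition T1 :: "real \<Rightarrow> real \<Rightarrow> real" where
  "T1 q0 c = c - sqrt (c\<^sup>2 - 2 * q0)"

section \<open>Reactive traveling waves\<close>

text \<open>In the reaction zone \<open>Z > 0\<close>, so \<open>Z powr \<alpha>\<close> is the usual power, equal to 1 for \<open>\<alpha> = 0\<close>.
  The reaction length \<open>L\<close> is determined by \<open>Z\<close>.\<close>

definition traveling_wave ::
    "real \<Rightarrow> real \<Rightarrow> real \<Rightarrow> real \<Rightarrow> (real \<Rightarrow> real) \<Rightarrow> real \<Rightarrow> real \<Rightarrow> real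
      \<Rightarrow> (real \<Rightarrow> real) \<Rightarrow> (real \<Rightarrow> real) \<Rightarrow> bool" where
  "traveling_wave q0 K \<alpha> Ti \<phi> \<beta> c L T Z \<longleftrightarrow>
     \<beta> > 0 \<and> c \<ge> c_cj q0 \<and> L > 0 \<and>
     Ck_on 1 T UNIV \<and> continuous_on UNIV Z \<and>
     T 0 = Ti \<and> (\<forall>\<xi>>0. T \<xi> < Ti) \<and> (\<forall>\<xi><0. T \<xi> > Ti) \<and>
     (\<forall>\<xi>>0. Z \<xi> = 1 \<and> \<beta> * deriv T \<xi> = - c * T \<xi> + (T \<xi>)\<^sup>2 / 2) \<and>
     (T \<longlongrightarrow> 0) at_top \<and>
     (\<forall>\<xi>\<in>{- L<..<0}. Z \<xi> > 0 \<and>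
        \<beta> * deriv T \<xi> = - c * T \<xi> + (T \<xi>)\<^sup>2 / 2 + q0 * (1 - Z \<xi>) \<and>
        (Z has_real_derivative K * \<phi> (T \<xi>) * Z \<xi> powr \<alpha>) (at \<xi>)) \<and>
     Z 0 = 1 \<and> Z (- L) = 0 \<and>
     (\<forall>\<xi>. \<xi> < - L \<longrightarrow> Z \<xi> = 0 \<and> \<beta> * deriv T \<xi> = - c * T \<xi> + (T \<xi>)\<^sup>2 / 2 + q0) \<and>
     (\<exists>T_minus. (T \<longlongrightarrow> T_minus) at_bot)"

definition strong_special_wave ::
    "real \<Rightarrow> real \<Rightarrow> real \<Rightarrow> real \<Rightarrow> (real \<Rightarrow> real) \<Rightarrow> real \<Rightarrow> real \<Rightarrow> real
      \<Rightarrow> (real \<Rightarrow> real) \<Rightarrow> (real \<Rightarrow> real) \<Rightarrow> bool" where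
  "strong_special_wave q0 K \<alpha> Ti \<phi> \<beta> c L T Z \<longleftrightarrow>
     traveling_wave q0 K \<alpha> Ti \<phi> \<beta> c L T Z \<and> (\<forall>\<xi>\<le>(- L). T \<xi> = T0 q0 c)"

definition weak_special_wave ::
    "real \<Rightarrow> real \<Rightarrow> real \<Rightarrow> real \<Rightarrow> (real \<Rightarrow> real) \<Rightarrow> real \<Rightarrow> real \<Rightarrow> real
      \<Rightarrow> (real \<Rightarrow> real) \<Rightarrow> (real \<Rightarrow> real) \<Rightarrow> bool" where
  "weak_special_wave q0 K \<alpha> Ti \<phi> \<beta> c L T Z \<longleftrightarrow>
     traveling_wave q0 K \<alpha> Ti \<phi> \<beta> c L T Z \<and> (\<forall>\<xi>\<le>(- L). T \<xi> = T1 q0 c)"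

definition chapman_jouguet_wave ::
    "real \<Rightarrow> real \<Rightarrow> real \<Rightarrow> real \<Rightarrow> (real \<Rightarrow> real) \<Rightarrow> real \<Rightarrow> real
      \<Rightarrow> (real \<Rightarrow> real) \<Rightarrow> (real \<Rightarrow> real) \<Rightarrow> bool" where
  "chapman_jouguet_wave q0 K \<alpha> Ti \<phi> \<beta> L T Z \<longleftrightarrow>
     traveling_wave q0 K \<alpha> Ti \<phi> \<beta> (c_cj q0) L T Z \<and> (T \<longlongrightarrow> sqrt (2 * q0)) at_bot"

definition chapman_jouguet_special_wave ::
    "real \<Rightarrow> real \<Rightarrow> real \<Rightarrow> real \<Rightarrow> (real \<Rightarrow> real) \<Rightarrow> real \<Rightarrow> real
      \<Rightarrow> (real \<Rightarrow> real) \<Rightarrow> (real \<Rightarrow> real) \<Rightarrow> bool" where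
  "chapman_jouguet_special_wave q0 K \<alpha> Ti \<phi> \<beta> L T Z \<longleftrightarrow>
     chapman_jouguet_wave q0 K \<alpha> Ti \<phi> \<beta> L T Z \<and> (\<forall>\<xi>\<le>(- L). T \<xi> = sqrt (2 * q0))"

text \<open>Algebraic convergence means that the distance to the limit is exactly of the order of a
  negative power of \<open>|\<xi>|\<close>.\<close>

definition chapman_jouguet_bump_wave ::
    "real \<Rightarrow> real \<Rightarrow> real \<Rightarrow> real \<Rightarrow> (real \<Rightarrow> real) \<Rightarrow> real \<Rightarrow> real
      \<Rightarrow> (real \<Rightarrow> real) \<Rightarrow> (real \<Rightarrow> real) \<Rightarrow> bool" where
  "chapman_jouguet_bump_wave q0 K \<alpha> Ti \<phi> \<beta> L T Z \<longleftrightarrow>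
     chapman_jouguet_wave q0 K \<alpha> Ti \<phi> \<beta> L T Z \<and>
     \<not> mono T \<and> \<not> antimono T \<and>
     (\<exists>\<xi>m\<in>{- L<..<0}. \<forall>\<xi>. T \<xi> \<le> T \<xi>m) \<and>
     (\<exists>p>0. (\<lambda>\<xi>. T \<xi> - sqrt (2 * q0)) \<in> \<Theta>[at_bot](\<lambda>\<xi>. \<bar>\<xi>\<bar> powr (- p)))"

section \<open>The curves of special waves\<close>

text \<open>The positivity of \<open>\<beta>\<close> is part of \<open>traveling_wave\<close>.\<close>

definition is_beta0 ::
    "real \<Rightarrow> real \<Rightarrow> real \<Rightarrow> real \<Rightarrow> (real \<Rightarrow> real) \<Rightarrow> real \<Rightarrow> real \<Rightarrow> bool" where
  "is_beta0 q0 K \<alpha> Ti \<phi> c \<beta> \<longleftrightarrow> (\<exists>L T Z. strong_special_wave q0 K \<alpha> Ti \<phi> \<beta> c L T Z)"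

definition is_beta1 ::
    "real \<Rightarrow> real \<Rightarrow> real \<Rightarrow> real \<Rightarrow> (real \<Rightarrow> real) \<Rightarrow> real \<Rightarrow> real \<Rightarrow> bool" where
  "is_beta1 q0 K \<alpha> Ti \<phi> c \<beta> \<longleftrightarrow> (\<exists>L T Z. weak_special_wave q0 K \<alpha> Ti \<phi> \<beta> c L T Z)"

definition beta0 ::
    "real \<Rightarrow> real \<Rightarrow> real \<Rightarrow> real \<Rightarrow> (real \<Rightarrow> real) \<Rightarrow> real \<Rightarrow> real" where
  "beta0 q0 K \<alpha> Ti \<phi> c = (THE \<beta>. is_beta0 q0 K \<alpha> Ti \<phi> c \<beta>)"

definition beta1 ::
    "real \<Rightarrow> real \<Rightarrow> real \<Rightarrow> real \<Rightarrow> (real \<Rightarrow> real) \<Rightarrow> real \<Rightarrow> real" where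
  "beta1 q0 K \<alpha> Ti \<phi> c = (THE \<beta>. is_beta1 q0 K \<alpha> Ti \<phi> c \<beta>)"

definition curve_B ::
    "real \<Rightarrow> real \<Rightarrow> real \<Rightarrow> real \<Rightarrow> (real \<Rightarrow> real) \<Rightarrow> real \<Rightarrow> (real \<times> real) set" where
  "curve_B q0 K \<alpha> Ti \<phi> \<beta>cj =
     {(beta0 q0 K \<alpha> Ti \<phi> c, c) |c. c \<ge> c_cj q0} \<union>
     {(beta1 q0 K \<alpha> Ti \<phi> c, c) |c. c_cj q0 \<le> c \<and> c < c_star q0 Ti} \<union>
     {(\<beta>cj, c_cj q0)}"

text \<open>Inside some box centred at \<open>(b, c)\<close>, the set \<open>B\<close> is exactly the graph of \<open>f\<close>.\<close>

definition locally_graph_of ::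
    "(real \<times> real) set \<Rightarrow> real \<Rightarrow> real \<Rightarrow> (real \<Rightarrow> real) \<Rightarrow> bool" where
  "locally_graph_of B b c f \<longleftrightarrow>
     (\<exists>\<epsilon>>0. \<exists>\<delta>>0. \<forall>x\<in>ball b \<epsilon>.
        f x \<in> ball c \<delta> \<and> (\<forall>y\<in>ball c \<delta>. (x, y) \<in> B \<longleftrightarrow> y = f x))"

text \<open>The second derivative is only required at the point itself, since for small exponents the
  curve is merely of class \<open>C\<^sup>1\<close>.\<close>

definition quadratic_minimum :: "(real \<Rightarrow> real) \<Rightarrow> real \<Rightarrow> bool" where
  "quadratic_minimum f b \<longleftrightarrow>
     (\<forall>\<^sub>F x in nhds b. f differentiable at x) \<and> deriv f b = 0 \<and>
     deriv f differentiable at b \<and> deriv (deriv f) b > 0"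

end

theory Submission
  imports Defs "HOL-Real_Asymp.Real_Asymp"
begin

text \<open>Why the theorem holds. The progress of the reaction is measured by
\<open>x = 1 - Z powr (1 - \<alpha>)\<close>, which grows from \<open>0\<close> at the ignition point to \<open>1\<close> at the end of the
reaction zone. This removes the power \<open>Z powr \<alpha>\<close>: with \<open>\<kappa> = (1 - \<alpha>) * K\<close>, \<open>p = 1 / (1 - \<alpha>)\<close> and
\<open>b = 1 / (\<beta> * \<kappa>)\<close> the progress satisfies \<open>x' = - \<kappa> * \<phi> T\<close>, and the temperature as a function of \<open>x\<close>
solves one scalar equation, \<open>\<phi> T * T' = b * (c * T - T\<^sup>2 / 2 - q0 + q0 * (1 - x) powr p)\<close> with
\<open>T 0 = Ti\<close>. Waves are the solutions of this equation that stay above \<open>Ti\<close>, continued by explicit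
solutions on both sides (\<open>wave_imp_special\<close>, \<open>orbit_imp_wave\<close>).

A special wave is a solution that ends, at \<open>x = 1\<close>, in a root \<open>\<theta>\<close> of \<open>c * T - T\<^sup>2 / 2 - q0\<close>; hence
\<open>c = \<theta> / 2 + q0 / \<theta>\<close>. Indexing special waves by their burnt temperature \<open>\<theta> > Ti\<close> unites the two
families: \<open>\<theta> \<ge> sqrt (2 * q0)\<close> gives the strong waves, \<open>\<theta> \<le> sqrt (2 * q0)\<close> the weak ones, and they meet
in the Chapman-Jouguet wave. The set \<open>(B)\<close> is therefore the image of a single map
\<open>\<theta> \<mapsto> (\<beta> \<theta>, c \<theta>)\<close> on \<open>{Ti<..}\<close>.

Two facts carry the analysis. First, the right-hand side is positive along a solution ending in \<open>\<theta>\<close>,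
because after multiplication by an integrating factor it decreases to \<open>0\<close> at \<open>x = 1\<close>
(\<open>excess_pos\<close>); so \<open>T\<close> increases from \<open>Ti\<close> to \<open>\<theta>\<close>. Second, with \<open>\<Phi>\<close> an antiderivative of \<open>\<phi>\<close>, the
difference of \<open>\<Phi> T\<close> for two solutions with different parameters satisfies a linear equation exactly
and is given by an integral formula (\<open>orbit_difference\<close>). The formula shows that \<open>T 1\<close> grows with \<open>b\<close>,
which gives uniqueness of \<open>\<beta>\<close> and injectivity of the curve; existence follows by shooting backwards
from \<open>T 1 = \<theta>\<close> and the intermediate value theorem in \<open>b\<close> (\<open>special_exists\<close>). Dividing the formula by
the difference of the parameters shows that \<open>b\<close> and \<open>T x\<close> are differentiable in \<open>\<theta>\<close>, with derivatives
expressed through \<open>b\<close>, \<open>T\<close> and integrals in \<open>x\<close> (\<open>coeff_profile_deriv\<close>). Every order of smoothness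
follows by induction, because \<open>x\<close> enters only as a continuous parameter (\<open>coeff_profile_smooth\<close>).

At \<open>\<theta> = sqrt (2 * q0)\<close> the speed \<open>c\<close> has a nondegenerate minimum while \<open>\<beta>\<close> is strictly decreasing;
solving for \<open>\<theta>\<close> as a function of \<open>\<beta>\<close> gives the quadratic minimum of \<open>c\<close> (\<open>curve_quadratic_minimum\<close>).
If \<open>c\<close> is the Chapman-Jouguet speed and \<open>\<beta>\<close> is below its critical value, \<open>b\<close> is larger and the solution
overshoots \<open>sqrt (2 * q0)\<close>; near \<open>x = 1\<close> the right-hand side is then negative, so there is an interior
maximum, and behind the zone \<open>T - sqrt (2 * q0)\<close> is the reciprocal of an affine function of \<open>\<xi>\<close>
(\<open>bump_wave_exists\<close>).\<close>

section \<open>One-variable calculus and scalar differential equations\<close>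

lemma integral_pos:
  fixes g :: "real \<Rightarrow> real"
  assumes "continuous_on {0..x} g" "0 < x" "\<And>t. 0 < t \<Longrightarrow> t < x \<Longrightarrow> 0 < g t"
  shows "0 < integral {0..x} g"
proof -
  define G where "G = (\<lambda>t. integral {0..t} g)"
  have G: "(G has_real_derivative g t) (at t within {0..x})" if "t \<in> {0..x}" for t
    unfolding G_def using integral_has_real_derivative[OF assms(1) that] .
  have "G 0 < G x"
  proof (rule DERIV_pos_imp_increasing_open[OF assms(2)])
    fix t assume t: "0 < t" "t < x"
    hence "at t within {0..x} = at t" by (intro at_within_interior) auto
    thus "\<exists>y. (G has_real_derivative y) (at t) \<and> 0 < y" using G[of t] t assms(3) by auto
  qed (use DERIV_continuous_on[OF G] in auto)
  thus ?thesis by (simp add: G_def)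
qed

lemma at_within_unit_interval: "0 < x \<Longrightarrow> x < 1 \<Longrightarrow> at x within {0..1} = at (x :: real)"
  by (intro at_within_interior) auto

text \<open>Hadamard's form of differentiability: a factorization of the increment with a continuous factor.\<close>

lemma DERIV_from_quotient:
  fixes f g :: "real \<Rightarrow> real"
  assumes I: "open I" "x \<in> I" and g: "continuous_on I g"
    and eq: "\<And>y. y \<in> I \<Longrightarrow> f y - f x = (y - x) * g y"
  shows "(f has_real_derivative g x) (at x)"
  unfolding has_field_derivative_iff
proof (rule Lim_transform_within_open[OF _ I])
  show "(g \<longlongrightarrow> g x) (at x)"
    using g I continuous_on_eq_continuous_at[OF I(1), of g] by (simp add: isCont_def)
  show "g y = (f y - f x) / (y - x)" if "y \<in> I" "y \<noteq> x" for y
    using eq[OF that(1)] that(2) by simp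
qed

text \<open>At a zero of the first factor the product rule asks only for continuity of the second one. This yields
the second derivative of \<open>c\<close> with respect to \<open>\<beta>\<close> from one derivative of \<open>\<beta>\<close> with respect to \<open>\<theta>\<close>.\<close>

lemma DERIV_mult_at_zero:
  fixes f h :: "real \<Rightarrow> real"
  assumes f: "(f has_real_derivative d) (at x)" "f x = 0" and h: "isCont h x"
  shows "((\<lambda>t. f t * h t) has_real_derivative d * h x) (at x)"
  unfolding has_field_derivative_iff
proof -
  have "((\<lambda>t. (f t - f x) / (t - x) * h t) \<longlongrightarrow> d * h x) (at x)"
    using f(1) h unfolding has_field_derivative_iff isCont_def by (intro tendsto_mult)
  thus "((\<lambda>t. (f t * h t - f x * h x) / (t - x)) \<longlongrightarrow> d * h x) (at x)"
    using f(2) by simp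
qed

lemma integral_abs_le:
  fixes f :: "real \<Rightarrow> real"
  assumes f: "continuous_on {0..1} f" and B: "\<And>t. t \<in> {0..1} \<Longrightarrow> \<bar>f t\<bar> \<le> B" and x: "x \<in> {0..1}"
  shows "\<bar>integral {0..x} f\<bar> \<le> B"
proof -
  have "norm (integral {0..x} f) \<le> B * (x - 0)"
    by (rule integral_bound) (use x B in \<open>auto intro: continuous_on_subset[OF f]\<close>)
  also have "\<dots> \<le> B" using x B[OF x] mult_left_le[of x B] by simp
  finally show ?thesis by simp
qed

text \<open>The change of variable between position and reaction progress, in either direction. Differentiability is
confined to the interior, because the powers of \<open>Z\<close> may have no derivative at the ends of the reaction zone.\<close>

lemma increasing_inverse:
  fixes X X' :: "real \<Rightarrow> real"
  assumes M: "0 \<le> M" and cont: "continuous_on {0..M} X" and X0: "X 0 = 0"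
    and der: "\<And>s. 0 < s \<Longrightarrow> s < M \<Longrightarrow> (X has_real_derivative X' s) (at s)"
    and pos: "\<And>s. 0 < s \<Longrightarrow> s < M \<Longrightarrow> X' s > 0"
  obtains g where "continuous_on {0..X M} g" "\<And>s. s \<in> {0..M} \<Longrightarrow> g (X s) = s"
    "\<And>s. s \<in> {0..M} \<Longrightarrow> X s \<in> {0..X M}"
    "\<And>x. x \<in> {0..X M} \<Longrightarrow> g x \<in> {0..M} \<and> X (g x) = x"
    "\<And>x. 0 < x \<Longrightarrow> x < X M \<Longrightarrow>
       0 < g x \<and> g x < M \<and> (g has_real_derivative inverse (X' (g x))) (at x)"
proof -
  have strict: "X s < X t" if "0 \<le> s" "s < t" "t \<le> M" for s t
  proof (rule DERIV_pos_imp_increasing_open[OF that(2)])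
    show "\<exists>y. (X has_real_derivative y) (at u) \<and> 0 < y" if "s < u" "u < t" for u
      using der[of u] pos[of u] that \<open>0 \<le> s\<close> \<open>t \<le> M\<close> by auto
    show "continuous_on {s..t} X" by (rule continuous_on_subset[OF cont]) (use that in auto)
  qed
  have inj: "inj_on X {0..M}"
  proof (rule inj_onI)
    fix s t assume "s \<in> {0..M}" "t \<in> {0..M}" "X s = X t"
    thus "s = t" using strict[of s t] strict[of t s] by (cases s t rule: linorder_cases) auto
  qed
  define g where "g = inv_into {0..M} X"
  have gX: "g (X s) = s" if "s \<in> {0..M}" for s unfolding g_def by (rule inv_into_f_f[OF inj that])
  have rng: "X s \<in> {0..X M}" if "s \<in> {0..M}" for s
    using strict[of 0 s] strict[of s M] X0 that by (cases "s = 0"; cases "s = M") auto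
  have img: "X ` {0..M} = {0..X M}"
  proof
    show "{0..X M} \<subseteq> X ` {0..M}"
    proof
      fix y assume "y \<in> {0..X M}"
      then obtain s where "0 \<le> s" "s \<le> M" "X s = y"
        using IVT'[of X 0 y M] X0 M cont by auto
      thus "y \<in> X ` {0..M}" by auto
    qed
  qed (use rng in auto)
  have Xg: "g x \<in> {0..M} \<and> X (g x) = x" if "x \<in> {0..X M}" for x
    using that unfolding img[symmetric] g_def by (auto simp: inv_into_into f_inv_into_f gX[unfolded g_def])
  have cg: "continuous_on {0..X M} g"
    unfolding img[symmetric] by (rule continuous_on_inv[OF cont]) (use gX in auto)
  have "0 < g x \<and> g x < M \<and> (g has_real_derivative inverse (X' (g x))) (at x)"
    if x: "0 < x" "x < X M" for x
  proof -
    have g: "g x \<in> {0..M}" "X (g x) = x" using Xg[of x] x by auto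
    hence g': "0 < g x" "g x < M" using x X0 by (cases "g x = 0"; cases "g x = M"; force)+
    have "(g has_real_derivative inverse (X' (g x))) (at x)"
    proof (rule DERIV_inverse_function[where a = 0 and b = "X M" and f = X])
      show "isCont g x"
        by (rule continuous_on_interior[OF cg]) (use x in auto)
      show "X (g y) = y" if "0 < y" "y < X M" for y using Xg[of y] that by auto
    qed (use der[OF g'] pos[OF g'] x in auto)
    with g' show ?thesis by blast
  qed
  with cg gX rng Xg show ?thesis by (rule that)
qed

text \<open>Pieces of a wave profile join to a differentiable function as soon as the function and the right-hand
side of its equation are continuous: the function is then an integral of the right-hand side.\<close>

lemma has_real_derivative_across_finite:
  fixes f D :: "real \<Rightarrow> real"
  assumes f: "continuous_on UNIV f" and D: "continuous_on UNIV D" and S: "finite S"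
    and der: "\<And>x. x \<notin> S \<Longrightarrow> (f has_real_derivative D x) (at x)"
  shows "(f has_real_derivative D x) (at x)"
proof -
  define a b where "a = x - 1" and "b = x + 1"
  have int: "(D has_integral f t - f a) {a..t}" if "a \<le> t" for t
    by (rule fundamental_theorem_of_calculus_strong[OF S that])
       (use der in \<open>auto intro: continuous_on_subset[OF f] simp flip: has_real_derivative_iff_has_vector_derivative\<close>)
  have "((\<lambda>t. integral {a..t} D) has_real_derivative D x) (at x within {a..b})"
    by (rule integral_has_real_derivative) (auto intro: continuous_on_subset[OF D] simp: a_def b_def)
  moreover have "at x within {a..b} = at x"
    by (rule at_within_interior) (auto simp: a_def b_def)
  ultimately have "((\<lambda>t. f a + integral {a..t} D) has_real_derivative 0 + D x) (at x)"
    by (intro DERIV_add DERIV_const) simp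
  hence "((\<lambda>t. f a + integral {a..t} D) has_real_derivative D x) (at x)" by simp
  thus ?thesis
  proof (rule has_field_derivative_transform_within_open[where S = "{a<..<b}"])
    show "f a + integral {a..t} D = f t" if "t \<in> {a<..<b}" for t
      using int[of t] that by (simp add: integral_unique)
  qed (auto simp: a_def b_def)
qed

text \<open>On the last interval on which \<open>d\<close> is negative, \<open>exp (- M * x) * d x\<close> would be nondecreasing and would start
at a nonnegative value. The differential inequality concerns only points with \<open>d x < 0\<close>, so it can be
checked with the values that a truncated vector field takes beyond the barrier.\<close>

lemma barrier_nonneg:
  fixes d d' :: "real \<Rightarrow> real"
  assumes cont: "continuous_on {a..b} d" and init: "0 \<le> d a"
    and der: "\<And>x. a < x \<Longrightarrow> x < b \<Longrightarrow> d x < 0 \<Longrightarrow>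
      (d has_real_derivative d' x) (at x) \<and> M * d x \<le> d' x"
    and x: "x \<in> {a..b}"
  shows "0 \<le> d x"
proof (rule ccontr)
  assume "\<not> 0 \<le> d x"
  hence neg: "d x < 0" by simp
  define S where "S = {a..x} \<inter> d -` {0..}"
  have cx: "continuous_on {a..x} d" using cont x by (auto intro: continuous_on_subset)
  have "closed S" unfolding S_def
    by (intro continuous_closed_preimage cx) auto
  moreover have "S \<noteq> {}" "bdd_above S" using init x by (auto simp: S_def)
  ultimately have x0: "Sup S \<in> S" by (rule closed_contains_Sup[rotated 2])
  define x0 where "x0 = Sup S"
  have x0S: "a \<le> x0" "x0 \<le> x" "0 \<le> d x0" using x0 by (auto simp: S_def x0_def)
  have lt: "d t < 0" if "x0 < t" "t \<le> x" for t
  proof (rule ccontr)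
    assume "\<not> d t < 0"
    hence "t \<in> S" using that x0S by (auto simp: S_def)
    hence "t \<le> x0" unfolding x0_def by (rule cSup_upper) (fact \<open>bdd_above S\<close>)
    thus False using that by simp
  qed
  have "exp (- M * x0) * d x0 \<le> exp (- M * x) * d x"
  proof (rule DERIV_nonneg_imp_increasing_open[OF x0S(2)])
    fix t assume t: "x0 < t" "t < x"
    have D: "(d has_real_derivative d' t) (at t)" "M * d t \<le> d' t"
      using der[of t] lt[of t] t x0S x by auto
    have "((\<lambda>t. exp (- M * t) * d t) has_real_derivative
        exp (- M * t) * (d' t - M * d t)) (at t)"
      by (auto intro!: derivative_eq_intros D(1) simp: algebra_simps)
    moreover have "0 \<le> exp (- M * t) * (d' t - M * d t)" using D(2) by simp
    ultimately show "\<exists>y. ((\<lambda>t. exp (- M * t) * d t) has_real_derivative y) (at t) \<and> 0 \<le> y"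
      by blast
  next
    show "continuous_on {x0..x} (\<lambda>t. exp (- M * t) * d t)"
      using x0S by (intro continuous_intros continuous_on_subset[OF cx]) auto
  qed
  moreover have "0 \<le> exp (- M * x0) * d x0" using x0S by simp
  moreover have "exp (- M * x) * d x < 0" using neg by (simp add: mult_less_0_iff)
  ultimately show False by linarith
qed

text \<open>Variation of constants for \<open>d' = a * d + h\<close>, \<open>d 0 = 0\<close>.\<close>

lemma linear_ode_formula:
  fixes a d h :: "real \<Rightarrow> real"
  assumes d: "continuous_on {0..1} d" "d 0 = 0"
    and a: "continuous_on {0..1} a" and h: "continuous_on {0..1} h"
    and der: "\<And>x. 0 < x \<Longrightarrow> x < 1 \<Longrightarrow> (d has_real_derivative a x * d x + h x) (at x)"
    and x: "x \<in> {0..1}"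
  shows "exp (- integral {0..x} a) * d x =
    integral {0..x} (\<lambda>t. exp (- integral {0..t} a) * h t)"
proof -
  define A where "A = (\<lambda>t. integral {0..t} a)"
  have A: "(A has_real_derivative a t) (at t within {0..1})" if "t \<in> {0..1}" for t
    unfolding A_def using integral_has_real_derivative[OF a that] .
  have cA: "continuous_on {0..1} A"
    by (rule DERIV_continuous_on) (rule A)
  have "((\<lambda>t. exp (- A t) * h t) has_integral exp (- A x) * d x - exp (- A 0) * d 0) {0..x}"
  proof (rule fundamental_theorem_of_calculus_interior)
    show "continuous_on {0..x} (\<lambda>t. exp (- A t) * d t)"
      using x by (intro continuous_intros continuous_on_subset[OF cA] continuous_on_subset[OF d(1)]) auto
    fix t assume t: "t \<in> {0<..<x}"
    hence "at t within {0..1} = at t" using x by (intro at_within_interior) auto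
    hence At: "(A has_real_derivative a t) (at t)" using A[of t] t x by auto
    have dt: "(d has_real_derivative a t * d t + h t) (at t)" using der[of t] t x by auto
    have "((\<lambda>t. exp (- A t) * d t) has_real_derivative exp (- A t) * h t) (at t)"
      by (auto intro!: derivative_eq_intros At dt simp: algebra_simps)
    thus "((\<lambda>t. exp (- A t) * d t) has_vector_derivative exp (- A t) * h t) (at t)"
      by (simp add: has_real_derivative_iff_has_vector_derivative)
  qed (use x in auto)
  thus ?thesis using d(2) by (simp add: A_def integral_unique)
qed

text \<open>Banach's fixed point theorem for \<open>v x = exp (- m * x) * u x\<close> with \<open>m = L + 1\<close>. The exponential weight
makes the integral operator a contraction with constant \<open>L / m\<close> on the whole interval at once, so no
continuation of local solutions occurs.\<close>

lemma picard_global: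
  fixes f :: "real \<Rightarrow> real \<Rightarrow> real"
  assumes cont: "continuous_on ({0..1} \<times> UNIV) (\<lambda>(x, y). f x y)"
    and lip: "\<And>x y z. x \<in> {0..1} \<Longrightarrow> \<bar>f x y - f x z\<bar> \<le> L * \<bar>y - z\<bar>" and L: "0 \<le> L"
  shows "\<exists>u. u 0 = a \<and> (\<forall>x\<in>{0..1}. (u has_real_derivative f x (u x)) (at x within {0..1}))"
proof -
  define m where "m = L + 1"
  have m: "m > 0" using L by (simp add: m_def)
  \<comment> \<open>Clamping to the interval turns functions on it into bounded continuous functions on the line.\<close>
  define r where "r = (\<lambda>x::real. max 0 (min 1 x))"
  have r: "r x \<in> {0..1}" for x by (auto simp: r_def)
  have rid: "r x = x" if "x \<in> {0..1}" for x using that by (auto simp: r_def)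
  have contr: "continuous_on UNIV r" unfolding r_def by (intro continuous_intros)
  define F where "F = (\<lambda>(v :: real \<Rightarrow>\<^sub>C real) s. f s (exp (m * s) * apply_bcontfun v s))"
  have contF: "continuous_on {0..1} (F v)" for v
  proof -
    have "continuous_on {0..1} (\<lambda>s. (s, exp (m * s) * apply_bcontfun v s))"
      by (intro continuous_intros continuous_on_apply_bcontfun)
    hence "continuous_on {0..1} ((\<lambda>(x, y). f x y) \<circ> (\<lambda>s. (s, exp (m * s) * apply_bcontfun v s)))"
      by (intro continuous_on_compose continuous_on_subset[OF cont]) auto
    thus ?thesis by (simp add: F_def o_def)
  qed
  have intF: "F v integrable_on {0..t}" if "t \<in> {0..1}" for v t
    using that by (intro integrable_continuous_real continuous_on_subset[OF contF]) auto
  define G where "G = (\<lambda>v t. exp (- m * t) * (a + integral {0..t} (F v)))"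
  have contG: "continuous_on {0..1} (G v)" for v
    unfolding G_def
    by (intro continuous_intros indefinite_integral_continuous_1 intF) auto
  have Gb: "(\<lambda>x. G v (r x)) \<in> bcontfun" for v
  proof -
    have "continuous_on UNIV (G v \<circ> r)"
      by (intro continuous_on_compose contr continuous_on_subset[OF contG]) (use r in auto)
    moreover have "bounded (G v ` {0..1})"
      by (intro compact_imp_bounded compact_continuous_image contG) auto
    hence "bounded (range (\<lambda>x. G v (r x)))"
      by (rule bounded_subset) (use r in auto)
    ultimately show ?thesis by (simp add: bcontfun_def o_def)
  qed
  define P where "P = (\<lambda>v. Bcontfun (\<lambda>x. G v (r x)))"
  have P: "apply_bcontfun (P v) x = G v (r x)" for v x
    using Gb by (simp add: P_def Bcontfun_inverse)
  have contraction: "dist (P v) (P w) \<le> L / m * dist v w" for v w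
  proof (rule dist_bound)
    fix x
    define t where "t = r x"
    have t: "t \<in> {0..1}" using r by (simp add: t_def)
    define D where "D = dist v w"
    have "norm (integral {0..t} (\<lambda>s. F v s - F w s)) \<le> integral {0..t} (\<lambda>s. L * D * exp (m * s))"
    proof (rule integral_norm_bound_integral)
      show "(\<lambda>s. F v s - F w s) integrable_on {0..t}"
        using t by (intro integrable_diff intF)
      show "(\<lambda>s. L * D * exp (m * s)) integrable_on {0..t}"
        by (intro integrable_continuous_real continuous_intros)
      fix s assume s: "s \<in> {0..t}"
      have "\<bar>F v s - F w s\<bar> \<le> L * \<bar>exp (m * s) * apply_bcontfun v s - exp (m * s) * apply_bcontfun w s\<bar>"
        unfolding F_def using s t by (intro lip) auto
      also have "\<dots> = L * (exp (m * s) * dist (apply_bcontfun v s) (apply_bcontfun w s))"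
        by (simp add: dist_real_def abs_mult flip: right_diff_distrib)
      also have "\<dots> \<le> L * (exp (m * s) * D)"
        unfolding D_def using L by (intro mult_left_mono dist_bounded) auto
      finally show "norm (F v s - F w s) \<le> L * D * exp (m * s)" by (simp add: mult_ac)
    qed
    also have "integral {0..t} (\<lambda>s. L * D * exp (m * s)) = L * D * ((exp (m * t) - 1) / m)"
    proof -
      have "((\<lambda>s. exp (m * s)) has_integral exp (m * t) / m - exp (m * 0) / m) {0..t}"
        using t m by (intro fundamental_theorem_of_calculus)
          (auto intro!: derivative_eq_intros simp flip: has_real_derivative_iff_has_vector_derivative)
      hence "integral {0..t} (\<lambda>s. exp (m * s)) = (exp (m * t) - 1) / m"
        by (simp add: integral_unique diff_divide_distrib)
      thus ?thesis by simp
    qed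
    also have "\<dots> \<le> L * D * (exp (m * t) / m)"
      using L m by (intro mult_left_mono divide_right_mono) (auto simp: D_def)
    finally have *: "\<bar>integral {0..t} (F v) - integral {0..t} (F w)\<bar> \<le> L * D * (exp (m * t) / m)"
      using intF[OF t] by (simp add: integral_diff)
    have "dist (apply_bcontfun (P v) x) (apply_bcontfun (P w) x) =
        exp (- m * t) * \<bar>integral {0..t} (F v) - integral {0..t} (F w)\<bar>"
      by (simp add: P G_def dist_real_def abs_mult t_def flip: right_diff_distrib)
    also have "\<dots> \<le> exp (- m * t) * (L * D * (exp (m * t) / m))"
      by (intro mult_left_mono *) auto
    also have "\<dots> = L / m * D" using m by (simp add: exp_minus field_simps)
    finally show "dist (apply_bcontfun (P v) x) (apply_bcontfun (P w) x) \<le> L / m * dist v w"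
      by (simp add: D_def)
  qed
  have "\<exists>!v. P v = v"
    by (rule banach_fix_type[of "L / m"]) (use L m contraction in \<open>auto simp: m_def\<close>)
  then obtain v where v: "P v = v" by blast
  define u where "u = (\<lambda>x. exp (m * x) * apply_bcontfun v x)"
  have u: "u x = a + integral {0..x} (F v)" if "x \<in> {0..1}" for x
  proof -
    have "apply_bcontfun v x = exp (- m * x) * (a + integral {0..x} (F v))"
      using P[of v x] v rid[OF that] by (simp add: G_def)
    thus ?thesis by (simp add: u_def exp_minus field_simps)
  qed
  have "(u has_real_derivative f x (u x)) (at x within {0..1})" if x: "x \<in> {0..1}" for x
  proof -
    have "((\<lambda>t. a + integral {0..t} (F v)) has_real_derivative 0 + F v x) (at x within {0..1})"
      by (intro DERIV_add DERIV_const integral_has_real_derivative contF x)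
    moreover have "F v x = f x (u x)" by (simp add: F_def u_def)
    ultimately have "((\<lambda>t. a + integral {0..t} (F v)) has_real_derivative f x (u x)) (at x within {0..1})"
      by simp
    thus ?thesis
      unfolding has_field_derivative_def
      by (rule has_derivative_transform[OF x, rotated]) (use u in auto)
  qed
  moreover have "u 0 = a" using u[of 0] by simp
  ultimately show ?thesis by blast
qed

text \<open>Shooting varies the factor \<open>b\<close> and relies on the continuity of the end value \<open>u b 1\<close>, which is a Gronwall
estimate for the square of the difference of two solutions.\<close>

lemma ode_family:
  fixes g w :: "real \<Rightarrow> real"
  assumes lip: "\<And>y z. \<bar>g y - g z\<bar> \<le> L * \<bar>y - z\<bar>" and L: "0 \<le> L"
    and w: "continuous_on {0..1} w"
  obtains u :: "real \<Rightarrow> real \<Rightarrow> real" where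
    "\<And>b. u b 0 = a"
    "\<And>b x. x \<in> {0..1} \<Longrightarrow> (u b has_real_derivative b * (g (u b x) + w x)) (at x within {0..1})"
    "continuous_on UNIV (\<lambda>b. u b 1)"
proof -
  have contg: "continuous_on S g" for S
    by (rule lipschitz_on_continuous_on[of L])
       (use lip L in \<open>auto simp: lipschitz_on_def dist_real_def\<close>)
  have "\<exists>u. u 0 = a \<and> (\<forall>x\<in>{0..1}. (u has_real_derivative b * (g (u x) + w x)) (at x within {0..1}))"
    for b
  proof (rule picard_global[where f = "\<lambda>x y. b * (g y + w x)"])
    have "continuous_on ({0..1} \<times> UNIV) (\<lambda>z. b * (g (snd z) + w (fst z)) :: real)"
      by (intro continuous_intros continuous_on_compose2[OF contg]
            continuous_on_compose2[OF w]) auto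
    thus "continuous_on ({0..1} \<times> UNIV) (\<lambda>(x, y). b * (g y + w x))"
      by (simp add: case_prod_unfold)
    show "\<bar>b * (g y + w x) - b * (g z + w x)\<bar> \<le> \<bar>b\<bar> * L * \<bar>y - z\<bar>" for x y z
    proof -
      have "b * (g y + w x) - b * (g z + w x) = b * (g y - g z)" by (simp add: algebra_simps)
      thus ?thesis using mult_left_mono[OF lip[of y z], of "\<bar>b\<bar>"]
        by (simp add: abs_mult mult.assoc)
    qed
  qed (use L in auto)
  then obtain u where u: "\<And>b. u b 0 = a"
    "\<And>b x. x \<in> {0..1} \<Longrightarrow> (u b has_real_derivative b * (g (u b x) + w x)) (at x within {0..1})"
    by metis
  have contu: "continuous_on {0..1} (u b)" for b
    by (rule DERIV_continuous_on) (rule u(2))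
  have "isCont (\<lambda>b. u b 1) b0" for b0
  proof -
    have "compact ((\<lambda>x. g (u b0 x) + w x) ` {0..1})"
      by (intro compact_continuous_image continuous_intros continuous_on_compose2[OF contg]
            contu w) auto
    hence "\<exists>C. \<forall>x\<in>{0..1}. \<bar>g (u b0 x) + w x\<bar> \<le> C"
      by (auto dest!: compact_imp_bounded simp: bounded_iff)
    then obtain C where C: "\<And>x. x \<in> {0..1} \<Longrightarrow> \<bar>g (u b0 x) + w x\<bar> \<le> C" by blast
    \<comment> \<open>With \<open>e\<close> a bound for the perturbation, \<open>(d\<^sup>2)' \<le> k * d\<^sup>2 + e\<^sup>2\<close>; here \<open>\<bar>b\<bar>\<close> is replaced by \<open>\<bar>b0\<bar> + 1\<close>.\<close>
    define k where "k = 2 * (\<bar>b0\<bar> + 1) * L + 1"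
    have est: "(u b 1 - u b0 1)\<^sup>2 \<le> (b - b0)\<^sup>2 * (C\<^sup>2 * exp k)" if b: "\<bar>b - b0\<bar> < 1" for b
    proof -
      define d where "d = (\<lambda>x. u b x - u b0 x)"
      define e where "e = \<bar>b - b0\<bar> * C"
      define h where "h = (\<lambda>x. exp (- k * x) * (d x)\<^sup>2 - e\<^sup>2 * x)"
      have "h 1 \<le> h 0"
      proof (rule DERIV_nonpos_imp_decreasing_open[of 0 1 h])
        show "continuous_on {0..1} h"
          unfolding h_def d_def by (intro continuous_intros contu)
        fix x :: real assume x: "0 < x" "x < 1"
        hence within: "at x within {0..1} = at x" by (intro at_within_interior) auto
        define d' where "d' = b * (g (u b x) + w x) - b0 * (g (u b0 x) + w x)"
        have d': "(d has_real_derivative d') (at x)"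
          unfolding d_def d'_def using u(2)[of x b] u(2)[of x b0] x
          by (intro DERIV_diff) (auto simp: within)
        have D: "(h has_real_derivative
            exp (- k * x) * (2 * d x * d') - k * exp (- k * x) * (d x)\<^sup>2 - e\<^sup>2) (at x)"
          unfolding h_def by (auto intro!: derivative_eq_intros d' simp: algebra_simps)
        have "d' = b * (g (u b x) - g (u b0 x)) + (b - b0) * (g (u b0 x) + w x)"
          by (simp add: d'_def algebra_simps)
        also have "\<bar>\<dots>\<bar> \<le> \<bar>b\<bar> * (L * \<bar>d x\<bar>) + e"
          unfolding e_def d_def
          by (rule order_trans[OF abs_triangle_ineq], unfold abs_mult)
             (intro add_mono mult_left_mono lip C, use x in auto)
        also have "\<dots> \<le> (\<bar>b0\<bar> + 1) * (L * \<bar>d x\<bar>) + e"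
          using b L by (intro add_mono mult_right_mono) auto
        finally have "2 * \<bar>d x\<bar> * \<bar>d'\<bar> \<le> 2 * \<bar>d x\<bar> * ((\<bar>b0\<bar> + 1) * (L * \<bar>d x\<bar>) + e)"
          by (intro mult_left_mono) auto
        also have "\<dots> = (2 * (\<bar>b0\<bar> + 1) * L) * (d x)\<^sup>2 + 2 * \<bar>d x\<bar> * e"
        proof -
          have "(d x)\<^sup>2 = \<bar>d x\<bar>\<^sup>2" by simp
          thus ?thesis by (simp only: power2_eq_square) (simp add: algebra_simps)
        qed
        also have "2 * \<bar>d x\<bar> * e \<le> (d x)\<^sup>2 + e\<^sup>2"
          using sum_squares_bound[of "\<bar>d x\<bar>" e] by simp
        finally have "2 * \<bar>d x\<bar> * \<bar>d'\<bar> \<le> k * (d x)\<^sup>2 + e\<^sup>2"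
          by (simp add: k_def algebra_simps)
        moreover have "2 * d x * d' \<le> 2 * \<bar>d x\<bar> * \<bar>d'\<bar>"
          using abs_ge_self[of "d x * d'"] by (simp add: abs_mult)
        ultimately have "2 * d x * d' - k * (d x)\<^sup>2 \<le> e\<^sup>2" by linarith
        hence "exp (- k * x) * (2 * d x * d' - k * (d x)\<^sup>2) \<le> exp (- k * x) * e\<^sup>2"
          by (intro mult_left_mono) auto
        also have "\<dots> \<le> 1 * e\<^sup>2"
        proof (rule mult_right_mono)
          have "0 \<le> k" using L by (simp add: k_def)
          thus "exp (- k * x) \<le> 1" using x by simp
        qed simp
        finally have "exp (- k * x) * (2 * d x * d') - k * exp (- k * x) * (d x)\<^sup>2 - e\<^sup>2 \<le> 0"
          by (simp add: algebra_simps)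
        thus "\<exists>y. (h has_real_derivative y) (at x) \<and> y \<le> 0" using D by blast
      qed auto
      hence "exp (- k) * (d 1)\<^sup>2 \<le> e\<^sup>2" by (simp add: h_def d_def u)
      hence "(d 1)\<^sup>2 \<le> e\<^sup>2 * exp k" by (simp add: exp_minus field_simps)
      thus ?thesis by (simp add: d_def e_def power_mult_distrib mult_ac)
    qed
    have "((\<lambda>b. (u b 1 - u b0 1)\<^sup>2) \<longlongrightarrow> 0) (at b0)"
    proof (rule tendsto_sandwich[where f = "\<lambda>_. 0"])
      show "\<forall>\<^sub>F b in at b0. (u b 1 - u b0 1)\<^sup>2 \<le> (b - b0)\<^sup>2 * (C\<^sup>2 * exp k)"
        using est by (auto simp: eventually_at dist_real_def intro!: exI[of _ 1])
      show "((\<lambda>b. (b - b0)\<^sup>2 * (C\<^sup>2 * exp k)) \<longlongrightarrow> 0) (at b0)"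
        by (auto intro!: tendsto_eq_intros)
    qed auto
    from tendsto_real_sqrt[OF this] have "((\<lambda>b. u b 1 - u b0 1) \<longlongrightarrow> 0) (at b0)"
      by (simp add: tendsto_rabs_zero_iff)
    thus ?thesis unfolding isCont_def by (simp add: LIM_zero_iff)
  qed
  hence "continuous_on UNIV (\<lambda>b. u b 1)" by (simp add: continuous_at_imp_continuous_on)
  with u show ?thesis by (intro that[of u]) auto
qed

section \<open>Functions that depend smoothly on a parameter\<close>

lemma Ck_on_0: "Ck_on 0 f S \<longleftrightarrow> continuous_on S f"
proof
  assume "Ck_on 0 f S"
  then obtain D :: "nat \<Rightarrow> real \<Rightarrow> 'a" where "\<forall>x\<in>S. D 0 x = f x" "continuous_on S (D 0)"
    by (auto simp: Ck_on_def)
  thus "continuous_on S f" by (metis continuous_on_cong)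
next
  assume "continuous_on S f"
  thus "Ck_on 0 f S" unfolding Ck_on_def by (intro exI[of _ "\<lambda>i. f"]) auto
qed

lemma Ck_on_Suc_iff:
  "Ck_on (Suc n) f S \<longleftrightarrow>
     (\<exists>f'. (\<forall>x\<in>S. (f has_vector_derivative f' x) (at x within S)) \<and> Ck_on n f' S)"
proof
  assume "Ck_on (Suc n) f S"
  then obtain D :: "nat \<Rightarrow> real \<Rightarrow> 'a" where D: "\<forall>x\<in>S. D 0 x = f x"
    "\<forall>i<Suc n. \<forall>x\<in>S. (D i has_vector_derivative D (Suc i) x) (at x within S)"
    "continuous_on S (D (Suc n))"
    by (auto simp: Ck_on_def)
  have "(f has_vector_derivative D 1 x) (at x within S)" if x: "x \<in> S" for x
  proof (rule has_vector_derivative_transform[OF x])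
    show "(D 0 has_vector_derivative D 1 x) (at x within S)" using D(2) x by auto
  qed (use D(1) in auto)
  moreover have "Ck_on n (D 1) S" unfolding Ck_on_def
    by (rule exI[of _ "\<lambda>i. D (Suc i)"]) (use D in auto)
  ultimately show "\<exists>f'. (\<forall>x\<in>S. (f has_vector_derivative f' x) (at x within S)) \<and> Ck_on n f' S"
    by blast
next
  assume "\<exists>f'. (\<forall>x\<in>S. (f has_vector_derivative f' x) (at x within S)) \<and> Ck_on n f' S"
  then obtain f' and D :: "nat \<Rightarrow> real \<Rightarrow> 'a" where
    f': "\<forall>x\<in>S. (f has_vector_derivative f' x) (at x within S)" and D: "\<forall>x\<in>S. D 0 x = f' x"
    "\<forall>i<n. \<forall>x\<in>S. (D i has_vector_derivative D (Suc i) x) (at x within S)"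
    "continuous_on S (D n)"
    by (auto simp: Ck_on_def)
  have "((case i of 0 \<Rightarrow> f | Suc j \<Rightarrow> D j) has_vector_derivative D i x) (at x within S)"
    if "i < Suc n" "x \<in> S" for i x
    using that f' D by (cases i) auto
  thus "Ck_on (Suc n) f S" unfolding Ck_on_def
    by (intro exI[of _ "\<lambda>i. case i of 0 \<Rightarrow> f | Suc j \<Rightarrow> D j"]) (use D(3) in auto)
qed

lemma Ck_on_continuous: "Ck_on n f S \<Longrightarrow> continuous_on S f"
proof (cases n)
  case (Suc m)
  assume "Ck_on n f S"
  hence "\<And>x. x \<in> S \<Longrightarrow> \<exists>D. (f has_vector_derivative D) (at x within S)"
    unfolding Suc Ck_on_Suc_iff by blast
  thus ?thesis
    by (meson continuous_on_eq_continuous_within has_vector_derivative_continuous)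
qed (simp add: Ck_on_0)

lemma Ck_on_Pair:
  "Ck_on n f S \<Longrightarrow> Ck_on n g S \<Longrightarrow> Ck_on n (\<lambda>x. (f x, g x)) S"
proof (induction n arbitrary: f g)
  case 0
  thus ?case by (auto simp: Ck_on_0 intro: continuous_on_Pair)
next
  case (Suc n)
  obtain f' g' where
    "\<forall>x\<in>S. (f has_vector_derivative f' x) (at x within S)" "Ck_on n f' S"
    "\<forall>x\<in>S. (g has_vector_derivative g' x) (at x within S)" "Ck_on n g' S"
    using Suc.prems unfolding Ck_on_Suc_iff by blast
  thus ?case unfolding Ck_on_Suc_iff
    by (intro exI[of _ "\<lambda>x. (f' x, g' x)"] conjI ballI has_vector_derivative_Pair Suc.IH) auto
qed

lemma Ck_on_1_UNIV_iff:
  "Ck_on 1 f UNIV \<longleftrightarrow> (\<exists>f'. (\<forall>x. (f has_real_derivative f' x) (at x)) \<and> continuous_on UNIV f')"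
  for f :: "real \<Rightarrow> real"
  unfolding One_nat_def Ck_on_Suc_iff Ck_on_0 by (simp add: has_real_derivative_iff_has_vector_derivative)

text \<open>\<open>w x \<theta>\<close> has derivatives in \<open>\<theta>\<close> up to order \<open>n\<close>, and each of them is jointly continuous in
\<open>(x, \<theta>)\<close>. Continuity is the only condition on the dependence on \<open>x\<close>. Passing the requirement on to a
derivative \<open>w'\<close> makes every closure property an induction on \<open>n\<close>.\<close>

primrec param_smooth :: "nat \<Rightarrow> real set \<Rightarrow> (real \<Rightarrow> real \<Rightarrow> real) \<Rightarrow> bool" where
  "param_smooth 0 I w \<longleftrightarrow> continuous_on ({0..1} \<times> I) (\<lambda>z. w (fst z) (snd z))"
| "param_smooth (Suc n) I w \<longleftrightarrow>
     continuous_on ({0..1} \<times> I) (\<lambda>z. w (fst z) (snd z)) \<and>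
     (\<exists>w'. param_smooth n I w' \<and>
        (\<forall>x\<in>{0..1}. \<forall>\<theta>\<in>I. ((\<lambda>\<theta>. w x \<theta>) has_real_derivative w' x \<theta>) (at \<theta>)))"

lemma param_smooth_continuous:
  "param_smooth n I w \<Longrightarrow> continuous_on ({0..1} \<times> I) (\<lambda>z. w (fst z) (snd z))"
  by (cases n) auto

lemma param_smooth_SucE:
  assumes "param_smooth (Suc n) I w"
  obtains w' where "param_smooth n I w'"
    "\<And>x \<theta>. x \<in> {0..1} \<Longrightarrow> \<theta> \<in> I \<Longrightarrow> ((\<lambda>\<theta>. w x \<theta>) has_real_derivative w' x \<theta>) (at \<theta>)"
  using assms unfolding param_smooth.simps by blast

lemma continuous_on_compose_pair:
  assumes "continuous_on (A \<times> I) (\<lambda>z. w (fst z) (snd z))" "continuous_on S f" "continuous_on S g"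
    "\<And>a. a \<in> S \<Longrightarrow> f a \<in> A \<and> g a \<in> I"
  shows "continuous_on S (\<lambda>a. w (f a) (g a))"
proof -
  have "continuous_on S (\<lambda>a. w (fst (f a, g a)) (snd (f a, g a)))"
    by (rule continuous_on_compose2[OF assms(1) continuous_on_Pair[OF assms(2,3)]]) (use assms(4) in auto)
  thus ?thesis by simp
qed

lemma param_smooth_SucD: "param_smooth (Suc n) I w \<Longrightarrow> param_smooth n I w"
proof (induction n arbitrary: w)
  case (Suc n)
  obtain w' where w': "param_smooth (Suc n) I w'"
    "\<And>x \<theta>. x \<in> {0..1} \<Longrightarrow> \<theta> \<in> I \<Longrightarrow> ((\<lambda>\<theta>. w x \<theta>) has_real_derivative w' x \<theta>) (at \<theta>)"
    using param_smooth_SucE[OF Suc.prems(1)] by blast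
  have "param_smooth n I w'" by (rule Suc.IH[OF w'(1)])
  thus ?case using w'(2) param_smooth_continuous[OF Suc.prems] by auto
qed auto

lemma param_smooth_SucI:
  assumes "continuous_on ({0..1} \<times> I) (\<lambda>z. w (fst z) (snd z))" "param_smooth n I w'"
    "\<And>x \<theta>. x \<in> {0..1} \<Longrightarrow> \<theta> \<in> I \<Longrightarrow> ((\<lambda>\<theta>. w x \<theta>) has_real_derivative w' x \<theta>) (at \<theta>)"
  shows "param_smooth (Suc n) I w"
  using assms by auto

lemma param_smooth_cong:
  assumes "open I" "param_smooth n I w" "\<And>x \<theta>. x \<in> {0..1} \<Longrightarrow> \<theta> \<in> I \<Longrightarrow> w x \<theta> = v x \<theta>"
  shows "param_smooth n I v"
proof -
  have cont: "continuous_on ({0..1} \<times> I) (\<lambda>z. v (fst z) (snd z))"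
    using param_smooth_continuous[OF assms(2)]
    by (rule continuous_on_eq) (use assms(3) in auto)
  show ?thesis
  proof (cases n)
    case (Suc m)
    obtain w' where w': "param_smooth m I w'"
      "\<And>x \<theta>. x \<in> {0..1} \<Longrightarrow> \<theta> \<in> I \<Longrightarrow> ((\<lambda>\<theta>. w x \<theta>) has_real_derivative w' x \<theta>) (at \<theta>)"
      using param_smooth_SucE[OF assms(2)[unfolded Suc]] by blast
    have "((\<lambda>\<theta>. v x \<theta>) has_real_derivative w' x \<theta>) (at \<theta>)" if "x \<in> {0..1}" "\<theta> \<in> I" for x \<theta>
      by (rule has_field_derivative_transform_within_open[OF w'(2)[OF that] assms(1) that(2)])
         (use assms(3) that in auto)
    thus ?thesis unfolding Suc by (rule param_smooth_SucI[OF cont w'(1)])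
  qed (use cont in auto)
qed

lemma param_smooth_indep: "continuous_on {0..1} h \<Longrightarrow> param_smooth n I (\<lambda>x \<theta>. h x)"
proof (induction n arbitrary: h)
  case 0
  thus ?case by (auto intro!: continuous_on_compose2[of "{0..1}" h] continuous_intros)
next
  case (Suc n)
  show ?case
    by (rule param_smooth_SucI[where w' = "\<lambda>x \<theta>. 0"])
       (auto intro!: Suc.IH continuous_on_compose2[OF Suc.prems] continuous_intros)
qed

lemma param_smooth_const: "param_smooth n I (\<lambda>x \<theta>. c)"
  by (rule param_smooth_indep) (rule continuous_on_const)

lemma param_smooth_param: "param_smooth n I (\<lambda>x \<theta>. \<theta>)"
proof (cases n)
  case (Suc m)
  show ?thesis unfolding Suc
    by (rule param_smooth_SucI[where w' = "\<lambda>x \<theta>. 1"]) (auto intro!: param_smooth_const continuous_intros)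
qed (auto intro!: continuous_intros)

lemma param_smooth_add:
  "param_smooth n I v \<Longrightarrow> param_smooth n I w \<Longrightarrow> param_smooth n I (\<lambda>x \<theta>. v x \<theta> + w x \<theta>)"
proof (induction n arbitrary: v w)
  case (Suc n)
  obtain v' w' where *: "param_smooth n I v'" "param_smooth n I w'"
    "\<And>x \<theta>. x \<in> {0..1} \<Longrightarrow> \<theta> \<in> I \<Longrightarrow> ((\<lambda>\<theta>. v x \<theta>) has_real_derivative v' x \<theta>) (at \<theta>)"
    "\<And>x \<theta>. x \<in> {0..1} \<Longrightarrow> \<theta> \<in> I \<Longrightarrow> ((\<lambda>\<theta>. w x \<theta>) has_real_derivative w' x \<theta>) (at \<theta>)"
    using param_smooth_SucE[OF Suc.prems(1)] param_smooth_SucE[OF Suc.prems(2)] by metis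
  show ?case
    by (rule param_smooth_SucI[OF _ Suc.IH[OF *(1,2)]])
       (use Suc.prems in \<open>auto intro!: continuous_intros derivative_eq_intros *(3,4)\<close>)
qed (auto intro!: continuous_intros)

lemma param_smooth_mult:
  "param_smooth n I v \<Longrightarrow> param_smooth n I w \<Longrightarrow> param_smooth n I (\<lambda>x \<theta>. v x \<theta> * w x \<theta>)"
proof (induction n arbitrary: v w)
  case (Suc n)
  obtain v' w' where *: "param_smooth n I v'" "param_smooth n I w'"
    "\<And>x \<theta>. x \<in> {0..1} \<Longrightarrow> \<theta> \<in> I \<Longrightarrow> ((\<lambda>\<theta>. v x \<theta>) has_real_derivative v' x \<theta>) (at \<theta>)"
    "\<And>x \<theta>. x \<in> {0..1} \<Longrightarrow> \<theta> \<in> I \<Longrightarrow> ((\<lambda>\<theta>. w x \<theta>) has_real_derivative w' x \<theta>) (at \<theta>)"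
    using param_smooth_SucE[OF Suc.prems(1)] param_smooth_SucE[OF Suc.prems(2)] by metis
  have "param_smooth n I (\<lambda>x \<theta>. v' x \<theta> * w x \<theta> + v x \<theta> * w' x \<theta>)"
    by (intro param_smooth_add Suc.IH * Suc.prems[THEN param_smooth_SucD])
  thus ?case
    by (rule param_smooth_SucI[rotated])
       (use Suc.prems in \<open>auto intro!: continuous_intros derivative_eq_intros *(3,4)\<close>)
qed (auto intro!: continuous_intros)

lemma param_smooth_minus:
  "param_smooth n I w \<Longrightarrow> param_smooth n I (\<lambda>x \<theta>. - w x \<theta>)"
  using param_smooth_mult[OF param_smooth_const[of n I "-1"], of w] by simp

lemma param_smooth_diff:
  "param_smooth n I v \<Longrightarrow> param_smooth n I w \<Longrightarrow> param_smooth n I (\<lambda>x \<theta>. v x \<theta> - w x \<theta>)"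
  using param_smooth_add[OF _ param_smooth_minus, of n I v w] by simp

lemma param_smooth_exp:
  "param_smooth n I w \<Longrightarrow> param_smooth n I (\<lambda>x \<theta>. exp (w x \<theta>))"
proof (induction n arbitrary: w)
  case (Suc n)
  obtain w' where *: "param_smooth n I w'"
    "\<And>x \<theta>. x \<in> {0..1} \<Longrightarrow> \<theta> \<in> I \<Longrightarrow> ((\<lambda>\<theta>. w x \<theta>) has_real_derivative w' x \<theta>) (at \<theta>)"
    using param_smooth_SucE[OF Suc.prems(1)] by blast
  have "param_smooth n I (\<lambda>x \<theta>. exp (w x \<theta>) * w' x \<theta>)"
    by (intro param_smooth_mult Suc.IH * Suc.prems[THEN param_smooth_SucD])
  thus ?case
    by (rule param_smooth_SucI[rotated])
       (use Suc.prems in \<open>auto intro!: continuous_intros derivative_eq_intros *(2)\<close>)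
qed (auto intro!: continuous_intros)

lemma param_smooth_inverse:
  assumes "param_smooth n I w" and nz: "\<And>x \<theta>. x \<in> {0..1} \<Longrightarrow> \<theta> \<in> I \<Longrightarrow> w x \<theta> \<noteq> 0"
  shows "param_smooth n I (\<lambda>x \<theta>. inverse (w x \<theta>))"
  using assms(1)
proof (induction n)
  case (Suc n)
  obtain w' where *: "param_smooth n I w'"
    "\<And>x \<theta>. x \<in> {0..1} \<Longrightarrow> \<theta> \<in> I \<Longrightarrow> ((\<lambda>\<theta>. w x \<theta>) has_real_derivative w' x \<theta>) (at \<theta>)"
    using param_smooth_SucE[OF Suc.prems(1)] by blast
  have "param_smooth n I (\<lambda>x \<theta>. - (inverse (w x \<theta>) * w' x \<theta> * inverse (w x \<theta>)))"
    by (intro param_smooth_minus param_smooth_mult Suc.IH * Suc.prems[THEN param_smooth_SucD])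
  thus ?case
    by (rule param_smooth_SucI[rotated])
       (use param_smooth_continuous[OF Suc.prems] nz in
        \<open>auto intro!: continuous_intros derivative_eq_intros *(2)\<close>)
qed (use nz in \<open>auto intro!: continuous_intros\<close>)

lemma param_smooth_divide:
  assumes "param_smooth n I v" "param_smooth n I w"
    "\<And>x \<theta>. x \<in> {0..1} \<Longrightarrow> \<theta> \<in> I \<Longrightarrow> w x \<theta> \<noteq> 0"
  shows "param_smooth n I (\<lambda>x \<theta>. v x \<theta> / w x \<theta>)"
  using param_smooth_mult[OF assms(1) param_smooth_inverse[OF assms(2,3)]]
  by (simp add: divide_inverse)

text \<open>The outer function may be smooth on a set with boundary, as \<open>\<phi>\<close> is on \<open>{Ti..}\<close>: one-sided derivatives
suffice for the chain rule when the inner values stay in the set.\<close>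

lemma param_smooth_compose:
  assumes "open I"
  shows "param_smooth n I w \<Longrightarrow> Ck_on n h S \<Longrightarrow>
    (\<And>x \<theta>. x \<in> {0..1} \<Longrightarrow> \<theta> \<in> I \<Longrightarrow> w x \<theta> \<in> S) \<Longrightarrow> param_smooth n I (\<lambda>x \<theta>. h (w x \<theta>))"
proof (induction n arbitrary: h)
  case 0
  have "continuous_on S h" using 0 by (simp add: Ck_on_0)
  thus ?case using 0 by (auto intro!: continuous_on_compose2[of S h])
next
  case (Suc n)
  obtain w' where w': "param_smooth n I w'"
    "\<And>x \<theta>. x \<in> {0..1} \<Longrightarrow> \<theta> \<in> I \<Longrightarrow> ((\<lambda>\<theta>. w x \<theta>) has_real_derivative w' x \<theta>) (at \<theta>)"
    using param_smooth_SucE[OF Suc.prems(1)] by blast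
  from Suc.prems(2) obtain h' where h':
    "\<And>y. y \<in> S \<Longrightarrow> (h has_real_derivative h' y) (at y within S)" "Ck_on n h' S"
    by (auto simp: Ck_on_Suc_iff has_real_derivative_iff_has_vector_derivative)
  have "param_smooth n I (\<lambda>x \<theta>. h' (w x \<theta>) * w' x \<theta>)"
    by (rule param_smooth_mult[OF Suc.IH[OF param_smooth_SucD[OF Suc.prems(1)] h'(2) Suc.prems(3)] w'(1)])
  moreover have "((\<lambda>\<theta>. h (w x \<theta>)) has_real_derivative h' (w x \<theta>) * w' x \<theta>) (at \<theta>)"
    if x: "x \<in> {0..1}" and \<theta>: "\<theta> \<in> I" for x \<theta>
  proof -
    have "((\<lambda>\<theta>. h (w x \<theta>)) has_real_derivative h' (w x \<theta>) * w' x \<theta>) (at \<theta> within I)"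
    proof (rule DERIV_image_chain[of h "h' (w x \<theta>)" "\<lambda>\<theta>. w x \<theta>", unfolded o_def])
      show "(h has_real_derivative h' (w x \<theta>)) (at (w x \<theta>) within (\<lambda>\<theta>. w x \<theta>) ` I)"
        by (rule DERIV_subset[OF h'(1)]) (use x \<theta> Suc.prems(3) in auto)
      show "((\<lambda>\<theta>. w x \<theta>) has_real_derivative w' x \<theta>) (at \<theta> within I)"
        by (rule has_field_derivative_at_within[OF w'(2)[OF x \<theta>]])
    qed
    thus ?thesis using at_within_open[OF \<theta> assms] by simp
  qed
  moreover have "continuous_on ({0..1} \<times> I) (\<lambda>z. h (w (fst z) (snd z)))"
    using Suc.prems(3)
    by (intro continuous_on_compose2[OF Ck_on_continuous[OF Suc.prems(2)]]
          param_smooth_continuous[OF Suc.prems(1)]) auto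
  ultimately show ?case by (intro param_smooth_SucI) auto
qed

text \<open>Rescaling to a fixed interval turns the joint continuity of an integral with variable end point into the
continuity of an integral with parameters.\<close>

lemma integral_rescale:
  fixes f :: "real \<Rightarrow> real"
  assumes "continuous_on {0..x} f" "0 \<le> x"
  shows "integral {0..x} f = integral {0..1} (\<lambda>s. x * f (x * s))"
proof -
  define F where "F = (\<lambda>t. integral {0..t} f)"
  have F: "(F has_real_derivative f t) (at t within {0..x})" if "t \<in> {0..x}" for t
    unfolding F_def using assms(1) that by (rule integral_has_real_derivative)
  have "((\<lambda>s. x * f (x * s)) has_integral F (x * 1) - F (x * 0)) {0..1}"
  proof (rule fundamental_theorem_of_calculus)
    fix s :: real assume s: "s \<in> {0..1}"
    have "((\<lambda>s. F (x * s)) has_real_derivative f (x * s) * x) (at s within {0..1})"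
    proof (rule DERIV_image_chain[of F "f (x * s)" "\<lambda>s. x * s", unfolded o_def])
      show "(F has_real_derivative f (x * s)) (at (x * s) within (*) x ` {0..1})"
        by (rule DERIV_subset[OF F]) (use s assms(2) in \<open>auto simp: mult_left_le\<close>)
    qed (auto intro!: derivative_eq_intros)
    thus "((\<lambda>s. F (x * s)) has_vector_derivative x * f (x * s)) (at s within {0..1})"
      by (simp add: has_real_derivative_iff_has_vector_derivative mult.commute)
  qed simp
  hence "integral {0..1} (\<lambda>s. x * f (x * s)) = integral {0..x} f"
    by (intro integral_unique) (simp add: F_def)
  thus ?thesis by (rule sym)
qed

lemma param_smooth_section:
  fixes w :: "real \<Rightarrow> real \<Rightarrow> real"
  assumes "continuous_on ({0..1} \<times> I) (\<lambda>z. w (fst z) (snd z))" "\<theta> \<in> I"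
  shows "continuous_on {0..1} (\<lambda>x. w x \<theta>)"
  by (rule continuous_on_compose_pair[OF assms(1)]) (use assms(2) in \<open>auto intro!: continuous_intros\<close>)

lemma continuous_on_integral_rescaled:
  fixes w :: "real \<Rightarrow> real \<Rightarrow> real"
  assumes "continuous_on ({0..1} \<times> I) (\<lambda>z. w (fst z) (snd z))"
  shows "continuous_on ({0..1} \<times> I) (\<lambda>z. integral {0..1} (\<lambda>s. fst z * w (fst z * s) (snd z)))"
proof -
  have "continuous_on (({0..1} \<times> I) \<times> cbox 0 1)
      (\<lambda>(z, s). fst z * w (fst z * s) (snd z))"
    unfolding case_prod_unfold
  proof (rule continuous_on_mult)
    show "continuous_on (({0..1} \<times> I) \<times> cbox 0 1) (\<lambda>p. w (fst (fst p) * snd p) (snd (fst p)))"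
      by (rule continuous_on_compose_pair[OF assms])
         (auto simp: mult_le_one intro!: continuous_intros)
  qed (intro continuous_intros)
  from integral_continuous_on_param[OF this] show ?thesis by simp
qed

text \<open>Differentiation under the integral sign.\<close>

lemma param_smooth_integral:
  assumes I: "open I" "convex I"
  shows "param_smooth n I w \<Longrightarrow> param_smooth n I (\<lambda>x \<theta>. integral {0..x} (\<lambda>t. w t \<theta>))"
proof (induction n arbitrary: w)
  have rescale: "integral {0..x} (\<lambda>t. w t \<theta>) = integral {0..1} (\<lambda>s. x * w (x * s) \<theta>)"
    if "continuous_on ({0..1} \<times> I) (\<lambda>z. w (fst z) (snd z))" "x \<in> {0..1}" "\<theta> \<in> I" for w :: "real \<Rightarrow> real \<Rightarrow> real" and x \<theta>
  proof -
    have "continuous_on {0..x} (\<lambda>t. w t \<theta>)"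
      using that(2) by (intro continuous_on_subset[OF param_smooth_section[OF that(1,3)]]) auto
    thus ?thesis using that by (intro integral_rescale[of x "\<lambda>t. w t \<theta>"]) auto
  qed
  have cont: "continuous_on ({0..1} \<times> I) (\<lambda>z. integral {0..fst z} (\<lambda>t. w t (snd z)))"
    if "continuous_on ({0..1} \<times> I) (\<lambda>z. w (fst z) (snd z))" for w :: "real \<Rightarrow> real \<Rightarrow> real"
    using continuous_on_integral_rescaled[OF that]
    by (rule continuous_on_eq) (use rescale[OF that] in auto)
  {
    case 0
    thus ?case using cont by simp
  next
    case (Suc n)
    obtain w' where w': "param_smooth n I w'"
      "\<And>x \<theta>. x \<in> {0..1} \<Longrightarrow> \<theta> \<in> I \<Longrightarrow> ((\<lambda>\<theta>. w x \<theta>) has_real_derivative w' x \<theta>) (at \<theta>)"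
      using param_smooth_SucE[OF Suc.prems(1)] by blast
    have "((\<lambda>\<theta>. integral {0..x} (\<lambda>t. w t \<theta>)) has_real_derivative
        integral {0..x} (\<lambda>t. w' t \<theta>)) (at \<theta>)" if x: "x \<in> {0..1}" and \<theta>: "\<theta> \<in> I" for x \<theta>
    proof -
      have "((\<lambda>\<theta>. integral (cbox 0 x) (\<lambda>t. w t \<theta>)) has_real_derivative
        integral (cbox 0 x) (\<lambda>t. w' t \<theta>)) (at \<theta> within I)"
      proof (rule leibniz_rule_field_derivative[where f = "\<lambda>\<theta> t. w t \<theta>" and fx = "\<lambda>\<theta> t. w' t \<theta>"])
        show "((\<lambda>\<theta>. w t \<theta>) has_real_derivative w' t \<theta>) (at \<theta> within I)"
          if "\<theta> \<in> I" "t \<in> cbox 0 x" for \<theta> t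
          by (rule has_field_derivative_at_within[OF w'(2)]) (use that x in auto)
        show "(\<lambda>t. w t \<theta>) integrable_on cbox 0 x" if "\<theta> \<in> I" for \<theta>
          using continuous_on_subset[OF param_smooth_section[OF param_smooth_continuous[OF Suc.prems] that],
              of "{0..x}"] x
          by (simp add: integrable_continuous_real)
        show "continuous_on (I \<times> cbox 0 x) (\<lambda>(\<theta>, t). w' t \<theta>)"
          unfolding case_prod_unfold
          by (rule continuous_on_compose_pair[OF param_smooth_continuous[OF w'(1)]])
             (use x in \<open>auto intro!: continuous_intros\<close>)
      qed (use I \<theta> in auto)
      thus ?thesis using at_within_open[OF \<theta> I(1)] by simp
    qed
    thus ?case
      by (rule param_smooth_SucI[OF cont[OF param_smooth_continuous[OF Suc.prems]] Suc.IH[OF w'(1)]])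
  }
qed

lemma param_smooth_at_1:
  "param_smooth n I w \<Longrightarrow> param_smooth n I (\<lambda>x \<theta>. w 1 \<theta>)"
proof (induction n arbitrary: w)
  case 0
  have "continuous_on ({0..1} \<times> I) (\<lambda>z. w (fst (1::real, snd z)) (snd (1::real, snd z)))"
    by (rule continuous_on_compose2[OF param_smooth_continuous[OF 0], of _ "\<lambda>z. (1, snd z)"])
       (auto intro!: continuous_intros)
  thus ?case by simp
next
  case (Suc n)
  have "continuous_on ({0..1} \<times> I) (\<lambda>z. w (fst (1::real, snd z)) (snd (1::real, snd z)))"
    by (rule continuous_on_compose2[OF param_smooth_continuous[OF Suc.prems], of _ "\<lambda>z. (1, snd z)"])
       (auto intro!: continuous_intros)
  moreover obtain w' where w': "param_smooth n I w'"
    "\<And>x \<theta>. x \<in> {0..1} \<Longrightarrow> \<theta> \<in> I \<Longrightarrow> ((\<lambda>\<theta>. w x \<theta>) has_real_derivative w' x \<theta>) (at \<theta>)"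
    using param_smooth_SucE[OF Suc.prems(1)] by blast
  ultimately show ?case by (intro param_smooth_SucI[OF _ Suc.IH[OF w'(1)]]) auto
qed

lemma param_smooth_imp_Ck_on:
  "param_smooth n I (\<lambda>x. f) \<Longrightarrow> Ck_on n f I"
proof -
  have "param_smooth n I w \<Longrightarrow> Ck_on n (w 1) I" for w
  proof (induction n arbitrary: w)
    case 0
    have "continuous_on I (\<lambda>\<theta>. w (fst (1::real, \<theta>)) (snd (1::real, \<theta>)))"
      by (rule continuous_on_compose2[OF param_smooth_continuous[OF 0], of _ "\<lambda>\<theta>. (1, \<theta>)"])
         (auto intro!: continuous_intros)
    thus ?case by (simp add: Ck_on_0)
  next
    case (Suc n)
    obtain w' where w': "param_smooth n I w'"
      "\<And>x \<theta>. x \<in> {0..1} \<Longrightarrow> \<theta> \<in> I \<Longrightarrow> ((\<lambda>\<theta>. w x \<theta>) has_real_derivative w' x \<theta>) (at \<theta>)"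
      using param_smooth_SucE[OF Suc.prems(1)] by blast
    have "\<forall>\<theta>\<in>I. (w 1 has_vector_derivative w' 1 \<theta>) (at \<theta> within I)"
      using w'(2)[of 1]
      by (auto intro: has_field_derivative_at_within
          simp flip: has_real_derivative_iff_has_vector_derivative)
    thus ?case unfolding Ck_on_Suc_iff using Suc.IH[OF w'(1)] by blast
  qed
  thus "param_smooth n I (\<lambda>x. f) \<Longrightarrow> Ck_on n f I" by blast
qed

section \<open>Kinetics and the profile equation\<close>

text \<open>The constant \<open>p\<close> is the exponent for which \<open>Z = (1 - x) powr p\<close> in terms of the progress \<open>x\<close>, and \<open>\<kappa>\<close> is the
factor in \<open>x' = - \<kappa> * \<phi> T\<close>.\<close>

locale reactive_flow =
  fixes q0 K \<alpha> Ti :: real and \<phi> :: "real \<Rightarrow> real"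
  assumes q0: "q0 > 0" and K: "K > 0" and alpha: "0 \<le> \<alpha>" "\<alpha> < 1"
    and Ti: "0 < Ti" "Ti < sqrt (2 * q0)"
    and kinetics: "ignition_kinetics Ti \<phi>"
begin

definition p :: real where "p = 1 / (1 - \<alpha>)"

definition \<kappa> :: real where "\<kappa> = (1 - \<alpha>) * K"

text \<open>The kinetics, continued below the ignition temperature by the positive value \<open>\<phi> Ti\<close>. The profile equation
divides by it, and it makes the equation meaningful, with continuous coefficients, for every temperature.\<close>

definition rate :: "real \<Rightarrow> real" where "rate T = \<phi> (max Ti T)"

text \<open>The antiderivative of \<open>rate\<close> that vanishes at \<open>Ti\<close>. In the variable \<open>heat T\<close> the profile equation has no
denominator.\<close>

definition heat :: "real \<Rightarrow> real" where
  "heat = (SOME F. (\<forall>T. (F has_real_derivative rate T) (at T)) \<and> F Ti = 0)"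

definition temperature :: "real \<Rightarrow> real" where "temperature = inv heat"

text \<open>The slope of the secant of \<open>heat\<close> between \<open>b\<close> and \<open>a\<close>, written as an integral in order to be continuous
across the diagonal \<open>a = b\<close>.\<close>

definition mean_rate :: "real \<Rightarrow> real \<Rightarrow> real" where
  "mean_rate a b = integral {0..1} (\<lambda>s. rate (b + s * (a - b)))"

text \<open>The right-hand side of the momentum equation, up to sign, with \<open>Z\<close> expressed through the progress \<open>x\<close>.\<close>

definition excess :: "real \<Rightarrow> real \<Rightarrow> real \<Rightarrow> real" where
  "excess c T x = c * T - T\<^sup>2 / 2 - q0 + q0 * (1 - x) powr p"

text \<open>The speed of a wave for which \<open>\<theta>\<close> is a burnt state, that is, a root of \<open>c * T - T\<^sup>2 / 2 - q0\<close>.\<close>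

definition speed :: "real \<Rightarrow> real" where "speed \<theta> = \<theta> / 2 + q0 / \<theta>"

text \<open>Solutions of the profile equation, without conditions at the end points: shooting prescribes the value at
\<open>x = 1\<close>, comparison the value at \<open>x = 0\<close>.\<close>

definition orbit :: "real \<Rightarrow> real \<Rightarrow> (real \<Rightarrow> real) \<Rightarrow> bool" where
  "orbit b c T \<longleftrightarrow> continuous_on {0..1} T \<and>
     (\<forall>x\<in>{0<..<1}. (T has_real_derivative b * excess c (T x) x / rate (T x)) (at x))"

lemma p_ge_1: "p \<ge> 1" using alpha by (simp add: p_def field_simps)

lemma kappa_pos: "\<kappa> > 0" using alpha K by (simp add: \<kappa>_def)

lemma rate_eq: "T \<ge> Ti \<Longrightarrow> rate T = \<phi> T" by (simp add: rate_def)

lemma rate_pos: "rate T > 0"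
  using kinetics by (auto simp: rate_def ignition_kinetics_def)

lemma Ck_on_phi: "Ck_on n \<phi> {Ti..}"
  using kinetics by (simp add: ignition_kinetics_def smooth_on_def)

lemma continuous_on_rate': "continuous_on UNIV rate"
proof -
  have "continuous_on UNIV (\<lambda>T. \<phi> (max Ti T))"
    by (rule continuous_on_compose2[OF Ck_on_continuous[OF Ck_on_phi[of 0]]])
       (auto intro!: continuous_intros)
  thus ?thesis by (simp add: rate_def[abs_def])
qed

lemma continuous_on_rate [continuous_intros]:
  "continuous_on S f \<Longrightarrow> continuous_on S (\<lambda>x. rate (f x))"
  by (rule continuous_on_compose2[OF continuous_on_rate']) auto

text \<open>On compact sets of temperatures this is continuity; at infinite temperature it is the hypothesis
\<open>\<psi> 0 > 0\<close>.\<close>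

lemma rate_bounded_below: obtains m where "m > 0" "\<And>T. m \<le> rate T"
proof -
  obtain \<psi> where \<psi>: "smooth_on \<psi> {0..1 / Ti}" "\<And>V. V \<in> {0<..1 / Ti} \<Longrightarrow> \<psi> V = \<phi> (1 / V)" "\<psi> 0 > 0"
    using kinetics unfolding ignition_kinetics_def by blast
  have cont: "continuous_on {0..1 / Ti} \<psi>"
    using \<psi>(1) Ck_on_continuous[of 0] by (auto simp: smooth_on_def)
  have pos: "\<psi> V > 0" if "V \<in> {0..1 / Ti}" for V
  proof (cases "V = 0")
    case False
    hence V: "V \<in> {0<..1 / Ti}" using that by auto
    have "1 / V \<ge> Ti" using V Ti by (auto simp: field_simps)
    thus ?thesis using rate_pos[of "1 / V"] \<psi>(2)[OF V] by (simp add: rate_eq)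
  qed (use \<psi>(3) in simp)
  obtain V0 where V0: "V0 \<in> {0..1 / Ti}" "\<And>V. V \<in> {0..1 / Ti} \<Longrightarrow> \<psi> V0 \<le> \<psi> V"
    using continuous_attains_inf[of "{0..1 / Ti}" \<psi>] cont Ti by auto
  have "\<psi> V0 \<le> rate T" for T
  proof -
    have V: "1 / max Ti T \<in> {0<..1 / Ti}" using Ti by (auto simp: field_simps max_def)
    hence "\<psi> (1 / max Ti T) = rate T" using \<psi>(2)[OF V] by (simp add: rate_def)
    thus ?thesis using V0(2)[of "1 / max Ti T"] V by auto
  qed
  thus ?thesis using that[of "\<psi> V0"] pos[OF V0(1)] by blast
qed

lemma heat_props: "(\<forall>T. (heat has_real_derivative rate T) (at T)) \<and> heat Ti = 0"
proof -
  have "isCont rate x" for x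
    using continuous_on_rate' by (simp add: continuous_on_eq_continuous_at)
  then obtain F where F: "\<And>x. (F has_real_derivative rate x) (at x)"
    using einterval_antiderivative[of "-\<infinity>" "\<infinity>" rate]
    by (auto simp: has_real_derivative_iff_has_vector_derivative)
  hence "\<exists>F. (\<forall>T. (F has_real_derivative rate T) (at T)) \<and> F Ti = 0"
    by (intro exI[of _ "\<lambda>T. F T - F Ti"]) (auto intro!: derivative_eq_intros)
  thus ?thesis unfolding heat_def by (rule someI_ex)
qed

lemmas heat_deriv = heat_props[THEN conjunct1, rule_format]

lemmas heat_Ti = heat_props[THEN conjunct2]

lemma continuous_on_heat [continuous_intros]:
  "continuous_on S f \<Longrightarrow> continuous_on S (\<lambda>x. heat (f x))"
proof -
  have "continuous_on UNIV heat"
    by (rule DERIV_continuous_on) (rule has_field_derivative_at_within[OF heat_deriv])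
  thus "continuous_on S f \<Longrightarrow> continuous_on S (\<lambda>x. heat (f x))"
    by (rule continuous_on_compose2) auto
qed

lemma heat_diff: "heat a - heat b = (a - b) * mean_rate a b"
proof -
  have "((\<lambda>s. (a - b) * rate (b + s * (a - b))) has_integral
      heat (b + 1 * (a - b)) - heat (b + 0 * (a - b))) {0..1}"
  proof (rule fundamental_theorem_of_calculus)
    fix s :: real
    have "((\<lambda>s. heat (b + s * (a - b))) has_real_derivative rate (b + s * (a - b)) * (a - b)) (at s within {0..1})"
      by (rule DERIV_chain2[OF heat_deriv]) (auto intro!: derivative_eq_intros)
    thus "((\<lambda>s. heat (b + s * (a - b))) has_vector_derivative (a - b) * rate (b + s * (a - b))) (at s within {0..1})"
      by (simp add: has_real_derivative_iff_has_vector_derivative mult.commute)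
  qed simp
  thus ?thesis by (simp add: mean_rate_def has_integral_iff)
qed

lemma mean_rate_ge: assumes "\<And>T. m \<le> rate T" shows "m \<le> mean_rate a b"
proof -
  have "integral {0..1} (\<lambda>s::real. m) \<le> mean_rate a b" unfolding mean_rate_def
    by (intro integral_le integrable_continuous_real continuous_intros assms)
  thus ?thesis by simp
qed

lemma mean_rate_pos: "mean_rate a b > 0"
proof -
  obtain m where "m > 0" "\<And>T. m \<le> rate T" by (rule rate_bounded_below) blast
  thus ?thesis using mean_rate_ge[of m a b, OF \<open>\<And>T. m \<le> rate T\<close>] by linarith
qed

lemma mean_rate_same: "mean_rate a a = rate a" by (simp add: mean_rate_def)

lemma continuous_on_mean_rate [continuous_intros]:
  fixes f g :: "'a::topological_space \<Rightarrow> real"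
  assumes "continuous_on S f" "continuous_on S g"
  shows "continuous_on S (\<lambda>x. mean_rate (f x) (g x))"
proof -
  have *: "continuous_on (S \<times> A) (\<lambda>z. f (fst z))" "continuous_on (S \<times> A) (\<lambda>z. g (fst z))" for A :: "real set"
    by (auto intro!: continuous_on_compose2[OF assms(1)] continuous_on_compose2[OF assms(2)] continuous_intros)
  have "continuous_on (S \<times> cbox 0 1) (\<lambda>(x, s). rate (g x + s * (f x - g x)))"
    unfolding case_prod_unfold by (intro continuous_intros *)
  from integral_continuous_on_param[OF this] show ?thesis by (simp add: mean_rate_def)
qed

lemma heat_less_iff: "heat a < heat b \<longleftrightarrow> a < b"
proof -
  have "a < b \<Longrightarrow> heat a < heat b" for a b
    using heat_diff[of b a] mult_pos_pos[OF _ mean_rate_pos, of "b - a" b a] by simp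
  thus ?thesis by (metis not_less_iff_gr_or_eq)
qed

lemma heat_eq_iff: "heat a = heat b \<longleftrightarrow> a = b"
  using heat_less_iff[of a b] heat_less_iff[of b a] by (cases a b rule: linorder_cases) auto

lemma abs_diff_le_heat: assumes "\<And>T. m \<le> rate T" "m > 0" shows "\<bar>a - b\<bar> \<le> \<bar>heat a - heat b\<bar> / m"
proof -
  have "m * \<bar>a - b\<bar> \<le> mean_rate a b * \<bar>a - b\<bar>"
    by (intro mult_right_mono mean_rate_ge assms) auto
  also have "\<dots> = \<bar>heat a - heat b\<bar>" using mean_rate_pos[of a b] by (simp add: heat_diff abs_mult)
  finally show ?thesis using assms(2) by (simp add: field_simps)
qed

lemma heat_surj: "\<exists>T. heat T = u"
proof -
  obtain m where m: "m > 0" "\<And>T. m \<le> rate T" by (rule rate_bounded_below) blast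
  define r where "r = \<bar>u\<bar> / m"
  have r: "r \<ge> 0" "m * r = \<bar>u\<bar>" using m(1) by (auto simp: r_def)
  have "heat (Ti - r) \<le> - \<bar>u\<bar>"
    using heat_diff[of Ti "Ti - r"] mult_right_mono[OF mean_rate_ge[OF m(2)] r(1), of Ti "Ti - r"] r
    by (simp add: heat_Ti mult.commute)
  moreover have "\<bar>u\<bar> \<le> heat (Ti + r)"
    using heat_diff[of "Ti + r" Ti] mult_right_mono[OF mean_rate_ge[OF m(2)] r(1), of "Ti + r" Ti] r
    by (simp add: heat_Ti mult.commute)
  ultimately show ?thesis
    using IVT'[of heat "Ti - r" u "Ti + r"] r(1) continuous_on_heat[OF continuous_on_id] by force
qed

lemma heat_temperature [simp]: "heat (temperature u) = u"
proof -
  obtain T where "heat T = u" using heat_surj by blast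
  hence "u \<in> range heat" by blast
  thus ?thesis unfolding temperature_def by (rule f_inv_into_f)
qed

lemma temperature_heat [simp]: "temperature (heat T) = T"
  using heat_eq_iff[of "temperature (heat T)" T] by simp

lemma temperature_deriv: "(temperature has_real_derivative inverse (rate (temperature u))) (at u)"
proof (rule DERIV_inverse_function[where a = "u - 1" and b = "u + 1"])
  obtain m where m: "m > 0" "\<And>T. m \<le> rate T" by (rule rate_bounded_below) blast
  have "(1 / m)-lipschitz_on UNIV temperature"
    using m abs_diff_le_heat[OF m(2,1), of "temperature x" "temperature y" for x y]
    by (auto simp: lipschitz_on_def dist_real_def)
  thus "isCont temperature u"
    by (intro continuous_on_interior[of UNIV] lipschitz_on_continuous_on) auto
qed (use heat_deriv rate_pos[of "temperature u"] in auto)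

lemma continuous_on_powr_p: "continuous_on {0..1} (\<lambda>x. (1 - x) powr p)"
  by (rule continuous_on_powr') (use p_ge_1 in \<open>auto intro!: continuous_intros\<close>)

lemma continuous_on_excess:
  "continuous_on {0..1} T \<Longrightarrow> continuous_on {0..1} (\<lambda>x. excess c (T x) x)"
  unfolding excess_def by (intro continuous_intros continuous_on_powr_p) auto

lemma excess_at_1: "\<theta> > 0 \<Longrightarrow> excess (speed \<theta>) \<theta> 1 = 0"
  by (simp add: excess_def speed_def power2_eq_square field_simps)

lemma powr_p_deriv:
  "x < 1 \<Longrightarrow> ((\<lambda>x. (1 - x) powr p) has_real_derivative - (p * (1 - x) powr (p - 1))) (at x)"
  by (auto intro!: derivative_eq_intros)

lemma orbitD:
  assumes "orbit b c T"
  shows "continuous_on {0..1} T"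
    "\<And>x. 0 < x \<Longrightarrow> x < 1 \<Longrightarrow> (T has_real_derivative b * excess c (T x) x / rate (T x)) (at x)"
  using assms by (auto simp: orbit_def)

lemma orbit_heat_deriv:
  assumes "orbit b c T" "0 < x" "x < 1"
  shows "((\<lambda>x. heat (T x)) has_real_derivative b * excess c (T x) x) (at x)"
  using DERIV_chain2[OF heat_deriv orbitD(2)[OF assms]] rate_pos[of "T x"] by simp

text \<open>Along an orbit the derivative of the excess \<open>r\<close> is \<open>a * r - q0 * p * (1 - x) powr (p - 1)\<close> with
\<open>a = b * (c - T) / rate T\<close>. Hence \<open>exp (- A) * r\<close>, where \<open>A\<close> is an antiderivative of \<open>a\<close>, is strictly
decreasing, and it ends at \<open>0\<close> because \<open>\<theta>\<close> is a root of the limiting excess. The argument does not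
distinguish whether \<open>\<theta>\<close> is the larger or the smaller root, so it treats strong and weak waves alike.\<close>

lemma excess_pos:
  assumes orbit: "orbit b (speed \<theta>) T" and T1: "T 1 = \<theta>" "\<theta> > 0" and x: "0 \<le> x" "x < 1"
  shows "excess (speed \<theta>) (T x) x > 0"
proof -
  define c where "c = speed \<theta>"
  note D = orbitD[OF orbit, folded c_def]
  define a where "a = (\<lambda>t. b * (c - T t) / rate (T t))"
  have a: "continuous_on {0..1} a"
    unfolding a_def using rate_pos by (intro continuous_intros D(1)) (auto simp: less_imp_neq[symmetric])
  define A where "A = (\<lambda>t. integral {0..t} a)"
  have A: "(A has_real_derivative a t) (at t within {0..1})" if "t \<in> {0..1}" for t
    unfolding A_def using integral_has_real_derivative[OF a that] .
  define g where "g = (\<lambda>t. exp (- A t) * excess c (T t) t)"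
  have "g 1 < g x"
  proof (rule DERIV_neg_imp_decreasing_open[OF x(2)])
    fix t assume t: "x < t" "t < 1"
    hence "at t within {0..1} = at t" using x by (intro at_within_interior) auto
    hence At: "(A has_real_derivative a t) (at t)" using A[of t] t x by auto
    define T' where "T' = b * excess c (T t) t / rate (T t)"
    have Tt: "(T has_real_derivative T') (at t)" unfolding T'_def using D(2)[of t] t x by auto
    have "((\<lambda>t. excess c (T t) t) has_real_derivative
        (c - T t) * T' - q0 * (p * (1 - t) powr (p - 1))) (at t)"
      unfolding excess_def
      by (auto intro!: derivative_eq_intros Tt powr_p_deriv t simp: algebra_simps)
    hence "(g has_real_derivative exp (- A t) * ((c - T t) * T' - q0 * (p * (1 - t) powr (p - 1)))
        + exp (- A t) * (- a t) * excess c (T t) t) (at t)"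
      unfolding g_def by (auto intro!: derivative_eq_intros At)
    moreover have "exp (- A t) * ((c - T t) * T' - q0 * (p * (1 - t) powr (p - 1)))
        + exp (- A t) * (- a t) * excess c (T t) t = - (exp (- A t) * (q0 * (p * (1 - t) powr (p - 1))))"
      by (simp add: a_def T'_def algebra_simps)
    moreover have "exp (- A t) * (q0 * (p * (1 - t) powr (p - 1))) > 0"
      using q0 p_ge_1 t by simp
    ultimately show "\<exists>y. (g has_real_derivative y) (at t) \<and> y < 0" by fastforce
  next
    have "continuous_on {0..1} g"
      unfolding g_def
      by (intro continuous_intros continuous_on_excess D(1) DERIV_continuous_on[OF A]) auto
    thus "continuous_on {x..1} g" by (rule continuous_on_subset) (use x in auto)
  qed
  moreover have "g 1 = 0" using excess_at_1[OF T1(2)] T1(1) by (simp add: g_def c_def)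
  ultimately show ?thesis by (simp add: g_def c_def zero_less_mult_iff)
qed

text \<open>The averaged linearization: the excess is quadratic in \<open>T\<close>, so its increment between two temperatures is
\<open>c - (T + S) / 2\<close> times their difference, and \<open>mean_rate\<close> converts that difference into one of \<open>heat\<close>.\<close>

definition growth :: "real \<Rightarrow> real \<Rightarrow> real \<Rightarrow> real \<Rightarrow> real" where
  "growth b c T S = b * (c - (T + S) / 2) / mean_rate T S"

lemma continuous_on_growth [continuous_intros]:
  fixes b c f g :: "'a::topological_space \<Rightarrow> real"
  assumes "continuous_on A b" "continuous_on A c" "continuous_on A f" "continuous_on A g"
  shows "continuous_on A (\<lambda>x. growth (b x) (c x) (f x) (g x))"
  unfolding growth_def using assms mean_rate_pos
  by (intro continuous_intros) (auto simp: less_imp_neq[symmetric])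

text \<open>An exact formula, without remainder: the difference of two values of \<open>heat\<close> solves a linear equation whose
source consists of the changes of \<open>b\<close> and \<open>c\<close>. It serves for comparison, for continuity and for
differentiation with respect to parameters.\<close>

lemma orbit_difference:
  assumes T: "orbit b c T" and S: "orbit b0 c0 S" and init: "T 0 = S 0" and x: "x \<in> {0..1}"
  defines "A \<equiv> \<lambda>x. integral {0..x} (\<lambda>t. growth b0 c0 (T t) (S t))"
  shows "exp (- A x) * (heat (T x) - heat (S x)) =
    integral {0..x} (\<lambda>t. exp (- A t) * ((b - b0) * excess c (T t) t + b0 * (c - c0) * T t))"
  unfolding A_def
proof (rule linear_ode_formula)
  fix x :: real assume x: "0 < x" "x < 1"
  have "((\<lambda>x. heat (T x) - heat (S x)) has_real_derivative
      b * excess c (T x) x - b0 * excess c0 (S x) x) (at x)"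
    by (intro DERIV_diff orbit_heat_deriv[OF T] orbit_heat_deriv[OF S] x)
  moreover have "b * excess c (T x) x - b0 * excess c0 (S x) x =
      growth b0 c0 (T x) (S x) * (heat (T x) - heat (S x)) +
      ((b - b0) * excess c (T x) x + b0 * (c - c0) * T x)"
  proof -
    have eq: "growth b0 c0 (T x) (S x) * (heat (T x) - heat (S x)) =
        b0 * (c0 - (T x + S x) / 2) * (T x - S x)"
      using mean_rate_pos[of "T x" "S x"] by (simp add: heat_diff growth_def)
    show ?thesis unfolding eq by (simp add: excess_def field_simps power2_eq_square)
  qed
  ultimately show "((\<lambda>x. heat (T x) - heat (S x)) has_real_derivative
      growth b0 c0 (T x) (S x) * (heat (T x) - heat (S x)) +
      ((b - b0) * excess c (T x) x + b0 * (c - c0) * T x)) (at x)" by simp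
qed (use init x orbitD(1)[OF T] orbitD(1)[OF S] in
      \<open>auto intro!: continuous_intros continuous_on_excess\<close>)

section \<open>Existence and uniqueness of the special orbits\<close>

text \<open>The orbits that belong to special waves; \<open>b\<close> stands for \<open>1 / (\<beta> * \<kappa>)\<close>.\<close>

definition special :: "real \<Rightarrow> real \<Rightarrow> (real \<Rightarrow> real) \<Rightarrow> bool" where
  "special b \<theta> T \<longleftrightarrow> b > 0 \<and> \<theta> > Ti \<and> orbit b (speed \<theta>) T \<and> T 0 = Ti \<and> T 1 = \<theta>"

lemma specialD:
  assumes "special b \<theta> T"
  shows "b > 0" "\<theta> > Ti" "\<theta> > 0" "orbit b (speed \<theta>) T" "T 0 = Ti" "T 1 = \<theta>"
  using assms Ti by (auto simp: special_def)

lemma special_excess_pos: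
  "special b \<theta> T \<Longrightarrow> 0 \<le> x \<Longrightarrow> x < 1 \<Longrightarrow> excess (speed \<theta>) (T x) x > 0"
  by (rule excess_pos[OF specialD(4,6,3)])

lemma orbit_to_equilibrium_strict_mono:
  assumes "orbit b (speed \<theta>) T" "T 1 = \<theta>" "\<theta> > 0" "b > 0" "0 \<le> x" "x < y" "y \<le> 1"
  shows "T x < T y"
proof (rule DERIV_pos_imp_increasing_open[OF assms(6)])
  fix t assume t: "x < t" "t < y"
  have "b * excess (speed \<theta>) (T t) t / rate (T t) > 0"
    using excess_pos[OF assms(1-3), of t] assms t rate_pos by simp
  thus "\<exists>d. (T has_real_derivative d) (at t) \<and> 0 < d"
    using orbitD(2)[OF assms(1), of t] assms t by auto
qed (use orbitD(1)[OF assms(1)] assms in \<open>auto intro: continuous_on_subset\<close>)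

lemma special_range:
  assumes "special b \<theta> T" "x \<in> {0..1}"
  shows "Ti \<le> T x" "T x \<le> \<theta>" "x > 0 \<Longrightarrow> Ti < T x"
proof -
  note D = specialD[OF assms(1)]
  note mono = orbit_to_equilibrium_strict_mono[OF D(4,6,3,1)]
  show "Ti \<le> T x" using mono[of 0 x] D(5) assms(2) by (cases "x = 0") auto
  show "T x \<le> \<theta>" using mono[of x 1] D(6) assms(2) by (cases "x = 1") auto
  show "x > 0 \<Longrightarrow> Ti < T x" using mono[of 0 x] D(5) assms(2) by auto
qed

text \<open>Since the excess of \<open>T\<close> is positive, \<open>orbit_difference\<close> with equal speeds has the sign of \<open>b - b0\<close>.\<close>

lemma orbit_comparison:
  assumes T: "special b \<theta> T" and S: "orbit b0 (speed \<theta>) S" and init: "S 0 = Ti" and x: "0 < x" "x \<le> 1"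
  shows "b < b0 \<Longrightarrow> T x < S x" "b = b0 \<Longrightarrow> T x = S x" "b > b0 \<Longrightarrow> T x > S x"
proof -
  note D = specialD[OF T]
  define A where "A = (\<lambda>x. integral {0..x} (\<lambda>t. growth b0 (speed \<theta>) (T t) (S t)))"
  have gc: "continuous_on {0..1} (\<lambda>t. growth b0 (speed \<theta>) (T t) (S t))"
    using orbitD(1)[OF D(4)] orbitD(1)[OF S] by (intro continuous_intros)
  hence "continuous_on {0..1} A"
    unfolding A_def by (intro indefinite_integral_continuous_1 integrable_continuous_real)
  hence "continuous_on {0..1} (\<lambda>t. exp (- A t) * excess (speed \<theta>) (T t) t)"
    by (intro continuous_intros continuous_on_excess orbitD(1)[OF D(4)])
  hence cont: "continuous_on {0..x} (\<lambda>t. exp (- A t) * excess (speed \<theta>) (T t) t)"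
    by (rule continuous_on_subset) (use x in auto)
  define I where "I = integral {0..x} (\<lambda>t. exp (- A t) * excess (speed \<theta>) (T t) t)"
  have I: "I > 0" unfolding I_def
    using x by (intro integral_pos[OF cont] mult_pos_pos special_excess_pos[OF T]) auto
  have "exp (- A x) * (heat (T x) - heat (S x)) =
      integral {0..x} (\<lambda>t. exp (- A t) * ((b - b0) * excess (speed \<theta>) (T t) t + b0 * (speed \<theta> - speed \<theta>) * T t))"
    unfolding A_def by (rule orbit_difference[OF D(4) S]) (use D(5) init x in auto)
  also have "\<dots> = integral {0..x} (\<lambda>t. (b - b0) * (exp (- A t) * excess (speed \<theta>) (T t) t))"
    by (intro integral_cong) (simp add: mult_ac)
  also have "\<dots> = (b - b0) * I" by (simp add: I_def)
  finally have eq: "exp (- A x) * (heat (T x) - heat (S x)) = (b - b0) * I" .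
  show "T x < S x" if "b < b0"
  proof -
    have "(b - b0) * I < 0" using that I by (simp add: mult_less_0_iff)
    hence "heat (T x) < heat (S x)" unfolding eq[symmetric] by (simp add: mult_less_0_iff)
    thus ?thesis by (simp add: heat_less_iff)
  qed
  show "T x > S x" if "b > b0"
  proof -
    have "(b - b0) * I > 0" using that I by simp
    hence "heat (S x) < heat (T x)" unfolding eq[symmetric] by (simp add: zero_less_mult_iff)
    thus ?thesis by (simp add: heat_less_iff)
  qed
  show "T x = S x" if "b = b0" using eq that by (simp add: heat_eq_iff)
qed

lemma special_unique_coefficient:
  assumes "special b \<theta> T" "special b0 \<theta> S" shows "b = b0"
  using orbit_comparison[OF assms(1) specialD(4,5)[OF assms(2)], of 1]
    specialD(6)[OF assms(1)] specialD(6)[OF assms(2)] by (cases b b0 rule: linorder_cases) auto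

lemma special_unique_end:
  assumes "special b \<theta> T" "special b \<theta>' S" "speed \<theta> = speed \<theta>'" shows "\<theta> = \<theta>'"
  using orbit_comparison(2)[OF assms(1), of b S 1] specialD[OF assms(1)] specialD[OF assms(2)] assms(3) by auto

text \<open>The quadratic \<open>c * T - T\<^sup>2 / 2 - q0\<close> with \<open>T\<close> truncated to \<open>{0..2 * c}\<close>. Both end points give the value
\<open>- q0\<close>. So the truncated function is Lipschitz continuous, and beyond the end points the reaction term,
which lies between \<open>0\<close> and \<open>q0\<close>, cannot outweigh it; this confines the solutions to the region without
truncation.\<close>

definition source :: "real \<Rightarrow> real \<Rightarrow> real" where
  "source c T = c * max 0 (min (2 * c) T) - (max 0 (min (2 * c) T))\<^sup>2 / 2 - q0"

lemma source_lipschitz: assumes "c > 0" shows "\<bar>source c a - source c b\<bar> \<le> c * \<bar>a - b\<bar>"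
proof -
  define t where "t = (\<lambda>v. max 0 (min (2 * c) v))"
  have t: "0 \<le> t v" "t v \<le> 2 * c" for v using assms by (auto simp: t_def)
  have "source c a - source c b = (c - (t a + t b) / 2) * (t a - t b)"
    by (simp add: source_def t_def field_simps power2_eq_square)
  also have "\<bar>\<dots>\<bar> \<le> c * \<bar>a - b\<bar>" unfolding abs_mult
  proof (rule mult_mono)
    show "\<bar>c - (t a + t b) / 2\<bar> \<le> c" using t[of a] t[of b] by (auto simp: abs_le_iff)
    show "\<bar>t a - t b\<bar> \<le> \<bar>a - b\<bar>" by (auto simp: t_def abs_if max_def min_def)
  qed (use assms in auto)
  finally show ?thesis .
qed

lemma source_inside: "0 \<le> T \<Longrightarrow> T \<le> 2 * c \<Longrightarrow> source c T = c * T - T\<^sup>2 / 2 - q0"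
  by (simp add: source_def)

lemma source_outside: "c > 0 \<Longrightarrow> T \<le> 0 \<or> 2 * c \<le> T \<Longrightarrow> source c T = - q0"
  by (auto simp: source_def power2_eq_square)

lemma speed_pos: "\<theta> > 0 \<Longrightarrow> speed \<theta> > 0" using q0 by (simp add: speed_def add_pos_pos)

lemma le_twice_speed: "\<theta> > 0 \<Longrightarrow> \<theta> \<le> 2 * speed \<theta>" using q0 by (simp add: speed_def)

lemma powr_p_le_1: "x \<in> {0..1} \<Longrightarrow> (1 - x) powr p \<le> 1"
  using powr_mono2[of p "1 - x" 1] p_ge_1 by simp

text \<open>In the variable \<open>v = heat T\<close> the truncated profile equation has a globally Lipschitz right-hand side,
because the inverse of \<open>heat\<close> is Lipschitz.\<close>

lemma source_flow:
  assumes c: "c > 0" and w: "continuous_on {0..1} w"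
  obtains L and u :: "real \<Rightarrow> real \<Rightarrow> real" where "L \<ge> 0"
    "\<And>v v'. \<bar>source c (temperature v) - source c (temperature v')\<bar> \<le> L * \<bar>v - v'\<bar>"
    "\<And>b. u b 0 = a"
    "\<And>b x. x \<in> {0..1} \<Longrightarrow> (u b has_real_derivative
        b * (source c (temperature (u b x)) + w x)) (at x within {0..1})"
    "continuous_on UNIV (\<lambda>b. u b 1)"
proof -
  obtain m where m: "m > 0" "\<And>T. m \<le> rate T" by (rule rate_bounded_below) blast
  have lip: "\<bar>source c (temperature v) - source c (temperature v')\<bar> \<le> (c / m) * \<bar>v - v'\<bar>" for v v'
  proof -
    have "\<bar>source c (temperature v) - source c (temperature v')\<bar> \<le> c * \<bar>temperature v - temperature v'\<bar>"
      by (rule source_lipschitz[OF c])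
    also have "\<dots> \<le> c * (\<bar>v - v'\<bar> / m)"
      using abs_diff_le_heat[OF m(2,1), of "temperature v" "temperature v'"] c
      by (intro mult_left_mono) auto
    finally show ?thesis by simp
  qed
  have L: "0 \<le> c / m" using c m by simp
  show ?thesis
    by (rule ode_family[OF lip L w, where a = a]) (rule that[OF L lip])
qed

text \<open>The equation is solved backwards from \<open>x = 1\<close>, in the variable \<open>y = 1 - x\<close> and with \<open>- b\<close> as the parameter.
The solution stays between \<open>0\<close> and \<open>\<theta>\<close>: the truncated source is \<open>- q0\<close> below \<open>0\<close>, and \<open>\<theta>\<close> itself is an
equilibrium when the reaction term is dropped.\<close>

lemma shooting:
  assumes \<theta>: "\<theta> > Ti"
  obtains T :: "real \<Rightarrow> real \<Rightarrow> real" where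
    "\<And>b. b \<ge> 0 \<Longrightarrow> orbit b (speed \<theta>) (T b)" "\<And>b. T b 1 = \<theta>"
    "continuous_on UNIV (\<lambda>b. T b 0)"
proof -
  define c where "c = speed \<theta>"
  have \<theta>0: "\<theta> > 0" using \<theta> Ti by simp
  have c: "c > 0" "\<theta> \<le> 2 * c" using speed_pos[OF \<theta>0] le_twice_speed[OF \<theta>0] by (auto simp: c_def)
  have F\<theta>: "source c \<theta> = 0"
    using excess_at_1[OF \<theta>0] c \<theta>0 p_ge_1 by (simp add: source_inside excess_def c_def)
  define w where "w = (\<lambda>y. q0 * (1 - (1 - y)) powr p)"
  have w: "continuous_on {0..1} w" unfolding w_def using p_ge_1
    by (intro continuous_intros continuous_on_powr') auto
  have w01: "0 \<le> w y" "w y \<le> q0" if "y \<in> {0..1}" for y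
    using that q0 powr_p_le_1[of "1 - y"] by (auto simp: w_def)
  obtain L u where L: "L \<ge> 0"
    and lip: "\<And>v v'. \<bar>source c (temperature v) - source c (temperature v')\<bar> \<le> L * \<bar>v - v'\<bar>"
    and u: "\<And>b. u b 0 = heat \<theta>" "\<And>b y. y \<in> {0..1} \<Longrightarrow> (u b has_real_derivative
        b * (source c (temperature (u b y)) + w y)) (at y within {0..1})"
      "continuous_on UNIV (\<lambda>b. u b 1)"
    by (rule source_flow[OF c(1) w, where a = "heat \<theta>"]) blast
  have cu: "continuous_on {0..1} (u b)" for b by (rule DERIV_continuous_on) (rule u(2))
  have du: "(u b has_real_derivative b * (source c (temperature (u b y)) + w y)) (at y)"
    if "0 < y" "y < 1" for b y
    using u(2)[of y b] that by (simp add: at_within_unit_interval)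
  have hi: "temperature (u (- b) y) \<le> \<theta>" if b: "b \<ge> 0" and y: "y \<in> {0..1}" for b y
  proof -
    have "0 \<le> heat \<theta> - u (- b) y"
    proof (rule barrier_nonneg[OF _ _ _ y])
      fix y :: real assume y: "0 < y" "y < 1" and neg: "heat \<theta> - u (- b) y < 0"
      have "- source c (temperature (u (- b) y)) \<le> L * (u (- b) y - heat \<theta>)"
        using lip[of "u (- b) y" "heat \<theta>"] neg F\<theta> by simp
      moreover have "0 \<le> w y" using w01 y by simp
      ultimately have "b * (L * (heat \<theta> - u (- b) y)) \<le> b * (source c (temperature (u (- b) y)) + w y)"
        using b by (intro mult_left_mono) (auto simp: algebra_simps)
      thus "((\<lambda>y. heat \<theta> - u (- b) y) has_real_derivative
          b * (source c (temperature (u (- b) y)) + w y)) (at y) \<and>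
          b * L * (heat \<theta> - u (- b) y) \<le> b * (source c (temperature (u (- b) y)) + w y)"
        using DERIV_diff[OF DERIV_const[of "heat \<theta>"] du[OF y, of "- b"]] by (simp add: mult.assoc)
    qed (use u(1) cu in \<open>auto intro!: continuous_intros\<close>)
    thus ?thesis using heat_less_iff[of \<theta> "temperature (u (- b) y)"] by auto
  qed
  have lo: "0 \<le> temperature (u (- b) y)" if b: "b \<ge> 0" and y: "y \<in> {0..1}" for b y
  proof -
    have "0 \<le> u (- b) y - heat 0"
    proof (rule barrier_nonneg[OF _ _ _ y])
      fix y :: real assume y: "0 < y" "y < 1" and neg: "u (- b) y - heat 0 < 0"
      have "temperature (u (- b) y) < 0"
        using neg heat_less_iff[of "temperature (u (- b) y)" 0] by simp
      hence s: "source c (temperature (u (- b) y)) = - q0" using source_outside[OF c(1)] by simp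
      have "0 \<le> - b * (- q0 + w y)" using b w01(2)[of y] y by (simp add: mult_nonneg_nonpos)
      thus "((\<lambda>y. u (- b) y - heat 0) has_real_derivative
          - b * (source c (temperature (u (- b) y)) + w y)) (at y) \<and>
          0 * (u (- b) y - heat 0) \<le> - b * (source c (temperature (u (- b) y)) + w y)"
        using DERIV_diff[OF du[OF y, of "- b"] DERIV_const[of "heat 0"]] s by simp
    next
      show "0 \<le> u (- b) 0 - heat 0" using \<theta>0 heat_less_iff[of 0 \<theta>] by (simp add: u)
    qed (use cu in \<open>auto intro!: continuous_intros\<close>)
    thus ?thesis using heat_less_iff[of "temperature (u (- b) y)" 0] by auto
  qed
  define T where "T = (\<lambda>b x. temperature (u (- b) (1 - x)))"
  have ct: "continuous_on UNIV temperature"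
    by (rule DERIV_continuous_on) (rule has_field_derivative_at_within[OF temperature_deriv])
  show ?thesis
  proof (rule that[of T])
    fix b :: real assume b: "b \<ge> 0"
    show "orbit b (speed \<theta>) (T b)" unfolding orbit_def
    proof (intro conjI ballI)
      show "continuous_on {0..1} (T b)" unfolding T_def
        by (intro continuous_on_compose2[OF ct] continuous_on_compose2[OF cu] continuous_intros) auto
      fix x :: real assume "x \<in> {0<..<1}"
      hence x: "0 < 1 - x" "1 - x < 1" by auto
      have "((\<lambda>x. u (- b) (1 - x)) has_real_derivative
          (- b * (source c (temperature (u (- b) (1 - x))) + w (1 - x))) * (- 1)) (at x)"
        by (rule DERIV_chain2[where f = "u (- b)" and g = "\<lambda>x. 1 - x", OF du[OF x]])
           (auto intro!: derivative_eq_intros)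
      from DERIV_chain2[OF temperature_deriv this]
      have "(T b has_real_derivative inverse (rate (T b x)) * ((- b * (source c (T b x) + w (1 - x))) * (- 1))) (at x)"
        unfolding T_def .
      moreover have "source c (T b x) = c * T b x - (T b x)\<^sup>2 / 2 - q0"
        using hi[OF b, of "1 - x"] lo[OF b, of "1 - x"] x c(2) by (intro source_inside) (auto simp: T_def)
      hence "source c (T b x) + w (1 - x) = excess c (T b x) x" by (simp add: excess_def w_def)
      ultimately show "(T b has_real_derivative b * excess (speed \<theta>) (T b x) x / rate (T b x)) (at x)"
        unfolding c_def[symmetric] by (simp add: divide_inverse mult.commute)
    qed
  next
    have "continuous_on UNIV (\<lambda>b. u (- b) 1)"
      by (rule continuous_on_compose2[OF u(3)]) (auto intro!: continuous_intros)
    hence "continuous_on UNIV (\<lambda>b. temperature (u (- b) 1))"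
      by (rule continuous_on_compose2[OF ct]) auto
    thus "continuous_on UNIV (\<lambda>b. T b 0)" by (simp add: T_def)
  qed (simp add: T_def u)
qed

text \<open>The value \<open>T b 0\<close> is \<open>\<theta>\<close> for \<open>b = 0\<close>. As long as it exceeds \<open>Ti\<close>, the orbit lies in \<open>{Ti..\<theta>}\<close>, where the
excess is bounded below near \<open>x = 0\<close>; then \<open>heat T\<close> grows by a multiple of \<open>b\<close>, which is impossible for large
\<open>b\<close> since its values are at most \<open>heat \<theta>\<close>. In between, \<open>T b 0 = Ti\<close> for some \<open>b\<close>.\<close>

lemma special_exists:
  assumes \<theta>: "\<theta> > Ti" shows "\<exists>b T. special b \<theta> T"
proof -
  obtain T where T: "\<And>b. b \<ge> 0 \<Longrightarrow> orbit b (speed \<theta>) (T b)" "\<And>b. T b 1 = \<theta>"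
    "continuous_on UNIV (\<lambda>b. T b 0)" by (rule shooting[OF \<theta>]) blast
  have \<theta>0: "\<theta> > 0" using \<theta> Ti by simp
  \<comment> \<open>A lower bound for \<open>c * T - T\<^sup>2 / 2 = T * (c - T / 2)\<close> on \<open>{Ti..\<theta>}\<close>.\<close>
  define \<mu> where "\<mu> = Ti * q0 / \<theta>"
  have \<mu>: "\<mu> > 0" using Ti q0 \<theta>0 by (simp add: \<mu>_def)
  have "\<exists>x0>0. x0 < 1 \<and> (\<forall>x. 0 \<le> x \<and> x \<le> x0 \<longrightarrow> q0 * (1 - (1 - x) powr p) \<le> \<mu> / 2)"
  proof -
    have "continuous_on {0..1} (\<lambda>x. q0 * (1 - (1 - x) powr p))"
      by (intro continuous_intros continuous_on_powr_p)
    then obtain d where d: "d > 0" "\<And>x. x \<in> {0..1} \<Longrightarrow> dist x 0 < d \<Longrightarrow>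
        dist (q0 * (1 - (1 - x) powr p)) (q0 * (1 - (1 - 0) powr p)) < \<mu> / 2"
      using \<mu> unfolding continuous_on_iff by (elim ballE[of _ _ 0] allE[of _ "\<mu> / 2"]) auto
    show ?thesis
    proof (intro exI[of _ "min (d / 2) (1 / 2)"] conjI allI impI)
      fix x assume "0 \<le> x \<and> x \<le> min (d / 2) (1 / 2)"
      thus "q0 * (1 - (1 - x) powr p) \<le> \<mu> / 2" using d(2)[of x] d(1) by (auto simp: dist_real_def)
    qed (use d in auto)
  qed
  then obtain x0 where x0: "0 < x0" "x0 < 1"
    "\<And>x. 0 \<le> x \<Longrightarrow> x \<le> x0 \<Longrightarrow> q0 * (1 - (1 - x) powr p) \<le> \<mu> / 2" by blast
  \<comment> \<open>For this value the growth of \<open>heat T\<close> on \<open>{0..x0}\<close> would already equal \<open>heat \<theta>\<close>.\<close>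
  define b1 where "b1 = 2 * heat \<theta> / (\<mu> * x0)"
  have h\<theta>: "heat \<theta> > 0" using heat_less_iff[of Ti \<theta>] \<theta> heat_Ti by simp
  have b1: "b1 > 0" using h\<theta> \<mu> x0 by (simp add: b1_def)
  have "T b1 0 \<le> Ti"
  proof (rule ccontr)
    assume "\<not> T b1 0 \<le> Ti"
    hence big: "T b1 0 > Ti" by simp
    note mono = orbit_to_equilibrium_strict_mono[OF T(1)[of b1] T(2) \<theta>0 b1]
    have rng: "Ti < T b1 x" "T b1 x \<le> \<theta>" if "x \<in> {0..1}" for x
      using mono[of 0 x] mono[of x 1] that big b1 T(2)
      by (cases "x = 0"; cases "x = 1"; force)+
    define h where "h = (\<lambda>x. heat (T b1 x) - b1 * (\<mu> / 2) * x)"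
    have "h 0 \<le> h x0"
    proof (rule DERIV_nonneg_imp_increasing_open[of 0 x0 h])
      fix x assume x: "0 < x" "x < x0"
      have "(h has_real_derivative b1 * excess (speed \<theta>) (T b1 x) x - b1 * (\<mu> / 2)) (at x)"
        unfolding h_def using orbit_heat_deriv[OF T(1)[of b1], of x] x x0 b1
        by (auto intro!: derivative_eq_intros)
      moreover have "\<mu> / 2 \<le> excess (speed \<theta>) (T b1 x) x"
      proof -
        have r: "Ti < T b1 x" "T b1 x \<le> \<theta>" using rng[of x] x x0 by auto
        have "Ti * (q0 / \<theta>) \<le> T b1 x * (speed \<theta> - T b1 x / 2)"
          using r Ti q0 \<theta>0 by (intro mult_mono) (auto simp: speed_def field_simps)
        hence "\<mu> \<le> speed \<theta> * T b1 x - (T b1 x)\<^sup>2 / 2"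
          by (simp add: \<mu>_def algebra_simps power2_eq_square)
        thus ?thesis using x0(3)[of x] x by (simp add: excess_def algebra_simps)
      qed
      hence "b1 * (\<mu> / 2) \<le> b1 * excess (speed \<theta>) (T b1 x) x" using b1 by (intro mult_left_mono) auto
      ultimately show "\<exists>y. (h has_real_derivative y) (at x) \<and> 0 \<le> y" by fastforce
    next
      have "continuous_on {0..1} h" unfolding h_def
        using orbitD(1)[OF T(1)[of b1]] b1 by (intro continuous_intros) auto
      thus "continuous_on {0..x0} h" by (rule continuous_on_subset) (use x0 in auto)
    qed (use x0 in simp)
    hence "heat (T b1 0) + b1 * (\<mu> / 2) * x0 \<le> heat (T b1 x0)" by (simp add: h_def)
    also have "heat (T b1 x0) \<le> heat \<theta>" using rng[of x0] x0 heat_less_iff[of \<theta> "T b1 x0"] by auto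
    also have "heat \<theta> = b1 * (\<mu> / 2) * x0" using \<mu> x0 by (simp add: b1_def)
    finally show False using heat_less_iff[of Ti "T b1 0"] big heat_Ti by simp
  qed
  moreover have "T 0 0 = \<theta>"
  proof -
    have "T 0 1 = T 0 0"
    proof (rule DERIV_isconst2[of 0 1])
      show "(T 0 has_real_derivative 0) (at x)" if "0 < x" "x < 1" for x
        using orbitD(2)[OF T(1)[of 0] that] by simp
    qed (use orbitD(1)[OF T(1)[of 0]] in auto)
    thus ?thesis using T(2) by simp
  qed
  ultimately obtain b where b: "0 \<le> b" "T b 0 = Ti"
    using IVT2'[of "\<lambda>b. T b 0" b1 Ti 0] \<theta> b1 continuous_on_subset[OF T(3)] by auto
  hence "b \<noteq> 0" using \<open>T 0 0 = \<theta>\<close> \<theta> by auto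
  hence "special b \<theta> (T b)" using b(1) T(1)[of b] unfolding special_def
    by (intro conjI b(2) T(2) \<theta>) auto
  thus ?thesis by blast
qed

text \<open>The known special orbit \<open>S\<close> is a lower barrier, because its excess is positive and \<open>b\<close> is larger; the upper
barrier is \<open>2 * c\<close>.\<close>

lemma overdriven_orbit_exists:
  assumes S: "special b0 \<theta> S" and b: "b0 < b"
  obtains T where "orbit b (speed \<theta>) T" "T 0 = Ti" "\<And>x. 0 < x \<Longrightarrow> x \<le> 1 \<Longrightarrow> S x < T x"
proof -
  note D = specialD[OF S]
  define c where "c = speed \<theta>"
  have c: "c > 0" "\<theta> \<le> 2 * c" using speed_pos[OF D(3)] le_twice_speed[OF D(3)] by (auto simp: c_def)
  define w where "w = (\<lambda>x. q0 * (1 - x) powr p)"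
  have w: "continuous_on {0..1} w" unfolding w_def by (intro continuous_intros continuous_on_powr_p)
  obtain L u where L: "L \<ge> 0"
    and lip: "\<And>v v'. \<bar>source c (temperature v) - source c (temperature v')\<bar> \<le> L * \<bar>v - v'\<bar>"
    and u: "\<And>b. u b 0 = heat Ti" "\<And>b x. x \<in> {0..1} \<Longrightarrow> (u b has_real_derivative
        b * (source c (temperature (u b x)) + w x)) (at x within {0..1})"
    by (rule source_flow[OF c(1) w, where a = "heat Ti"]) blast
  have cu: "continuous_on {0..1} (u b)" by (rule DERIV_continuous_on) (rule u(2))
  have du: "(u b has_real_derivative b * (source c (temperature (u b x)) + w x)) (at x)"
    if "0 < x" "x < 1" for x
    using u(2)[of x b] that by (simp add: at_within_unit_interval)
  have hi: "temperature (u b x) \<le> 2 * c" if x: "x \<in> {0..1}" for x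
  proof -
    have "0 \<le> heat (2 * c) - u b x"
    proof (rule barrier_nonneg[OF _ _ _ x])
      fix x :: real assume x: "0 < x" "x < 1" and neg: "heat (2 * c) - u b x < 0"
      have "2 * c < temperature (u b x)"
        using neg heat_less_iff[of "2 * c" "temperature (u b x)"] by simp
      hence s: "source c (temperature (u b x)) = - q0" using source_outside[OF c(1)] by simp
      have "w x \<le> q0" using powr_p_le_1[of x] x q0 by (simp add: w_def mult_left_le)
      hence "b * (- q0 + w x) \<le> 0" using b D(1) by (simp add: mult_nonneg_nonpos)
      thus "((\<lambda>x. heat (2 * c) - u b x) has_real_derivative
          - (b * (source c (temperature (u b x)) + w x))) (at x) \<and>
          0 * (heat (2 * c) - u b x) \<le> - (b * (source c (temperature (u b x)) + w x))"
        using DERIV_diff[OF DERIV_const[of "heat (2 * c)"] du[OF x]] s by simp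
    next
      show "0 \<le> heat (2 * c) - u b 0" using D(2) c(2) heat_less_iff[of "2 * c" Ti] by (simp add: u)
    qed (use cu in \<open>auto intro!: continuous_intros\<close>)
    thus ?thesis using heat_less_iff[of "2 * c" "temperature (u b x)"] by auto
  qed
  have lo: "S x \<le> temperature (u b x)" if x: "x \<in> {0..1}" for x
  proof -
    have "0 \<le> u b x - heat (S x)"
    proof (rule barrier_nonneg[OF _ _ _ x])
      fix x :: real assume x: "0 < x" "x < 1" and neg: "u b x - heat (S x) < 0"
      have r: "0 \<le> S x" "S x \<le> 2 * c" using special_range[OF S, of x] x Ti c by auto
      have e: "excess c (S x) x = source c (S x) + w x"
        using source_inside[OF r] by (simp add: excess_def w_def)
      have "source c (S x) - source c (temperature (u b x)) \<le> L * (heat (S x) - u b x)"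
        using lip[of "heat (S x)" "u b x"] neg by simp
      hence "b * (L * (u b x - heat (S x))) \<le> b * (source c (temperature (u b x)) - source c (S x))"
        using b D(1) by (intro mult_left_mono) (auto simp: algebra_simps)
      moreover have "0 \<le> (b - b0) * excess c (S x) x"
        using b special_excess_pos[OF S, of x] x by (simp add: c_def)
      ultimately have "b * L * (u b x - heat (S x)) \<le>
          b * (source c (temperature (u b x)) + w x) - b0 * excess c (S x) x"
        unfolding e by (simp add: algebra_simps)
      thus "((\<lambda>x. u b x - heat (S x)) has_real_derivative
          b * (source c (temperature (u b x)) + w x) - b0 * excess c (S x) x) (at x) \<and>
          b * L * (u b x - heat (S x)) \<le> b * (source c (temperature (u b x)) + w x) - b0 * excess c (S x) x"
        using DERIV_diff[OF du[OF x] orbit_heat_deriv[OF D(4) x]] by (simp add: c_def)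
    next
      show "continuous_on {0..1} (\<lambda>x. u b x - heat (S x))"
        by (intro continuous_intros cu orbitD(1)[OF D(4)])
    qed (simp add: u D(5))
    thus ?thesis using heat_less_iff[of "temperature (u b x)" "S x"] by auto
  qed
  have ct: "continuous_on UNIV temperature"
    by (rule DERIV_continuous_on) (rule has_field_derivative_at_within[OF temperature_deriv])
  define T where "T = (\<lambda>x. temperature (u b x))"
  have pT: "orbit b (speed \<theta>) T" unfolding orbit_def
  proof (intro conjI ballI)
    show "continuous_on {0..1} T" unfolding T_def
      by (intro continuous_on_compose2[OF ct cu]) auto
    fix x :: real assume "x \<in> {0<..<1}"
    hence x: "0 < x" "x < 1" by auto
    from DERIV_chain2[OF temperature_deriv du[OF x]]
    have "(T has_real_derivative inverse (rate (T x)) * (b * (source c (T x) + w x))) (at x)"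
      unfolding T_def .
    moreover have "source c (T x) = c * T x - (T x)\<^sup>2 / 2 - q0"
      using hi[of x] lo[of x] special_range(1)[OF S, of x] x Ti by (intro source_inside) (auto simp: T_def)
    hence "source c (T x) + w x = excess c (T x) x" by (simp add: excess_def w_def)
    ultimately show "(T has_real_derivative b * excess (speed \<theta>) (T x) x / rate (T x)) (at x)"
      unfolding c_def[symmetric] by (simp add: divide_inverse mult.commute)
  qed
  have T0: "T 0 = Ti" by (simp add: T_def u)
  show ?thesis
    by (rule that[OF pT T0]) (use orbit_comparison(1)[OF S pT T0] b in auto)
qed

section \<open>Smooth dependence on the burnt temperature\<close>

definition coeff :: "real \<Rightarrow> real" where
  "coeff \<theta> = (SOME b. \<exists>T. special b \<theta> T)"

definition profile :: "real \<Rightarrow> real \<Rightarrow> real" where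
  "profile \<theta> = (SOME T. special (coeff \<theta>) \<theta> T)"

lemma special_profile: "\<theta> > Ti \<Longrightarrow> special (coeff \<theta>) \<theta> (profile \<theta>)"
proof -
  assume "\<theta> > Ti"
  from special_exists[OF this] have "\<exists>T. special (coeff \<theta>) \<theta> T"
    unfolding coeff_def by (rule someI_ex)
  thus ?thesis unfolding profile_def by (rule someI_ex)
qed

lemmas profileD = specialD[OF special_profile]

lemma coeff_unique: "special b \<theta> T \<Longrightarrow> b = coeff \<theta>"
  by (rule special_unique_coefficient[OF _ special_profile]) (auto dest: specialD(2))

lemma continuous_on_profile: "\<theta> > Ti \<Longrightarrow> continuous_on {0..1} (profile \<theta>)"
  by (rule orbitD(1)[OF profileD(4)])

definition speed' :: "real \<Rightarrow> real" where "speed' \<theta> = 1 / 2 - q0 / \<theta>\<^sup>2"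

lemma speed_deriv: "\<theta> \<noteq> 0 \<Longrightarrow> (speed has_real_derivative speed' \<theta>) (at \<theta>)"
  unfolding speed_def[abs_def] speed'_def
  by (auto intro!: derivative_eq_intros simp: power2_eq_square)

lemma excess_bounds:
  assumes "special b \<theta> T" "x \<in> {0..1}"
  shows "0 \<le> excess (speed \<theta>) (T x) x" "excess (speed \<theta>) (T x) x \<le> \<theta>\<^sup>2 / 2 + q0"
proof -
  note D = specialD[OF assms(1)] and r = special_range[OF assms]
  show "0 \<le> excess (speed \<theta>) (T x) x"
    using special_excess_pos[OF assms(1), of x] excess_at_1[OF D(3)] D(6) assms(2)
    by (cases "x = 1") auto
  have "excess (speed \<theta>) (T x) x \<le> speed \<theta> * T x"
  proof -
    have "q0 * (1 - x) powr p \<le> q0" using powr_p_le_1[OF assms(2)] q0 by (simp add: mult_left_le)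
    moreover have "0 \<le> (T x)\<^sup>2 / 2" by simp
    ultimately show ?thesis unfolding excess_def by linarith
  qed
  also have "\<dots> \<le> speed \<theta> * \<theta>" using r(2) speed_pos[OF D(3)] by (intro mult_left_mono) auto
  also have "\<dots> = \<theta>\<^sup>2 / 2 + q0" using D(3) by (simp add: speed_def field_simps power2_eq_square)
  finally show "excess (speed \<theta>) (T x) x \<le> \<theta>\<^sup>2 / 2 + q0" .
qed

text \<open>Integration of \<open>(heat T)' = b * excess\<close>. It bounds the total excess from below by \<open>heat \<theta> / b\<close>, without prior
control of \<open>b\<close>.\<close>

lemma coeff_times_total_excess:
  assumes "special b \<theta> T"
  shows "b * integral {0..1} (\<lambda>x. excess (speed \<theta>) (T x) x) = heat \<theta>"
proof -
  note D = specialD[OF assms]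
  have "((\<lambda>x. b * excess (speed \<theta>) (T x) x) has_integral heat (T 1) - heat (T 0)) {0..1}"
  proof (rule fundamental_theorem_of_calculus_interior)
    show "continuous_on {0..1} (\<lambda>x. heat (T x))" by (intro continuous_intros orbitD(1)[OF D(4)])
    show "((\<lambda>x. heat (T x)) has_vector_derivative b * excess (speed \<theta>) (T x) x) (at x)"
      if "x \<in> {0<..<1}" for x
      using orbit_heat_deriv[OF D(4)] that
      by (auto simp flip: has_real_derivative_iff_has_vector_derivative)
  qed simp
  thus ?thesis using D by (simp add: integral_unique heat_Ti flip: integral_mult_right)
qed

text \<open>Both estimates come from \<open>orbit_difference\<close>; the first one from its value at \<open>x = 1\<close>. The factors
\<open>growth\<close> involve only the coefficient at \<open>\<theta>0\<close> and are therefore bounded uniformly in \<open>\<theta>\<close>. The coefficient at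
\<open>\<theta>\<close> has no a priori bound, and for this reason the first estimate concerns a quotient of coefficients.\<close>

lemma profile_difference_estimates:
  assumes \<theta>0: "\<theta>0 > Ti"
  obtains C where "C > 0"
    "\<And>\<theta>. Ti < \<theta> \<Longrightarrow> \<theta> < 2 * \<theta>0 \<Longrightarrow>
       \<bar>1 - coeff \<theta>0 / coeff \<theta>\<bar> \<le> C * (\<bar>heat \<theta> - heat \<theta>0\<bar> + \<bar>speed \<theta> - speed \<theta>0\<bar>) / heat \<theta>"
    "\<And>\<theta> x. Ti < \<theta> \<Longrightarrow> \<theta> < 2 * \<theta>0 \<Longrightarrow> x \<in> {0..1} \<Longrightarrow>
       \<bar>profile \<theta> x - profile \<theta>0 x\<bar> \<le> C * (\<bar>coeff \<theta> - coeff \<theta>0\<bar> + \<bar>speed \<theta> - speed \<theta>0\<bar>)"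
proof -
  obtain m where m: "m > 0" "\<And>T. m \<le> rate T" by (rule rate_bounded_below) blast
  define b0 c0 S where "b0 = coeff \<theta>0" and "c0 = speed \<theta>0" and "S = profile \<theta>0"
  note S = special_profile[OF \<theta>0, folded b0_def S_def]
  note DS = specialD[OF S]
  have c0: "c0 > 0" using speed_pos[OF DS(3)] by (simp add: c0_def)
  \<comment> \<open>\<open>G\<close> bounds \<open>growth\<close>, \<open>W\<close> the integrating factor and its reciprocal, and \<open>M\<close> the coefficients of the source term.\<close>
  define G where "G = b0 * (c0 + 3 * \<theta>0) / m"
  define W where "W = exp G"
  define M where "M = max 1 (max (2 * \<theta>0\<^sup>2 + q0) (2 * \<theta>0 * b0))"
  define C where "C = W * (W * M) * max 1 (1 / m)"
  have M: "1 \<le> M" "2 * \<theta>0\<^sup>2 + q0 \<le> M" "2 * \<theta>0 * b0 \<le> M" by (auto simp: M_def)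
  have W: "W > 0" by (simp add: W_def)
  have C: "C > 0" using M W by (simp add: C_def)
  have C': "W * (W * (M * Y)) * n \<le> C * Y" if "n \<le> max 1 (1 / m)" "Y \<ge> 0" for n Y
  proof -
    have "(W * (W * M) * Y) * n \<le> (W * (W * M) * Y) * max 1 (1 / m)"
      using that M W by (intro mult_left_mono) auto
    thus ?thesis by (simp add: C_def mult_ac)
  qed
  {
    fix \<theta> assume \<theta>: "Ti < \<theta>" "\<theta> < 2 * \<theta>0"
    define b T where "b = coeff \<theta>" and "T = profile \<theta>"
    note T = special_profile[OF \<theta>(1), folded b_def T_def]
    note DT = specialD[OF T]
    define A where "A = (\<lambda>x. integral {0..x} (\<lambda>t. growth b0 c0 (T t) (S t)))"
    define w where "w = (\<lambda>t. exp (- A t))"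
    define E where "E = (\<lambda>x. excess (speed \<theta>) (T x) x)"
    define \<Delta> where "\<Delta> = speed \<theta> - c0"
    have cT: "continuous_on {0..1} T" "continuous_on {0..1} S"
      using orbitD(1) DT(4) DS(4) by auto
    have cE: "continuous_on {0..1} E" unfolding E_def by (rule continuous_on_excess[OF cT(1)])
    have cg: "continuous_on {0..1} (\<lambda>t. growth b0 c0 (T t) (S t))" using cT by (intro continuous_intros)
    have cw: "continuous_on {0..1} w" unfolding w_def A_def
      by (intro continuous_on_exp continuous_on_minus indefinite_integral_continuous_1
          integrable_continuous_real cg)
    have g: "\<bar>growth b0 c0 (T t) (S t)\<bar> \<le> G" if t: "t \<in> {0..1}" for t
    proof -
      have "\<bar>c0 - (T t + S t) / 2\<bar> \<le> c0 + 3 * \<theta>0"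
        using special_range(1,2)[OF T t] special_range(1,2)[OF S t] \<theta> Ti(1) c0
        by (intro abs_leI) argo+
      hence "b0 * \<bar>c0 - (T t + S t) / 2\<bar> / mean_rate (T t) (S t) \<le> b0 * (c0 + 3 * \<theta>0) / m"
        using mean_rate_ge[OF m(2)] m(1) DS c0 by (intro frac_le mult_left_mono) auto
      thus ?thesis unfolding growth_def G_def
        using DS(1) mean_rate_pos[of "T t" "S t"] by (simp add: abs_mult)
    qed
    have w: "0 < w x" "w x \<le> W" "1 \<le> W * w x" if "x \<in> {0..1}" for x
    proof -
      have "\<bar>A x\<bar> \<le> G" unfolding A_def by (rule integral_abs_le[OF cg g that])
      thus "0 < w x" "w x \<le> W" "1 \<le> W * w x" by (auto simp: w_def W_def simp flip: exp_add)
    qed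
    have source: "\<bar>w t * y\<bar> \<le> W * Y" if "t \<in> {0..1}" "\<bar>y\<bar> \<le> Y" for t y Y
      using w[OF that(1)] that(2) W by (auto simp: abs_mult intro!: mult_mono)
    have T01: "0 \<le> T t" "T t \<le> 2 * \<theta>0" if "t \<in> {0..1}" for t
      using special_range(1,2)[OF T that] \<theta> Ti by auto
    have bT: "\<bar>b0 * \<Delta> * T t\<bar> \<le> M * \<bar>\<Delta>\<bar>" if "t \<in> {0..1}" for t
    proof -
      have "b0 * T t \<le> b0 * (2 * \<theta>0)" using DS(1) T01(2)[OF that] by (intro mult_left_mono) auto
      hence "b0 * T t * \<bar>\<Delta>\<bar> \<le> M * \<bar>\<Delta>\<bar>" using M(3) by (intro mult_right_mono) (auto simp: mult.commute)
      thus ?thesis using DS(1) T01(1)[OF that] by (simp add: abs_mult mult_ac)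
    qed
    have E0: "0 \<le> E t" if "t \<in> {0..1}" for t using excess_bounds(1)[OF T that] by (simp add: E_def)
    have bE: "\<bar>(b - b0) * E t\<bar> \<le> M * \<bar>b - b0\<bar>" if "t \<in> {0..1}" for t
    proof -
      have "\<theta>\<^sup>2 \<le> (2 * \<theta>0)\<^sup>2" using \<theta> Ti by (intro power_mono) auto
      hence "E t \<le> M"
        using excess_bounds(2)[OF T that] M(2) unfolding E_def power_mult_distrib by simp
      hence "E t * \<bar>b - b0\<bar> \<le> M * \<bar>b - b0\<bar>" by (intro mult_right_mono) auto
      thus ?thesis using E0[OF that] by (simp add: abs_mult mult.commute)
    qed
    have diff: "w x * (heat (T x) - heat (S x)) =
        integral {0..x} (\<lambda>t. w t * ((b - b0) * E t + b0 * \<Delta> * T t))" if "x \<in> {0..1}" for x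
      unfolding A_def E_def \<Delta>_def w_def
      by (rule orbit_difference[OF DT(4) DS(4)[folded c0_def] _ that]) (simp add: DT DS)
    have int: "(\<lambda>t. w t * E t) integrable_on {0..1}" "(\<lambda>t. w t * (b0 * \<Delta> * T t)) integrable_on {0..1}"
      "E integrable_on {0..1}"
      by (intro integrable_continuous_real continuous_intros cw cE cT)+
    define I1 I2 where "I1 = integral {0..1} (\<lambda>t. w t * E t)"
      and "I2 = integral {0..1} (\<lambda>t. w t * (b0 * \<Delta> * T t))"
    have "heat \<theta> / b = integral {0..1} E"
      using coeff_times_total_excess[OF T] DT(1) by (simp add: E_def[abs_def] field_simps)
    also have "\<dots> \<le> integral {0..1} (\<lambda>t. W * (w t * E t))"
    proof (intro integral_le int(3) integrable_on_mult_right int(1))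
      show "E t \<le> W * (w t * E t)" if "t \<in> {0..1}" for t
        using mult_right_mono[OF w(3)[OF that] E0[OF that]] by (simp add: mult.assoc)
    qed
    finally have I1: "heat \<theta> / b \<le> W * I1" by (simp add: I1_def)
    have I2: "\<bar>I2\<bar> \<le> W * (M * \<bar>\<Delta>\<bar>)" unfolding I2_def
      by (rule integral_abs_le) (auto intro!: continuous_intros cw cT source bT)
    have "integral {0..1} (\<lambda>t. w t * ((b - b0) * E t + b0 * \<Delta> * T t)) =
        integral {0..1} (\<lambda>t. (b - b0) * (w t * E t) + w t * (b0 * \<Delta> * T t))"
      by (intro integral_cong) (simp add: algebra_simps)
    also have "\<dots> = (b - b0) * I1 + I2"
      using int by (subst integral_add) (auto simp: I1_def I2_def intro: integrable_on_mult_right)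
    finally have at1: "(b - b0) * I1 = w 1 * (heat \<theta> - heat \<theta>0) - I2" using diff[of 1] DT DS by simp
    have h\<theta>: "heat \<theta> > 0" using heat_less_iff[of Ti \<theta>] \<theta> heat_Ti by simp
    define X where "X = \<bar>heat \<theta> - heat \<theta>0\<bar> + \<bar>\<Delta>\<bar>"
    have I1_pos: "0 \<le> I1" using I1 h\<theta> DT(1) W by (smt (verit) divide_pos_pos mult_pos_neg)
    have "\<bar>b - b0\<bar> * (heat \<theta> / b) \<le> \<bar>b - b0\<bar> * (W * I1)"
      by (intro mult_left_mono I1) auto
    also have "\<dots> = W * \<bar>w 1 * (heat \<theta> - heat \<theta>0) - I2\<bar>"
      unfolding at1[symmetric] using I1_pos by (simp add: abs_mult)
    also have "\<dots> \<le> W * (W * (M * X))"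
    proof (intro mult_left_mono)
      have "\<bar>heat \<theta> - heat \<theta>0\<bar> \<le> M * \<bar>heat \<theta> - heat \<theta>0\<bar>"
        using mult_right_mono[OF M(1), of "\<bar>heat \<theta> - heat \<theta>0\<bar>"] by simp
      hence "\<bar>w 1 * (heat \<theta> - heat \<theta>0)\<bar> \<le> W * (M * \<bar>heat \<theta> - heat \<theta>0\<bar>)" by (intro source) auto
      moreover have "W * (M * X) = W * (M * \<bar>heat \<theta> - heat \<theta>0\<bar>) + W * (M * \<bar>\<Delta>\<bar>)"
        by (simp add: X_def algebra_simps)
      ultimately show "\<bar>w 1 * (heat \<theta> - heat \<theta>0) - I2\<bar> \<le> W * (M * X)"
        using I2 abs_triangle_ineq4[of "w 1 * (heat \<theta> - heat \<theta>0)" I2] by linarith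
    qed (use W in simp)
    also have "\<dots> \<le> C * X" using C'[of 1 X] by (simp add: X_def)
    finally have "\<bar>b - b0\<bar> / b \<le> C * X / heat \<theta>" using h\<theta> by (simp add: pos_le_divide_eq)
    moreover have "\<bar>1 - b0 / b\<bar> = \<bar>b - b0\<bar> / b" using DT(1) by (simp add: field_simps abs_divide)
    ultimately have est1: "\<bar>1 - b0 / b\<bar> \<le> C * X / heat \<theta>" by simp
    have est2: "\<bar>T x - S x\<bar> \<le> C * (\<bar>b - b0\<bar> + \<bar>\<Delta>\<bar>)" if x: "x \<in> {0..1}" for x
    proof -
      define Y where "Y = \<bar>b - b0\<bar> + \<bar>\<Delta>\<bar>"
      have "\<bar>w x * (heat (T x) - heat (S x))\<bar> \<le> W * (M * Y)" unfolding diff[OF x]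
      proof (rule integral_abs_le[OF _ _ x])
        show "\<bar>w t * ((b - b0) * E t + b0 * \<Delta> * T t)\<bar> \<le> W * (M * Y)" if "t \<in> {0..1}" for t
          using abs_triangle_ineq[of "(b - b0) * E t" "b0 * \<Delta> * T t"] bE[OF that] bT[OF that]
          by (intro source[OF that]) (simp add: Y_def algebra_simps)
      qed (intro continuous_intros cw cE cT)
      hence "W * (w x * \<bar>heat (T x) - heat (S x)\<bar>) \<le> W * (W * (M * Y))"
        using w(1)[OF x] W by (intro mult_left_mono) (auto simp: abs_mult)
      moreover have "1 * \<bar>heat (T x) - heat (S x)\<bar> \<le> (W * w x) * \<bar>heat (T x) - heat (S x)\<bar>"
        by (intro mult_right_mono w(3) x) auto
      ultimately have "\<bar>heat (T x) - heat (S x)\<bar> \<le> W * (W * (M * Y))" by (simp add: mult.assoc)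
      hence "\<bar>heat (T x) - heat (S x)\<bar> / m \<le> W * (W * (M * Y)) * (1 / m)"
        using m(1) by (simp add: divide_right_mono)
      moreover have "\<bar>T x - S x\<bar> \<le> \<bar>heat (T x) - heat (S x)\<bar> / m" by (rule abs_diff_le_heat[OF m(2,1)])
      ultimately show ?thesis using C'[of "1 / m" Y] by (simp add: Y_def)
    qed
    note est1[unfolded X_def \<Delta>_def b0_def b_def c0_def] est2[unfolded b_def T_def b0_def S_def \<Delta>_def c0_def]
  }
  thus ?thesis by (intro that[OF C])
qed

lemma continuous_on_speed: "continuous_on {Ti<..} speed"
  unfolding speed_def using Ti by (intro continuous_intros) auto

lemma continuous_on_coeff: "continuous_on {Ti<..} coeff"
proof -
  have "(coeff \<longlongrightarrow> coeff \<theta>0) (at \<theta>0)" if \<theta>0: "\<theta>0 > Ti" for \<theta>0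
  proof -
    obtain C where C: "\<And>\<theta>. Ti < \<theta> \<Longrightarrow> \<theta> < 2 * \<theta>0 \<Longrightarrow>
       \<bar>1 - coeff \<theta>0 / coeff \<theta>\<bar> \<le> C * (\<bar>heat \<theta> - heat \<theta>0\<bar> + \<bar>speed \<theta> - speed \<theta>0\<bar>) / heat \<theta>"
      by (rule profile_difference_estimates[OF \<theta>0]) blast
    have h: "heat \<theta>0 > 0" using heat_less_iff[of Ti \<theta>0] \<theta>0 heat_Ti by simp
    have ts: "(speed \<longlongrightarrow> speed \<theta>0) (at \<theta>0)"
      using DERIV_isCont[OF speed_deriv] \<theta>0 Ti by (simp add: isCont_def)
    have th: "(heat \<longlongrightarrow> heat \<theta>0) (at \<theta>0)"
      using DERIV_isCont[OF heat_deriv] by (simp add: isCont_def)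
    have "((\<lambda>\<theta>. C * (\<bar>heat \<theta> - heat \<theta>0\<bar> + \<bar>speed \<theta> - speed \<theta>0\<bar>) / heat \<theta>) \<longlongrightarrow>
        C * (\<bar>heat \<theta>0 - heat \<theta>0\<bar> + \<bar>speed \<theta>0 - speed \<theta>0\<bar>) / heat \<theta>0) (at \<theta>0)"
      using h by (intro tendsto_intros ts th) auto
    hence lim: "((\<lambda>\<theta>. C * (\<bar>heat \<theta> - heat \<theta>0\<bar> + \<bar>speed \<theta> - speed \<theta>0\<bar>) / heat \<theta>) \<longlongrightarrow> 0) (at \<theta>0)"
      by simp
    have near: "\<forall>\<^sub>F \<theta> in at \<theta>0. \<theta> \<in> {Ti<..<2 * \<theta>0}"
      using \<theta>0 Ti by (intro eventually_at_in_open') auto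
    have "((\<lambda>\<theta>. 1 - coeff \<theta>0 / coeff \<theta>) \<longlongrightarrow> 0) (at \<theta>0)"
      by (rule Lim_null_comparison[OF _ lim]) (use near C in \<open>auto elim!: eventually_mono\<close>)
    from tendsto_diff[OF tendsto_const[of 1] this]
    have "((\<lambda>\<theta>. coeff \<theta>0 / coeff \<theta>) \<longlongrightarrow> 1) (at \<theta>0)" by simp
    from tendsto_divide[OF tendsto_const[of "coeff \<theta>0"] this]
    have "((\<lambda>\<theta>. coeff \<theta>0 / (coeff \<theta>0 / coeff \<theta>)) \<longlongrightarrow> coeff \<theta>0) (at \<theta>0)" by simp
    thus ?thesis using profileD(1)[OF \<theta>0] by simp
  qed
  thus ?thesis by (intro continuous_at_imp_continuous_on ballI) (simp add: isCont_def)
qed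

lemma continuous_on_profile_joint:
  "continuous_on ({0..1} \<times> {Ti<..}) (\<lambda>z. profile (snd z) (fst z))"
  unfolding continuous_on_def
proof
  fix z0 :: "real \<times> real" assume "z0 \<in> {0..1} \<times> {Ti<..}"
  then obtain x0 \<theta>0 where z0: "z0 = (x0, \<theta>0)" "x0 \<in> {0..1}" "\<theta>0 > Ti" by auto
  let ?F = "at z0 within {0..1} \<times> {Ti<..}"
  obtain C where C: "\<And>\<theta> x. Ti < \<theta> \<Longrightarrow> \<theta> < 2 * \<theta>0 \<Longrightarrow> x \<in> {0..1} \<Longrightarrow>
       \<bar>profile \<theta> x - profile \<theta>0 x\<bar> \<le> C * (\<bar>coeff \<theta> - coeff \<theta>0\<bar> + \<bar>speed \<theta> - speed \<theta>0\<bar>)"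
    by (rule profile_difference_estimates[OF z0(3)]) blast
  have "continuous_on ({0..1} \<times> {Ti<..})
      (\<lambda>z :: real \<times> real. C * (\<bar>coeff (snd z) - coeff \<theta>0\<bar> + \<bar>speed (snd z) - speed \<theta>0\<bar>))"
  proof -
    have "continuous_on ({0..1} \<times> {Ti<..}) (\<lambda>z :: real \<times> real. coeff (snd z))"
      by (rule continuous_on_compose2[OF continuous_on_coeff]) (auto intro!: continuous_intros)
    moreover have "continuous_on ({0..1} \<times> {Ti<..}) (\<lambda>z :: real \<times> real. speed (snd z))"
      by (rule continuous_on_compose2[OF continuous_on_speed]) (auto intro!: continuous_intros)
    ultimately show ?thesis by (intro continuous_intros) assumption+
  qed
  moreover have mem: "z0 \<in> {0..1} \<times> {Ti<..}" using z0 by simp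
  ultimately have lim: "((\<lambda>z. C * (\<bar>coeff (snd z) - coeff \<theta>0\<bar> + \<bar>speed (snd z) - speed \<theta>0\<bar>)) \<longlongrightarrow>
      C * (\<bar>coeff (snd z0) - coeff \<theta>0\<bar> + \<bar>speed (snd z0) - speed \<theta>0\<bar>)) ?F"
    unfolding continuous_on_def by (rule bspec)
  have zero: "C * (\<bar>coeff (snd z0) - coeff \<theta>0\<bar> + \<bar>speed (snd z0) - speed \<theta>0\<bar>) = 0"
    using z0(1) by simp
  have near: "\<forall>\<^sub>F z in ?F. fst z \<in> {0..1} \<and> Ti < snd z \<and> snd z < 2 * \<theta>0"
  proof -
    have "\<forall>\<^sub>F z in ?F. z \<in> UNIV \<times> {..<2 * \<theta>0}"
      by (rule topological_tendstoD[OF tendsto_ident_at]) (use z0 Ti in \<open>auto intro!: open_Times\<close>)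
    moreover have "\<forall>\<^sub>F z in ?F. z \<in> {0..1} \<times> {Ti<..}" by (simp add: eventually_at_filter)
    ultimately show ?thesis by eventually_elim auto
  qed
  have "((\<lambda>z. profile (snd z) (fst z) - profile \<theta>0 (fst z)) \<longlongrightarrow> 0) ?F"
    by (rule Lim_null_comparison[OF _ lim[unfolded zero]])
       (use near C in \<open>auto elim!: eventually_mono\<close>)
  moreover have "((\<lambda>z. profile \<theta>0 (fst z)) \<longlongrightarrow> profile \<theta>0 x0) ?F"
  proof -
    have "continuous_on ({0..1} \<times> {Ti<..}) (\<lambda>z. profile \<theta>0 (fst z))"
      by (rule continuous_on_compose2[OF continuous_on_profile[OF z0(3)]])
         (auto intro!: continuous_intros)
    hence "((\<lambda>z. profile \<theta>0 (fst z)) \<longlongrightarrow> profile \<theta>0 (fst z0)) ?F"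
      unfolding continuous_on_def using mem by (rule bspec)
    thus ?thesis by (simp only: z0(1) fst_conv)
  qed
  ultimately have "((\<lambda>z. (profile (snd z) (fst z) - profile \<theta>0 (fst z)) + profile \<theta>0 (fst z))
      \<longlongrightarrow> 0 + profile \<theta>0 x0) ?F"
    by (rule tendsto_add)
  thus "((\<lambda>z. profile (snd z) (fst z)) \<longlongrightarrow> profile (snd z0) (fst z0)) ?F" using z0 by simp
qed

lemma param_smooth_speed: "param_smooth n {Ti<..} (\<lambda>x \<theta>. speed \<theta>)"
  unfolding speed_def using Ti
  by (intro param_smooth_add param_smooth_divide param_smooth_param param_smooth_const) auto

lemma param_smooth_speed': "param_smooth n {Ti<..} (\<lambda>x \<theta>. speed' \<theta>)"
  unfolding speed'_def power2_eq_square using Ti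
  by (intro param_smooth_diff param_smooth_divide param_smooth_mult param_smooth_param param_smooth_const) auto

lemma param_smooth_excess:
  assumes "param_smooth n {Ti<..} (\<lambda>x \<theta>. profile \<theta> x)"
  shows "param_smooth n {Ti<..} (\<lambda>x \<theta>. excess (speed \<theta>) (profile \<theta> x) x)"
  unfolding excess_def power2_eq_square
  by (intro param_smooth_add[OF _ param_smooth_mult[OF param_smooth_const param_smooth_indep[OF continuous_on_powr_p]]]
      param_smooth_diff param_smooth_mult param_smooth_speed assms param_smooth_const param_smooth_divide)
     auto

lemma profile_ge_Ti: "\<theta> > Ti \<Longrightarrow> x \<in> {0..1} \<Longrightarrow> Ti \<le> profile \<theta> x"
  by (rule special_range(1)[OF special_profile])

lemma param_smooth_rate:
  assumes "param_smooth n {Ti<..} (\<lambda>x \<theta>. profile \<theta> x)"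
  shows "param_smooth n {Ti<..} (\<lambda>x \<theta>. rate (profile \<theta> x))"
proof (rule param_smooth_cong)
  show "param_smooth n {Ti<..} (\<lambda>x \<theta>. \<phi> (profile \<theta> x))"
    by (rule param_smooth_compose[OF _ assms Ck_on_phi]) (auto simp: profile_ge_Ti)
  show "\<phi> (profile \<theta> x) = rate (profile \<theta> x)" if "x \<in> {0..1}" "\<theta> \<in> {Ti<..}" for x \<theta>
    using profile_ge_Ti[of \<theta> x] that by (simp add: rate_eq)
qed simp

lemma param_smooth_rate_param: "param_smooth n {Ti<..} (\<lambda>x \<theta>. rate \<theta>)"
proof (rule param_smooth_cong)
  show "param_smooth n {Ti<..} (\<lambda>x \<theta>. \<phi> \<theta>)"
    by (rule param_smooth_compose[OF _ param_smooth_param Ck_on_phi]) auto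
qed (auto simp: rate_eq)

text \<open>The inverse of the integrating factor of the equation linearized along the profile.\<close>

definition damping :: "real \<Rightarrow> real \<Rightarrow> real" where
  "damping x \<theta> =
     exp (- integral {0..x} (\<lambda>t. coeff \<theta> * (speed \<theta> - profile \<theta> t) / rate (profile \<theta> t)))"

text \<open>The \<open>\<theta>\<close>-derivative of the coefficient: \<open>orbit_difference\<close> at \<open>x = 1\<close>, divided by the increment of \<open>\<theta>\<close>, in
the limit. The name \<open>profile'\<close> below has the corresponding meaning for the temperature.\<close>

definition coeff' :: "real \<Rightarrow> real" where
  "coeff' \<theta> =
     (damping 1 \<theta> * rate \<theta> - coeff \<theta> * speed' \<theta> * integral {0..1} (\<lambda>t. damping t \<theta> * profile \<theta> t))
     / integral {0..1} (\<lambda>t. damping t \<theta> * excess (speed \<theta>) (profile \<theta> t) t)"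

definition profile' :: "real \<Rightarrow> real \<Rightarrow> real" where
  "profile' \<theta> x =
     integral {0..x} (\<lambda>t. damping t \<theta> *
       (coeff' \<theta> * excess (speed \<theta>) (profile \<theta> t) t + coeff \<theta> * speed' \<theta> * profile \<theta> t))
     / (damping x \<theta> * rate (profile \<theta> x))"

lemma weighted_excess_integral_pos:
  assumes "\<theta> > Ti" and A: "continuous_on {0..1} A"
  shows "integral {0..1} (\<lambda>t. exp (- A t) * excess (speed \<theta>) (profile \<theta> t) t) > 0"
proof (rule integral_pos)
  show "continuous_on {0..1} (\<lambda>t. exp (- A t) * excess (speed \<theta>) (profile \<theta> t) t)"
    by (intro continuous_intros A continuous_on_excess continuous_on_profile assms(1))
qed (use special_excess_pos[OF special_profile[OF assms(1)]] in auto)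

lemma profile_smooth_0: "param_smooth 0 {Ti<..} (\<lambda>x \<theta>. profile \<theta> x)"
  using continuous_on_profile_joint by simp

lemma coeff_smooth_0: "param_smooth 0 {Ti<..} (\<lambda>x \<theta>. coeff \<theta>)"
proof -
  have "continuous_on ({0..1} \<times> {Ti<..}) (\<lambda>z :: real \<times> real. coeff (snd z))"
    by (rule continuous_on_compose2[OF continuous_on_coeff]) (auto intro!: continuous_intros)
  thus ?thesis by simp
qed

text \<open>For fixed \<open>\<theta>0\<close>, \<open>orbit_difference\<close> factors \<open>coeff \<theta> - coeff \<theta>0\<close> and \<open>profile \<theta> x - profile \<theta>0 x\<close> as
\<open>\<theta> - \<theta>0\<close> times expressions \<open>Q\<close> and \<open>V\<close>. These are continuous, since they are built from the jointly
continuous profile by algebra and integration, and at \<open>\<theta>0\<close> they reduce to the linearized formulas.\<close>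

lemma coeff_profile_deriv:
  assumes \<theta>0: "\<theta>0 > Ti"
  shows "(coeff has_real_derivative coeff' \<theta>0) (at \<theta>0)"
    and "x \<in> {0..1} \<Longrightarrow> ((\<lambda>\<theta>. profile \<theta> x) has_real_derivative profile' \<theta>0 x) (at \<theta>0)"
proof -
  define I where "I = {Ti<..}"
  have I: "open I" "convex I" "\<theta>0 \<in> I" using \<theta>0 by (auto simp: I_def)
  define b0 c0 S where "b0 = coeff \<theta>0" and "c0 = speed \<theta>0" and "S = profile \<theta>0"
  note S = special_profile[OF \<theta>0, folded b0_def S_def]
  note DS = specialD[OF S]
  define A where "A = (\<lambda>x \<theta>. integral {0..x} (\<lambda>t. growth b0 c0 (profile \<theta> t) (S t)))"
  define E where "E = (\<lambda>x \<theta>. excess (speed \<theta>) (profile \<theta> x) x)"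
  define J where "J = (\<lambda>\<theta>. integral {0..1} (\<lambda>t. exp (- A t \<theta>) * profile \<theta> t))"
  define N where "N = (\<lambda>\<theta>. integral {0..1} (\<lambda>t. exp (- A t \<theta>) * E t \<theta>))"
  define q where "q = (\<lambda>\<theta>. 1 / 2 - q0 / (\<theta> * \<theta>0))"
  define Q where "Q = (\<lambda>\<theta>. (exp (- A 1 \<theta>) * mean_rate \<theta> \<theta>0 - b0 * q \<theta> * J \<theta>) / N \<theta>)"
  define H where "H = (\<lambda>x \<theta>. integral {0..x} (\<lambda>t. exp (- A t \<theta>) * (Q \<theta> * E t \<theta> + b0 * q \<theta> * profile \<theta> t)))"
  define V where "V = (\<lambda>x \<theta>. H x \<theta> / (exp (- A x \<theta>) * mean_rate (profile \<theta> x) (S x)))"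

  have sP: "param_smooth 0 I (\<lambda>x \<theta>. profile \<theta> x)" using profile_smooth_0 by (simp add: I_def)
  have cS: "continuous_on ({0..1} \<times> I) (\<lambda>z. S (fst z))"
    by (rule continuous_on_compose2[OF orbitD(1)[OF DS(4)]]) (auto intro!: continuous_intros)
  have "param_smooth 0 I (\<lambda>x \<theta>. growth b0 c0 (profile \<theta> x) (S x))"
    using sP by (auto intro!: continuous_intros cS)
  hence sA: "param_smooth 0 I A" unfolding A_def by (rule param_smooth_integral[OF I(1,2)])
  have sE: "param_smooth 0 I E"
    unfolding E_def I_def by (rule param_smooth_excess[OF profile_smooth_0])
  have se: "param_smooth 0 I (\<lambda>x \<theta>. exp (- A x \<theta>))"
    by (rule param_smooth_exp[OF param_smooth_minus[OF sA]])
  have sJ: "param_smooth 0 I (\<lambda>x. J)"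
    unfolding J_def
    by (rule param_smooth_at_1[OF param_smooth_integral[OF I(1,2) param_smooth_mult[OF se sP]]])
  have sN: "param_smooth 0 I (\<lambda>x. N)"
    unfolding N_def
    by (rule param_smooth_at_1[OF param_smooth_integral[OF I(1,2) param_smooth_mult[OF se sE]]])
  have Npos: "N \<theta> > 0" if "\<theta> \<in> I" for \<theta>
    unfolding N_def E_def using that
    by (intro weighted_excess_integral_pos param_smooth_section[OF param_smooth_continuous[OF sA]])
       (auto simp: I_def)
  have sq: "param_smooth 0 I (\<lambda>x. q)"
    unfolding q_def using Ti \<theta>0
    by (intro param_smooth_diff param_smooth_divide param_smooth_mult param_smooth_param param_smooth_const)
       (auto simp: I_def)
  have sm: "param_smooth 0 I (\<lambda>x \<theta>. mean_rate \<theta> \<theta>0)"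
    by (auto intro!: continuous_intros)
  have sQ: "param_smooth 0 I (\<lambda>x. Q)"
    unfolding Q_def using Npos
    by (intro param_smooth_divide param_smooth_diff param_smooth_mult sJ sN sq sm param_smooth_const
        param_smooth_at_1[OF se]) (auto simp: less_imp_neq[symmetric])
  have sH: "param_smooth 0 I H"
    unfolding H_def
    by (intro param_smooth_integral[OF I(1,2)] param_smooth_mult param_smooth_add se sQ sE sq sP
        param_smooth_const)
  have sV: "param_smooth 0 I V"
    unfolding V_def
  proof (intro param_smooth_divide param_smooth_mult sH se)
    show "param_smooth 0 I (\<lambda>x \<theta>. mean_rate (profile \<theta> x) (S x))"
      using sP by (auto intro!: continuous_intros cS)
    show "exp (- A x \<theta>) * mean_rate (profile \<theta> x) (S x) \<noteq> 0" for x \<theta>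
      using mean_rate_pos[of "profile \<theta> x" "S x"] by simp
  qed

  have q: "speed \<theta> - c0 = (\<theta> - \<theta>0) * q \<theta>" if "\<theta> \<in> I" for \<theta>
    using that \<theta>0 Ti by (simp add: q_def c0_def speed_def I_def field_simps)
  have diff: "exp (- A x \<theta>) * (heat (profile \<theta> x) - heat (S x)) =
      integral {0..x} (\<lambda>t. exp (- A t \<theta>) * ((coeff \<theta> - b0) * E t \<theta> + b0 * (speed \<theta> - c0) * profile \<theta> t))"
    if "\<theta> \<in> I" "x \<in> {0..1}" for \<theta> x
    unfolding A_def E_def
    by (rule orbit_difference[OF profileD(4) DS(4)[folded c0_def]])
       (use that profileD(5) DS(5) in \<open>auto simp: I_def\<close>)
  have Q: "coeff \<theta> - b0 = (\<theta> - \<theta>0) * Q \<theta>" if \<theta>: "\<theta> \<in> I" for \<theta>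
  proof -
    have int: "(\<lambda>t. exp (- A t \<theta>) * E t \<theta>) integrable_on {0..1}"
        "(\<lambda>t. exp (- A t \<theta>) * profile \<theta> t) integrable_on {0..1}"
      by (intro integrable_continuous_real
          param_smooth_section[OF param_smooth_continuous[OF param_smooth_mult[OF se sE]] \<theta>]
          param_smooth_section[OF param_smooth_continuous[OF param_smooth_mult[OF se sP]] \<theta>])+
    have "exp (- A 1 \<theta>) * (heat \<theta> - heat \<theta>0) =
        integral {0..1} (\<lambda>t. exp (- A t \<theta>) * ((coeff \<theta> - b0) * E t \<theta> + b0 * (speed \<theta> - c0) * profile \<theta> t))"
      using diff[OF \<theta>, of 1] profileD(6)[of \<theta>] DS(6) \<theta> by (simp add: I_def)
    also have "\<dots> = integral {0..1} (\<lambda>t. (coeff \<theta> - b0) * (exp (- A t \<theta>) * E t \<theta>) +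
        b0 * (speed \<theta> - c0) * (exp (- A t \<theta>) * profile \<theta> t))"
      by (intro integral_cong) (simp add: algebra_simps)
    also have "\<dots> = (coeff \<theta> - b0) * N \<theta> + b0 * (speed \<theta> - c0) * J \<theta>"
      unfolding N_def J_def using int
      by (subst integral_add) (auto intro: integrable_on_mult_right)
    finally have "(coeff \<theta> - b0) * N \<theta> =
        (\<theta> - \<theta>0) * (exp (- A 1 \<theta>) * mean_rate \<theta> \<theta>0 - b0 * q \<theta> * J \<theta>)"
      by (simp add: heat_diff q[OF \<theta>] algebra_simps)
    thus ?thesis using Npos[OF \<theta>] by (simp add: Q_def field_simps)
  qed
  have V: "profile \<theta> x - S x = (\<theta> - \<theta>0) * V x \<theta>" if \<theta>: "\<theta> \<in> I" and x: "x \<in> {0..1}" for \<theta> x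
  proof -
    have "exp (- A x \<theta>) * (heat (profile \<theta> x) - heat (S x)) =
        integral {0..x} (\<lambda>t. (\<theta> - \<theta>0) * (exp (- A t \<theta>) * (Q \<theta> * E t \<theta> + b0 * q \<theta> * profile \<theta> t)))"
      unfolding diff[OF \<theta> x] by (intro integral_cong) (simp add: Q[OF \<theta>] q[OF \<theta>] algebra_simps)
    also have "\<dots> = (\<theta> - \<theta>0) * H x \<theta>" by (simp add: H_def)
    finally show ?thesis
      using mean_rate_pos[of "profile \<theta> x" "S x"]
      by (simp add: V_def heat_diff field_simps)
  qed

  \<comment> \<open>On the diagonal, \<open>mean_rate T T = rate T\<close>, and the averaged quantities become the linearized ones.\<close>
  have A0: "exp (- A x \<theta>0) = damping x \<theta>0" for x
    by (simp add: A_def damping_def growth_def mean_rate_same b0_def c0_def S_def)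
  have q': "q \<theta>0 = speed' \<theta>0" by (simp add: q_def speed'_def power2_eq_square)
  have Q0: "Q \<theta>0 = coeff' \<theta>0"
    by (simp add: Q_def coeff'_def J_def N_def E_def A0 q' mean_rate_same b0_def)
  have V0: "V x \<theta>0 = profile' \<theta>0 x" for x
    by (simp add: V_def profile'_def H_def E_def A0 q' Q0 mean_rate_same b0_def S_def)

  have "continuous_on I Q" using param_smooth_imp_Ck_on[OF sQ] by (simp add: Ck_on_0)
  from DERIV_from_quotient[OF I(1,3) this, of coeff] Q
  show "(coeff has_real_derivative coeff' \<theta>0) (at \<theta>0)" by (simp add: b0_def Q0)
  assume x: "x \<in> {0..1}"
  have "continuous_on I (V x)"
    by (rule continuous_on_compose_pair[OF param_smooth_continuous[OF sV]]) (use x in \<open>auto intro!: continuous_intros\<close>)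
  from DERIV_from_quotient[OF I(1,3) this, of "\<lambda>\<theta>. profile \<theta> x"] V[OF _ x]
  show "((\<lambda>\<theta>. profile \<theta> x) has_real_derivative profile' \<theta>0 x) (at \<theta>0)"
    by (simp add: S_def V0)
qed

text \<open>The formulas for the derivatives involve nothing but the profile, the coefficient and smooth functions of
them, so the derivatives are as smooth as the functions themselves.\<close>

lemma smooth_bootstrap:
  assumes P: "param_smooth n {Ti<..} (\<lambda>x \<theta>. profile \<theta> x)" and B: "param_smooth n {Ti<..} (\<lambda>x. coeff)"
  shows "param_smooth n {Ti<..} (\<lambda>x. coeff')" "param_smooth n {Ti<..} (\<lambda>x \<theta>. profile' \<theta> x)"
proof -
  have I: "open {Ti<..}" "convex {Ti<..}" by auto
  note R = param_smooth_rate[OF P] and E = param_smooth_excess[OF P]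
  have D: "param_smooth n {Ti<..} damping"
    unfolding damping_def[abs_def] using rate_pos
    by (intro param_smooth_exp param_smooth_minus param_smooth_integral[OF I] param_smooth_divide
        param_smooth_mult param_smooth_diff B P R param_smooth_speed) (auto simp: less_imp_neq[symmetric])
  have J: "param_smooth n {Ti<..} (\<lambda>x \<theta>. integral {0..1} (\<lambda>t. damping t \<theta> * profile \<theta> t))"
    by (rule param_smooth_at_1[OF param_smooth_integral[OF I param_smooth_mult[OF D P]]])
  have N: "param_smooth n {Ti<..} (\<lambda>x \<theta>. integral {0..1} (\<lambda>t. damping t \<theta> * excess (speed \<theta>) (profile \<theta> t) t))"
    by (rule param_smooth_at_1[OF param_smooth_integral[OF I param_smooth_mult[OF D E]]])
  have "integral {0..1} (\<lambda>t. damping t \<theta> * excess (speed \<theta>) (profile \<theta> t) t) \<noteq> 0" if "\<theta> > Ti" for \<theta>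
  proof -
    have "continuous_on {0..1} (\<lambda>x. integral {0..x} (\<lambda>t. coeff \<theta> * (speed \<theta> - profile \<theta> t) / rate (profile \<theta> t)))"
      using rate_pos
      by (intro indefinite_integral_continuous_1 integrable_continuous_real continuous_intros
          continuous_on_profile that) (auto simp: less_imp_neq[symmetric])
    from weighted_excess_integral_pos[OF that this] show ?thesis by (simp add: damping_def)
  qed
  thus C: "param_smooth n {Ti<..} (\<lambda>x. coeff')"
    unfolding coeff'_def[abs_def]
    by (intro param_smooth_divide[OF _ N] param_smooth_diff param_smooth_mult param_smooth_at_1[OF D] J B
        param_smooth_speed' param_smooth_rate_param) auto
  have "damping x \<theta> * rate (profile \<theta> x) \<noteq> 0" for x \<theta>
    using rate_pos[of "profile \<theta> x"] by (simp add: damping_def)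
  thus "param_smooth n {Ti<..} (\<lambda>x \<theta>. profile' \<theta> x)"
    unfolding profile'_def[abs_def]
    by (intro param_smooth_divide param_smooth_integral[OF I] param_smooth_mult param_smooth_add
        D C E B P R param_smooth_speed') auto
qed

lemma coeff_profile_smooth:
  "param_smooth n {Ti<..} (\<lambda>x \<theta>. profile \<theta> x) \<and> param_smooth n {Ti<..} (\<lambda>x. coeff)"
proof (induction n)
  case 0
  show ?case using profile_smooth_0 coeff_smooth_0 by simp
next
  case (Suc n)
  note b = smooth_bootstrap[OF Suc[THEN conjunct1] Suc[THEN conjunct2]]
  show ?case
    by (intro conjI param_smooth_SucI[OF _ b(2)] param_smooth_SucI[OF _ b(1)] coeff_profile_deriv)
       (use profile_smooth_0 coeff_smooth_0 in auto)
qed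

lemma Ck_on_speed: "Ck_on n speed {Ti<..}"
  by (rule param_smooth_imp_Ck_on[OF param_smooth_speed])

lemma continuous_on_coeff': "continuous_on {Ti<..} coeff'"
proof -
  have "param_smooth 0 {Ti<..} (\<lambda>x. coeff')"
    using smooth_bootstrap(1) coeff_profile_smooth by blast
  from param_smooth_imp_Ck_on[OF this] show ?thesis by (simp add: Ck_on_0)
qed

text \<open>At \<open>\<theta> = sqrt (2 * q0)\<close> the speed is stationary, and only the positive term of \<open>coeff'\<close> remains.\<close>

lemma coeff'_pos_at_sonic: "coeff' (sqrt (2 * q0)) > 0"
proof -
  define s where "s = sqrt (2 * q0)"
  have s: "s > Ti" using Ti by (simp add: s_def)
  have "speed' s = 0" using q0 by (simp add: speed'_def s_def)
  moreover have "continuous_on {0..1} (\<lambda>x. integral {0..x} (\<lambda>t. coeff s * (speed s - profile s t) / rate (profile s t)))"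
    using rate_pos
    by (intro indefinite_integral_continuous_1 integrable_continuous_real continuous_intros
        continuous_on_profile s) (auto simp: less_imp_neq[symmetric])
  note weighted_excess_integral_pos[OF s this]
  ultimately show ?thesis using rate_pos[of s]
    unfolding s_def[symmetric] coeff'_def damping_def by simp
qed

section \<open>Travelling waves and orbits\<close>

lemma one_minus_alpha: "(1 - \<alpha>) * p = 1" "p * \<alpha> = p - 1" "p * \<kappa> = K"
  using alpha by (auto simp: p_def \<kappa>_def field_simps)

text \<open>In the reaction zone \<open>Z powr (1 - \<alpha>)\<close> has the derivative \<open>\<kappa> * \<phi> T > 0\<close>, so \<open>1 - Z powr (1 - \<alpha>)\<close> can serve as
the independent variable.\<close>

lemma wave_imp_special:
  assumes wave: "traveling_wave q0 K \<alpha> Ti \<phi> \<beta> (speed \<theta>) L T Z"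
    and tail: "\<And>\<xi>. \<xi> \<le> - L \<Longrightarrow> T \<xi> = \<theta>" and \<theta>: "\<theta> > Ti"
  shows "\<exists>S. special (1 / (\<beta> * \<kappa>)) \<theta> S"
proof -
  define c where "c = speed \<theta>"
  have w: "\<beta> > 0" "L > 0" "Ck_on 1 T UNIV" "continuous_on UNIV Z" "T 0 = Ti"
    "\<And>\<xi>. \<xi> < 0 \<Longrightarrow> T \<xi> > Ti"
    "\<And>\<xi>. - L < \<xi> \<Longrightarrow> \<xi> < 0 \<Longrightarrow> Z \<xi> > 0"
    "\<And>\<xi>. - L < \<xi> \<Longrightarrow> \<xi> < 0 \<Longrightarrow> \<beta> * deriv T \<xi> = - c * T \<xi> + (T \<xi>)\<^sup>2 / 2 + q0 * (1 - Z \<xi>)"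
    "\<And>\<xi>. - L < \<xi> \<Longrightarrow> \<xi> < 0 \<Longrightarrow> (Z has_real_derivative K * \<phi> (T \<xi>) * Z \<xi> powr \<alpha>) (at \<xi>)"
    "Z 0 = 1" "Z (- L) = 0"
    using wave unfolding traveling_wave_def c_def[symmetric] by auto
  obtain T' where T': "\<And>x. (T has_real_derivative T' x) (at x)"
    using w(3) unfolding Ck_on_1_UNIV_iff by blast
  have cT: "continuous_on A T" for A
    by (rule DERIV_continuous_on) (rule has_field_derivative_at_within[OF T'])
  have cZ: "continuous_on A Z" for A by (rule continuous_on_subset[OF w(4)]) simp
  define X where "X = (\<lambda>s. 1 - Z (- s) powr (1 - \<alpha>))"
  have Z0: "Z (- s) \<ge> 0" if "s \<in> {0..L}" for s
  proof (cases "s = 0 \<or> s = L")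
    case False
    thus ?thesis using w(7)[of "- s"] that by auto
  qed (use w in auto)
  have cX: "continuous_on {0..L} X" unfolding X_def
  proof (intro continuous_on_diff continuous_on_const continuous_on_powr')
    show "continuous_on {0..L} (\<lambda>s. Z (- s))"
      by (rule continuous_on_compose2[OF w(4)]) (auto intro!: continuous_intros)
  qed (use Z0 alpha in auto)
  have dX: "(X has_real_derivative \<kappa> * rate (T (- s))) (at s)" if s: "0 < s" "s < L" for s
  proof -
    have Z: "Z (- s) > 0" using w(7)[of "- s"] s by auto
    have "((\<lambda>s. Z (- s)) has_real_derivative K * \<phi> (T (- s)) * Z (- s) powr \<alpha> * (- 1)) (at s)"
      by (rule DERIV_chain2[of Z _ "\<lambda>s. - s"]) (use w(9)[of "- s"] s in \<open>auto intro!: derivative_eq_intros\<close>)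
    hence "(X has_real_derivative
        - ((1 - \<alpha>) * Z (- s) powr (1 - \<alpha> - 1) * (K * \<phi> (T (- s)) * Z (- s) powr \<alpha> * (- 1)))) (at s)"
      unfolding X_def using Z
      by (auto intro!: derivative_eq_intros DERIV_chain2[OF has_real_derivative_powr])
    moreover have one: "Z (- s) powr (1 - \<alpha> - 1) * Z (- s) powr \<alpha> = 1"
      using Z by (simp flip: powr_add)
    have "- ((1 - \<alpha>) * Z (- s) powr (1 - \<alpha> - 1) * (K * \<phi> (T (- s)) * Z (- s) powr \<alpha> * (- 1)))
        = (1 - \<alpha>) * K * \<phi> (T (- s))"
    proof -
      have "- ((1 - \<alpha>) * y * (K * \<phi> (T (- s)) * z * (- 1))) = (1 - \<alpha>) * K * \<phi> (T (- s)) * (y * z)" for y z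
        by simp
      thus ?thesis using one by (simp only: mult_1_right)
    qed
    moreover have "rate (T (- s)) = \<phi> (T (- s))" using w(6)[of "- s"] s by (intro rate_eq) auto
    ultimately show ?thesis unfolding \<kappa>_def by (simp only:)
  qed
  have X0: "X 0 = 0" and XL: "X L = 1" using w alpha by (auto simp: X_def)
  obtain g where g: "continuous_on {0..1} g" "\<And>s. s \<in> {0..L} \<Longrightarrow> g (X s) = s"
    "\<And>s. s \<in> {0..L} \<Longrightarrow> X s \<in> {0..1}"
    "\<And>x. x \<in> {0..1} \<Longrightarrow> g x \<in> {0..L} \<and> X (g x) = x"
    "\<And>x. 0 < x \<Longrightarrow> x < 1 \<Longrightarrow>
       0 < g x \<and> g x < L \<and> (g has_real_derivative inverse (\<kappa> * rate (T (- g x)))) (at x)"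
    using increasing_inverse[OF less_imp_le[OF w(2)] cX X0 dX mult_pos_pos[OF kappa_pos rate_pos]]
    unfolding XL by blast
  define S where "S = (\<lambda>x. T (- g x))"
  have "orbit (1 / (\<beta> * \<kappa>)) c S" unfolding orbit_def
  proof (intro conjI ballI)
    show "continuous_on {0..1} S" unfolding S_def
      by (rule continuous_on_compose2[OF cT[of UNIV]]) (auto intro!: continuous_intros g(1))
    fix x :: real assume x: "x \<in> {0<..<1}"
    hence gx: "0 < g x" "g x < L" "X (g x) = x"
      "(g has_real_derivative inverse (\<kappa> * rate (S x))) (at x)"
      using g(4)[of x] g(5)[of x] by (auto simp: S_def)
    have "(S has_real_derivative T' (- g x) * (- inverse (\<kappa> * rate (S x)))) (at x)"
      unfolding S_def
      by (rule DERIV_chain2[OF T']) (use gx(4) in \<open>auto intro!: derivative_eq_intros simp: S_def\<close>)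
    moreover have "\<beta> * T' (- g x) = - excess c (S x) x"
    proof -
      have "Z (- g x) powr (1 - \<alpha>) = 1 - x" using gx(3) by (simp add: X_def)
      hence "(1 - x) powr p = (Z (- g x) powr (1 - \<alpha>)) powr p" by simp
      also have "\<dots> = Z (- g x)" using w(7)[of "- g x"] gx one_minus_alpha(1) by (simp add: powr_powr)
      finally show ?thesis
        using w(8)[of "- g x"] gx DERIV_imp_deriv[OF T'] by (simp add: excess_def S_def algebra_simps)
    qed
    hence "T' (- g x) = - excess c (S x) x / \<beta>" using w(1) by (simp add: field_simps)
    ultimately show "(S has_real_derivative 1 / (\<beta> * \<kappa>) * excess c (S x) x / rate (S x)) (at x)"
      by (simp add: divide_inverse mult_ac)
  qed
  moreover have "S 0 = Ti" using g(2)[of 0] X0 w(2,5) by (simp add: S_def)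
  moreover have "S 1 = \<theta>" using g(2)[of L] XL w(2) tail by (simp add: S_def)
  ultimately show ?thesis using w(1) kappa_pos \<theta> by (auto simp: special_def c_def)
qed

lemma c_cj_gt: "c \<ge> c_cj q0 \<Longrightarrow> c > Ti" using Ti by (simp add: c_cj_def)

text \<open>Position as a function of progress is an integral of \<open>1 / (\<kappa> * rate T)\<close>. Ahead of the zone the
equation for \<open>T\<close> is logistic and has the solution \<open>\<Lambda>\<close>; behind it, \<open>U\<close> prescribes the solution as a function
of the distance to the end of the zone. The position of the maximum of a bump is located by the last
conclusion.\<close>

lemma orbit_imp_wave:
  assumes orbit: "orbit b c S" and b: "b > 0" and S0: "S 0 = Ti" and S: "\<And>x. 0 < x \<Longrightarrow> x \<le> 1 \<Longrightarrow> S x > Ti"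
    and c: "c \<ge> c_cj q0"
    and U: "U 0 = S 1" "continuous_on {0..} U" "\<And>r. r \<ge> 0 \<Longrightarrow> U r > Ti"
      "\<And>r. r > 0 \<Longrightarrow> (U has_real_derivative (b * \<kappa>) * (c * U r - (U r)\<^sup>2 / 2 - q0)) (at r)"
      "(U \<longlongrightarrow> T_minus) at_top"
  defines "\<beta> \<equiv> 1 / (b * \<kappa>)"
  obtains L T Z where "traveling_wave q0 K \<alpha> Ti \<phi> \<beta> c L T Z" "\<And>\<xi>. \<xi> \<le> - L \<Longrightarrow> T \<xi> = U (- L - \<xi>)"
    "(T \<longlongrightarrow> T_minus) at_bot"
    "\<And>\<xi>. - L \<le> \<xi> \<Longrightarrow> \<xi> \<le> 0 \<Longrightarrow> \<exists>x\<in>{0..1}. T \<xi> = S x"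
    "\<And>x. 0 < x \<Longrightarrow> x < 1 \<Longrightarrow> \<exists>\<xi>\<in>{- L<..<0}. T \<xi> = S x"
proof -
  have \<beta>: "\<beta> > 0" and inv\<beta>: "1 / \<beta> = b * \<kappa>" using b kappa_pos by (auto simp: \<beta>_def)
  have cTi: "c > Ti" "c > 0" using c_cj_gt[OF c] Ti by auto
  note cS = orbitD(1)[OF orbit]
  have nz: "\<kappa> * rate T \<noteq> 0" for T using kappa_pos rate_pos[of T] by simp
  define X where "X = (\<lambda>x. integral {0..x} (\<lambda>t. inverse (\<kappa> * rate (S t))))"
  have ci: "continuous_on {0..1} (\<lambda>t. inverse (\<kappa> * rate (S t)))"
    by (intro continuous_intros cS) (use nz in auto)
  have dX: "(X has_real_derivative inverse (\<kappa> * rate (S x))) (at x within {0..1})" if "x \<in> {0..1}" for x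
    unfolding X_def by (rule integral_has_real_derivative[OF ci that])
  have cX: "continuous_on {0..1} X" by (rule DERIV_continuous_on) (rule dX)
  have dX': "(X has_real_derivative inverse (\<kappa> * rate (S x))) (at x)" if "0 < x" "x < 1" for x
    using dX[of x] that by (simp add: at_within_unit_interval)
  have pos: "inverse (\<kappa> * rate (S x)) > 0" for x using kappa_pos rate_pos by simp
  have X0: "X 0 = 0" by (simp add: X_def)
  define L where "L = X 1"
  have L: "L > 0" unfolding L_def X_def by (rule integral_pos[OF ci]) (use pos in auto)
  obtain g where g: "continuous_on {0..L} g" "\<And>x. x \<in> {0..1} \<Longrightarrow> g (X x) = x"
    "\<And>x. x \<in> {0..1} \<Longrightarrow> X x \<in> {0..L}"
    "\<And>s. s \<in> {0..L} \<Longrightarrow> g s \<in> {0..1} \<and> X (g s) = s"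
    "\<And>s. 0 < s \<Longrightarrow> s < L \<Longrightarrow> 0 < g s \<and> g s < 1 \<and>
       (g has_real_derivative inverse (inverse (\<kappa> * rate (S (g s))))) (at s)"
    using increasing_inverse[OF zero_le_one cX X0 dX' pos] unfolding L_def[symmetric] by blast
  have g0: "g 0 = 0" "g L = 1" using g(2)[of 0] g(2)[of 1] X0 by (auto simp: L_def)
  \<comment> \<open>The constant for which the logistic profile takes the value \<open>Ti\<close> at \<open>\<xi> = 0\<close>.\<close>
  define a where "a = 2 * c / Ti - 1"
  have a: "a > 0" using cTi Ti by (simp add: a_def field_simps)
  define \<Lambda> where "\<Lambda> = (\<lambda>\<xi>. 2 * c / (1 + a * exp (c * \<xi> / \<beta>)))"
  have den: "1 + a * exp (c * \<xi> / \<beta>) > 0" for \<xi> using a by (intro add_pos_pos mult_pos_pos) auto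
  define T where "T = (\<lambda>\<xi>. if \<xi> \<le> 0 then (if \<xi> \<le> - L then U (- L - \<xi>) else S (g (- \<xi>))) else \<Lambda> \<xi>)"
  define Z where "Z = (\<lambda>\<xi>. if \<xi> \<le> 0 then (if \<xi> \<le> - L then 0 else (1 - g (- \<xi>)) powr p) else 1)"
  define D where "D = (\<lambda>\<xi>. (1 / \<beta>) * (- c * T \<xi> + (T \<xi>)\<^sup>2 / 2 + q0 * (1 - Z \<xi>)))"
  have cgm: "continuous_on {\<xi> \<in> {\<xi> \<in> UNIV. \<xi> \<le> 0}. - L \<le> \<xi>} (\<lambda>\<xi>. g (- \<xi>))"
    by (rule continuous_on_compose2[OF g(1)]) (auto intro!: continuous_intros)
  have c\<Lambda>: "continuous_on A \<Lambda>" for A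
    unfolding \<Lambda>_def using den by (intro continuous_intros) (auto simp: less_imp_neq[symmetric] \<beta>_def b kappa_pos)
  have contT: "continuous_on UNIV T" unfolding T_def
  proof (intro continuous_on_cases_le continuous_on_id c\<Lambda>)
    show "continuous_on {\<xi> \<in> {\<xi> \<in> UNIV. \<xi> \<le> 0}. \<xi> \<le> - L} (\<lambda>\<xi>. U (- L - \<xi>))"
      by (rule continuous_on_compose2[OF U(2)]) (auto intro!: continuous_intros)
    show "continuous_on {\<xi> \<in> {\<xi> \<in> UNIV. \<xi> \<le> 0}. - L \<le> \<xi>} (\<lambda>\<xi>. S (g (- \<xi>)))"
      by (rule continuous_on_compose2[OF cS cgm]) (use g(4) in force)
    show "U (- L - \<xi>) = S (g (- \<xi>))" if "\<xi> = - L" for \<xi> using that U(1) g0 by simp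
    show "(if \<xi> \<le> - L then U (- L - \<xi>) else S (g (- \<xi>))) = \<Lambda> \<xi>" if "\<xi> = 0" for \<xi>
      using that L g0 S0 cTi Ti by (simp add: \<Lambda>_def a_def)
  qed
  have contZ: "continuous_on UNIV Z" unfolding Z_def
  proof (intro continuous_on_cases_le continuous_on_id continuous_on_const)
    show "continuous_on {\<xi> \<in> {\<xi> \<in> UNIV. \<xi> \<le> 0}. - L \<le> \<xi>} (\<lambda>\<xi>. (1 - g (- \<xi>)) powr p)"
      by (rule continuous_on_compose2[OF continuous_on_powr_p cgm]) (use g(4) in force)
    show "0 = (1 - g (- \<xi>)) powr p" if "\<xi> = - L" for \<xi> using that g0 by simp
    show "(if \<xi> \<le> - L then 0 else (1 - g (- \<xi>)) powr p) = 1" if "\<xi> = 0" for \<xi>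
      using that L g0 by simp
  qed
  have contD: "continuous_on UNIV D" unfolding D_def by (intro continuous_intros contT contZ) simp
  have zone: "T \<xi> = S (g (- \<xi>))" "Z \<xi> = (1 - g (- \<xi>)) powr p" if "- L < \<xi>" "\<xi> < 0" for \<xi>
    using that by (auto simp: T_def Z_def)
  have dg: "((\<lambda>\<xi>. g (- \<xi>)) has_real_derivative - (\<kappa> * rate (T \<xi>))) (at \<xi>)" if "- L < \<xi>" "\<xi> < 0" for \<xi>
  proof -
    have "((\<lambda>\<xi>. g (- \<xi>)) has_real_derivative inverse (inverse (\<kappa> * rate (S (g (- \<xi>))))) * (- 1)) (at \<xi>)"
      by (rule DERIV_chain2[of g _ "\<lambda>\<xi>. - \<xi>"]) (use g(5)[of "- \<xi>"] that in \<open>auto intro!: derivative_eq_intros\<close>)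
    thus ?thesis using zone[OF that] by simp
  qed
  have derT0: "(T has_real_derivative D \<xi>) (at \<xi>)" if "\<xi> \<notin> {- L, 0}" for \<xi>
  proof -
    consider "\<xi> < - L" | "- L < \<xi>" "\<xi> < 0" | "0 < \<xi>" using \<open>\<xi> \<notin> {- L, 0}\<close> by fastforce
    thus ?thesis
    proof cases
      case 1
      have "((\<lambda>\<xi>. U (- L - \<xi>)) has_real_derivative
          ((b * \<kappa>) * (c * U (- L - \<xi>) - (U (- L - \<xi>))\<^sup>2 / 2 - q0)) * (- 1)) (at \<xi>)"
        by (rule DERIV_chain2[of U _ "\<lambda>\<xi>. - L - \<xi>"]) (use U(4)[of "- L - \<xi>"] 1 in \<open>auto intro!: derivative_eq_intros\<close>)
      moreover have "((b * \<kappa>) * (c * U (- L - \<xi>) - (U (- L - \<xi>))\<^sup>2 / 2 - q0)) * (- 1) = D \<xi>"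
        unfolding D_def inv\<beta> using 1 L by (simp add: T_def Z_def algebra_simps)
      ultimately have *: "((\<lambda>\<xi>. U (- L - \<xi>)) has_real_derivative D \<xi>) (at \<xi>)" by simp
      show ?thesis
        by (rule has_field_derivative_transform_within_open[OF *, of "{..<- L}"]) (use 1 L in \<open>auto simp: T_def\<close>)
    next
      case 2
      define x where "x = g (- \<xi>)"
      have x: "0 < x" "x < 1" using g(5)[of "- \<xi>"] 2 by (auto simp: x_def)
      have "((\<lambda>\<xi>. S (g (- \<xi>))) has_real_derivative
          (b * excess c (S x) x / rate (S x)) * (- (\<kappa> * rate (T \<xi>)))) (at \<xi>)"
        by (rule DERIV_chain2[OF _ dg[OF 2]]) (use orbitD(2)[OF orbit x] in \<open>simp add: x_def\<close>)
      moreover have "(b * excess c (S x) x / rate (S x)) * (- (\<kappa> * rate (T \<xi>))) = D \<xi>"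
        unfolding D_def inv\<beta> zone[OF 2] x_def[symmetric] using rate_pos[of "S x"]
        by (simp add: excess_def field_simps)
      ultimately have *: "((\<lambda>\<xi>. S (g (- \<xi>))) has_real_derivative D \<xi>) (at \<xi>)" by simp
      show ?thesis
        by (rule has_field_derivative_transform_within_open[OF *, of "{- L<..<0}"]) (use 2 in \<open>auto simp: T_def\<close>)
    next
      case 3
      define e where "e = exp (c * \<xi> / \<beta>)"
      have "(\<Lambda> has_real_derivative - (2 * c * (a * (e * (c / \<beta>)))) / (1 + a * e)\<^sup>2) (at \<xi>)"
        unfolding \<Lambda>_def e_def using den[of \<xi>] \<beta>
        by (auto intro!: derivative_eq_intros simp: power2_eq_square)
      moreover have "- (2 * c * (a * (e * (c / \<beta>)))) / (1 + a * e)\<^sup>2 = D \<xi>"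
      proof -
        have T: "T \<xi> = 2 * c / (1 + a * e)" and Z: "Z \<xi> = 1" using 3 by (auto simp: T_def Z_def \<Lambda>_def e_def)
        define s where "s = 1 + a * e"
        have s: "s \<noteq> 0" using den[of \<xi>] by (simp add: s_def e_def)
        have ae: "a * (e * (c / \<beta>)) = (s - 1) * (c / \<beta>)" by (simp add: s_def)
        show ?thesis unfolding ae D_def T Z s_def[symmetric] using \<beta> s
          by (simp add: field_simps power2_eq_square)
      qed
      ultimately have *: "(\<Lambda> has_real_derivative D \<xi>) (at \<xi>)" by simp
      show ?thesis
        by (rule has_field_derivative_transform_within_open[OF *, of "{0<..}"]) (use 3 in \<open>auto simp: T_def\<close>)
    qed
  qed
  have derT: "(T has_real_derivative D \<xi>) (at \<xi>)" for \<xi>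
    by (rule has_real_derivative_across_finite[OF contT contD, of "{- L, 0}"]) (use derT0 in auto)
  have ode: "\<beta> * deriv T \<xi> = - c * T \<xi> + (T \<xi>)\<^sup>2 / 2 + q0 * (1 - Z \<xi>)" for \<xi>
    using DERIV_imp_deriv[OF derT[of \<xi>]] \<beta> by (simp add: D_def)
  have ahead: "T \<xi> < Ti" if "\<xi> > 0" for \<xi>
  proof -
    have "1 < exp (c * \<xi> / \<beta>)" using that cTi \<beta> by simp
    hence "a < a * exp (c * \<xi> / \<beta>)" using a by simp
    hence "2 * c / Ti < 1 + a * exp (c * \<xi> / \<beta>)" by (simp add: a_def)
    thus ?thesis using that Ti den[of \<xi>] by (simp add: T_def \<Lambda>_def field_simps)
  qed
  have behind: "T \<xi> > Ti" if "\<xi> < 0" for \<xi>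
  proof (cases "\<xi> \<le> - L")
    case False
    thus ?thesis using zone[of \<xi>] that S[of "g (- \<xi>)"] g(5)[of "- \<xi>"] by auto
  qed (use that U(3)[of "- L - \<xi>"] L in \<open>auto simp: T_def\<close>)
  have lim0: "(T \<longlongrightarrow> 0) at_top"
  proof -
    have "(\<Lambda> \<longlongrightarrow> 0) at_top" unfolding \<Lambda>_def using cTi(2) \<beta> a by real_asymp
    moreover have "\<forall>\<^sub>F \<xi> in at_top. \<Lambda> \<xi> = T \<xi>"
      using eventually_gt_at_top[of 0] by eventually_elim (simp add: T_def)
    ultimately show ?thesis by (rule Lim_transform_eventually)
  qed
  have limm: "(T \<longlongrightarrow> T_minus) at_bot"
  proof -
    have "filterlim (\<lambda>\<xi>. - L - \<xi>) at_top at_bot" by real_asymp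
    from filterlim_compose[OF U(5) this] have "((\<lambda>\<xi>. U (- L - \<xi>)) \<longlongrightarrow> T_minus) at_bot" .
    moreover have "\<forall>\<^sub>F \<xi> in at_bot. U (- L - \<xi>) = T \<xi>"
      using eventually_le_at_bot[of "- L"] by eventually_elim (use L in \<open>simp add: T_def\<close>)
    ultimately show ?thesis by (rule Lim_transform_eventually)
  qed
  have "traveling_wave q0 K \<alpha> Ti \<phi> \<beta> c L T Z" unfolding traveling_wave_def
  proof (intro conjI allI impI ballI)
    show "Ck_on 1 T UNIV" unfolding Ck_on_1_UNIV_iff using derT contD by blast
    show "\<exists>T_minus. (T \<longlongrightarrow> T_minus) at_bot" using limm by blast
  next
    fix \<xi> assume \<xi>: "\<xi> \<in> {- L<..<0}"
    hence z: "- L < \<xi>" "\<xi> < 0" by auto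
    define x where "x = g (- \<xi>)"
    have x: "0 < x" "x < 1" using g(5)[of "- \<xi>"] z by (auto simp: x_def)
    have Zx: "Z \<xi> = (1 - x) powr p" using zone(2)[OF z] by (simp add: x_def)
    show "Z \<xi> > 0" using Zx x by simp
    show "\<beta> * deriv T \<xi> = - c * T \<xi> + (T \<xi>)\<^sup>2 / 2 + q0 * (1 - Z \<xi>)" by (rule ode)
    have "((\<lambda>\<xi>. (1 - g (- \<xi>)) powr p) has_real_derivative
        - (p * (1 - x) powr (p - 1)) * - (\<kappa> * rate (T \<xi>))) (at \<xi>)"
      by (rule DERIV_chain2[OF _ dg[OF z]]) (use powr_p_deriv[OF x(2)] in \<open>simp add: x_def\<close>)
    moreover have "- (p * (1 - x) powr (p - 1)) * - (\<kappa> * rate (T \<xi>)) = K * \<phi> (T \<xi>) * Z \<xi> powr \<alpha>"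
    proof -
      have "Z \<xi> powr \<alpha> = (1 - x) powr (p - 1)" unfolding Zx by (simp add: powr_powr one_minus_alpha)
      moreover have "rate (T \<xi>) = \<phi> (T \<xi>)" using behind[OF z(2)] by (simp add: rate_eq)
      moreover have "- (p * y) * - (\<kappa> * z) = (p * \<kappa>) * z * y" for y z by simp
      ultimately show ?thesis by (simp only: one_minus_alpha(3))
    qed
    ultimately have *: "((\<lambda>\<xi>. (1 - g (- \<xi>)) powr p) has_real_derivative K * \<phi> (T \<xi>) * Z \<xi> powr \<alpha>) (at \<xi>)"
      by simp
    show "(Z has_real_derivative K * \<phi> (T \<xi>) * Z \<xi> powr \<alpha>) (at \<xi>)"
      by (rule has_field_derivative_transform_within_open[OF *, of "{- L<..<0}"]) (use z in \<open>auto simp: Z_def\<close>)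
  next
    fix \<xi> assume \<xi>: "\<xi> < - L"
    show "Z \<xi> = 0" using \<xi> L by (simp add: Z_def)
    thus "\<beta> * deriv T \<xi> = - c * T \<xi> + (T \<xi>)\<^sup>2 / 2 + q0" using ode[of \<xi>] by simp
  next
    fix \<xi> :: real assume \<xi>: "\<xi> > 0"
    show "Z \<xi> = 1" using \<xi> by (simp add: Z_def)
    thus "\<beta> * deriv T \<xi> = - c * T \<xi> + (T \<xi>)\<^sup>2 / 2" using ode[of \<xi>] by simp
  qed (use \<beta> c L contZ ahead behind lim0 g0 S0 in \<open>auto simp: T_def Z_def\<close>)
  moreover have "T \<xi> = U (- L - \<xi>)" if "\<xi> \<le> - L" for \<xi> using that L by (simp add: T_def)
  moreover note limm
  moreover have "\<exists>x\<in>{0..1}. T \<xi> = S x" if "- L \<le> \<xi>" "\<xi> \<le> 0" for \<xi>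
  proof (cases "\<xi> = - L")
    case True
    thus ?thesis using L U(1) by (intro bexI[of _ 1]) (auto simp: T_def)
  next
    case False
    thus ?thesis using that g(4)[of "- \<xi>"] by (intro bexI[of _ "g (- \<xi>)"]) (auto simp: T_def)
  qed
  moreover have "\<exists>\<xi>\<in>{- L<..<0}. T \<xi> = S x" if x: "0 < x" "x < 1" for x
  proof (intro bexI[of _ "- X x"])
    have r: "X x \<in> {0..L}" "g (X x) = x" using g(2,3)[of x] x by auto
    hence "X x \<noteq> 0" "X x \<noteq> L" using g0 x by auto
    thus m: "- X x \<in> {- L<..<0}" using r by auto
    show "T (- X x) = S x" using m r by (auto simp: T_def)
  qed
  ultimately show ?thesis by (rule that)
qed

section \<open>The curve of special waves\<close>

text \<open>The burnt temperature, and at the same time the speed, of Chapman-Jouguet waves.\<close>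

definition sonic :: real where "sonic = sqrt (2 * q0)"

definition viscosity :: "real \<Rightarrow> real" where "viscosity \<theta> = 1 / (\<kappa> * coeff \<theta>)"

definition viscosity' :: "real \<Rightarrow> real" where "viscosity' \<theta> = - coeff' \<theta> / (\<kappa> * (coeff \<theta>)\<^sup>2)"

lemma sonic_facts: "sonic > Ti" "sonic > 0" "sonic\<^sup>2 = 2 * q0" "sonic * sonic = 2 * q0"
  using Ti q0 by (auto simp: sonic_def)

lemma c_cj_eq: "c_cj q0 = sonic" by (simp add: c_cj_def sonic_def)

lemma speed_minus_sonic: "\<theta> > 0 \<Longrightarrow> speed \<theta> - sonic = (\<theta> - sonic)\<^sup>2 / (2 * \<theta>)"
  using sonic_facts(4) by (simp add: speed_def field_simps power2_eq_square)

lemma speed_sonic: "speed sonic = sonic" using speed_minus_sonic[OF sonic_facts(2)] by simp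

lemma speed_ge: "\<theta> > 0 \<Longrightarrow> c_cj q0 \<le> speed \<theta>"
proof -
  assume "\<theta> > 0"
  hence "0 \<le> speed \<theta> - sonic" unfolding speed_minus_sonic[OF \<open>\<theta> > 0\<close>] by simp
  thus "c_cj q0 \<le> speed \<theta>" by (simp add: c_cj_eq)
qed

lemma speed_eqI: "\<theta> > 0 \<Longrightarrow> (\<theta> - c)\<^sup>2 = c\<^sup>2 - 2 * q0 \<Longrightarrow> speed \<theta> = c"
  by (simp add: speed_def field_simps power2_eq_square)

lemma T0_end_state:
  assumes "c \<ge> c_cj q0"
  shows "speed (T0 q0 c) = c" "sonic \<le> T0 q0 c"
proof -
  have c: "c \<ge> sonic" "c > 0" using assms sonic_facts by (auto simp: c_cj_eq)
  have "c\<^sup>2 \<ge> sonic\<^sup>2" using c sonic_facts(2) by (intro power_mono) auto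
  hence sq: "c\<^sup>2 - 2 * q0 \<ge> 0" by (simp add: sonic_facts)
  hence "0 \<le> sqrt (c\<^sup>2 - 2 * q0)" by (rule real_sqrt_ge_zero)
  thus "sonic \<le> T0 q0 c" using c unfolding T0_def by linarith
  thus "speed (T0 q0 c) = c" using sq sonic_facts(2) by (intro speed_eqI) (auto simp: T0_def)
qed

lemma T1_end_state:
  assumes "c \<ge> c_cj q0" "c < c_star q0 Ti"
  shows "speed (T1 q0 c) = c" "Ti < T1 q0 c" "T1 q0 c \<le> sonic"
proof -
  have c: "c \<ge> sonic" "c > Ti" using assms sonic_facts by (auto simp: c_cj_eq)
  have "c\<^sup>2 \<ge> sonic\<^sup>2" using c sonic_facts(2) by (intro power_mono) auto
  hence sq: "c\<^sup>2 - 2 * q0 \<ge> 0" by (simp add: sonic_facts)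
  have "c * (2 * Ti) < Ti\<^sup>2 + 2 * q0" using assms(2) Ti by (simp add: c_star_def field_simps)
  hence "c\<^sup>2 - 2 * q0 < (c - Ti)\<^sup>2" by (simp add: power2_diff)
  hence "sqrt (c\<^sup>2 - 2 * q0) < c - Ti" using c by (intro real_less_lsqrt) auto
  thus *: "Ti < T1 q0 c" by (simp add: T1_def)
  thus "speed (T1 q0 c) = c" using sq Ti by (intro speed_eqI) (auto simp: T1_def)
  have "(c - sonic)\<^sup>2 \<le> c\<^sup>2 - 2 * q0"
    using mult_right_mono[OF c(1), of sonic] sonic_facts by (simp add: power2_diff)
  hence "c - sonic \<le> sqrt (c\<^sup>2 - 2 * q0)" by (rule real_le_rsqrt)
  thus "T1 q0 c \<le> sonic" by (simp add: T1_def)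
qed

lemma sqrt_speed: "\<theta> > 0 \<Longrightarrow> sqrt ((speed \<theta>)\<^sup>2 - 2 * q0) = \<bar>\<theta> - speed \<theta>\<bar>"
proof -
  assume "\<theta> > 0"
  hence "(speed \<theta>)\<^sup>2 - 2 * q0 = (\<theta> - speed \<theta>)\<^sup>2"
    by (simp add: speed_def field_simps power2_eq_square)
  thus ?thesis by simp
qed

lemma minus_speed: "\<theta> > 0 \<Longrightarrow> \<theta> - speed \<theta> = (\<theta> + sonic) * (\<theta> - sonic) / (2 * \<theta>)"
  using sonic_facts(4) by (simp add: speed_def field_simps)

lemma T0_speed: "sonic \<le> \<theta> \<Longrightarrow> T0 q0 (speed \<theta>) = \<theta>"
  using minus_speed[of \<theta>] sonic_facts(2) by (simp add: T0_def sqrt_speed)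

lemma T1_speed:
  assumes "Ti < \<theta>" "\<theta> \<le> sonic"
  shows "T1 q0 (speed \<theta>) = \<theta>" "speed \<theta> < c_star q0 Ti"
proof -
  have \<theta>: "\<theta> > 0" using assms Ti by simp
  have "(\<theta> + sonic) * (\<theta> - sonic) \<le> 0" using assms \<theta> sonic_facts by (simp add: mult_nonneg_nonpos)
  hence "\<theta> - speed \<theta> \<le> 0" using minus_speed[OF \<theta>] \<theta> by (simp add: divide_nonpos_pos)
  thus "T1 q0 (speed \<theta>) = \<theta>" using \<theta> by (simp add: T1_def sqrt_speed)
  have "\<theta> * Ti < sonic * sonic" using assms \<theta> Ti sonic_facts by (intro mult_le_less_imp_less) auto
  hence "0 < (\<theta> - Ti) * (2 * q0 - \<theta> * Ti)" using assms sonic_facts(4) by simp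
  thus "speed \<theta> < c_star q0 Ti"
    using \<theta> Ti by (simp add: speed_def c_star_def field_simps power2_eq_square)
qed

lemma viscosity_pos: "\<theta> > Ti \<Longrightarrow> viscosity \<theta> > 0"
  using profileD(1) kappa_pos by (simp add: viscosity_def)

text \<open>The link between waves and the functions of \<open>\<theta>\<close> studied above: the viscosity of a special wave is
determined by its burnt temperature.\<close>

lemma end_state_wave_iff:
  assumes \<theta>: "\<theta> > Ti"
  shows "(\<exists>L T Z. traveling_wave q0 K \<alpha> Ti \<phi> \<beta> (speed \<theta>) L T Z \<and> (\<forall>\<xi>\<le>- L. T \<xi> = \<theta>))
    \<longleftrightarrow> \<beta> = viscosity \<theta>"
proof
  assume "\<exists>L T Z. traveling_wave q0 K \<alpha> Ti \<phi> \<beta> (speed \<theta>) L T Z \<and> (\<forall>\<xi>\<le>- L. T \<xi> = \<theta>)"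
  then obtain L T Z where w: "traveling_wave q0 K \<alpha> Ti \<phi> \<beta> (speed \<theta>) L T Z"
    "\<And>\<xi>. \<xi> \<le> - L \<Longrightarrow> T \<xi> = \<theta>" by blast
  obtain S where "special (1 / (\<beta> * \<kappa>)) \<theta> S" using wave_imp_special[OF w \<theta>] by blast
  hence eq: "coeff \<theta> = 1 / (\<beta> * \<kappa>)" by (rule coeff_unique[symmetric])
  have "\<beta> > 0" using w(1) by (simp add: traveling_wave_def)
  thus "\<beta> = viscosity \<theta>" using kappa_pos unfolding viscosity_def eq by simp
next
  assume \<beta>: "\<beta> = viscosity \<theta>"
  have th0: "\<theta> > 0" using \<theta> Ti by simp
  note D = profileD[OF \<theta>]
  have "speed \<theta> * \<theta> - \<theta>\<^sup>2 / 2 - q0 = 0"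
    using th0 by (simp add: speed_def field_simps power2_eq_square)
  hence eq: "((\<lambda>_. \<theta>) has_real_derivative coeff \<theta> * \<kappa> * (speed \<theta> * \<theta> - \<theta>\<^sup>2 / 2 - q0)) (at r)" for r
    by simp
  have above: "profile \<theta> x > Ti" if "0 < x" "x \<le> 1" for x
    using special_range(3)[OF special_profile[OF \<theta>], of x] that by simp
  obtain L T Z where "traveling_wave q0 K \<alpha> Ti \<phi> (1 / (coeff \<theta> * \<kappa>)) (speed \<theta>) L T Z"
    "\<And>\<xi>. \<xi> \<le> - L \<Longrightarrow> T \<xi> = \<theta>" "(T \<longlongrightarrow> \<theta>) at_bot"
    "\<And>\<xi>. - L \<le> \<xi> \<Longrightarrow> \<xi> \<le> 0 \<Longrightarrow> \<exists>x\<in>{0..1}. T \<xi> = profile \<theta> x"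
    "\<And>x. 0 < x \<Longrightarrow> x < 1 \<Longrightarrow> \<exists>\<xi>\<in>{- L<..<0}. T \<xi> = profile \<theta> x"
    using orbit_imp_wave[OF D(4,1,5) above speed_ge[OF th0] D(6)[symmetric] continuous_on_const \<theta> eq tendsto_const]
    by blast
  thus "\<exists>L T Z. traveling_wave q0 K \<alpha> Ti \<phi> \<beta> (speed \<theta>) L T Z \<and> (\<forall>\<xi>\<le>- L. T \<xi> = \<theta>)"
    unfolding \<beta> viscosity_def by (auto simp: mult.commute)
qed

lemma is_beta0_iff: "c \<ge> c_cj q0 \<Longrightarrow> is_beta0 q0 K \<alpha> Ti \<phi> c \<beta> \<longleftrightarrow> \<beta> = viscosity (T0 q0 c)"
  using end_state_wave_iff[of "T0 q0 c" \<beta>] T0_end_state[of c] sonic_facts(1)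
  by (simp add: is_beta0_def strong_special_wave_def)

lemma is_beta1_iff:
  "c \<ge> c_cj q0 \<Longrightarrow> c < c_star q0 Ti \<Longrightarrow> is_beta1 q0 K \<alpha> Ti \<phi> c \<beta> \<longleftrightarrow> \<beta> = viscosity (T1 q0 c)"
  using end_state_wave_iff[of "T1 q0 c" \<beta>] T1_end_state[of c]
  by (simp add: is_beta1_def weak_special_wave_def)

lemma beta0_eq: "c \<ge> c_cj q0 \<Longrightarrow> beta0 q0 K \<alpha> Ti \<phi> c = viscosity (T0 q0 c)"
  by (simp add: beta0_def is_beta0_iff)

lemma beta1_eq: "c \<ge> c_cj q0 \<Longrightarrow> c < c_star q0 Ti \<Longrightarrow> beta1 q0 K \<alpha> Ti \<phi> c = viscosity (T1 q0 c)"
  by (simp add: beta1_def is_beta1_iff)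

lemma c_cj_less_c_star: "c_cj q0 < c_star q0 Ti"
  using T1_speed(2)[OF sonic_facts(1)] by (simp add: speed_sonic c_cj_eq)

lemma T_at_sonic: "T0 q0 (c_cj q0) = sonic" "T1 q0 (c_cj q0) = sonic"
  using T0_speed[of sonic] T1_speed(1)[OF sonic_facts(1)] by (simp_all add: c_cj_eq speed_sonic)

definition curve_point :: "real \<Rightarrow> real \<times> real" where
  "curve_point \<theta> = (viscosity \<theta>, speed \<theta>)"

text \<open>Both branches of \<open>(B)\<close> are parametrized by the burnt temperature, \<open>\<theta> = T0 q0 c\<close> on one and
\<open>\<theta> = T1 q0 c\<close> on the other.\<close>

lemma curve_B_eq: "curve_B q0 K \<alpha> Ti \<phi> (viscosity sonic) = curve_point ` {Ti<..}"
proof (rule set_eqI)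
  fix z
  have "z \<in> curve_point ` {Ti<..}"
    if "\<theta> > Ti" "z = (viscosity \<theta>, speed \<theta>)" for \<theta>
    using that by (auto simp: curve_point_def)
  note image = this
  have "z \<in> curve_point ` {Ti<..}" if "z \<in> curve_B q0 K \<alpha> Ti \<phi> (viscosity sonic)"
  proof -
    from that consider c where "c \<ge> c_cj q0" "z = (beta0 q0 K \<alpha> Ti \<phi> c, c)"
      | c where "c \<ge> c_cj q0" "c < c_star q0 Ti" "z = (beta1 q0 K \<alpha> Ti \<phi> c, c)"
      | "z = (viscosity sonic, c_cj q0)"
      unfolding curve_B_def by blast
    thus ?thesis
    proof cases
      case (1 c)
      thus ?thesis using T0_end_state[of c] sonic_facts(1) by (intro image[of "T0 q0 c"]) (auto simp: beta0_eq)
    next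
      case (2 c)
      thus ?thesis using T1_end_state[of c] by (intro image[of "T1 q0 c"]) (auto simp: beta1_eq)
    next
      case 3
      thus ?thesis using sonic_facts(1) by (intro image[of sonic]) (auto simp: speed_sonic c_cj_eq)
    qed
  qed
  moreover have "z \<in> curve_B q0 K \<alpha> Ti \<phi> (viscosity sonic)" if "z \<in> curve_point ` {Ti<..}"
  proof -
    from that obtain \<theta> where \<theta>: "\<theta> > Ti" "z = (viscosity \<theta>, speed \<theta>)"
      by (auto simp: curve_point_def)
    have c: "speed \<theta> \<ge> c_cj q0" using \<theta> Ti by (intro speed_ge) auto
    show ?thesis
    proof (cases "\<theta> \<le> sonic")
      case True
      note t = T1_speed[OF \<theta>(1) True]
      have "z = (beta1 q0 K \<alpha> Ti \<phi> (speed \<theta>), speed \<theta>)" using beta1_eq[OF c t(2)] t(1) \<theta> by simp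
      thus ?thesis unfolding curve_B_def using c t(2) by blast
    next
      case False
      have "z = (beta0 q0 K \<alpha> Ti \<phi> (speed \<theta>), speed \<theta>)"
        using beta0_eq[OF c] T0_speed[of \<theta>] False \<theta> by simp
      thus ?thesis unfolding curve_B_def using c by blast
    qed
  qed
  ultimately show "z \<in> curve_B q0 K \<alpha> Ti \<phi> (viscosity sonic) \<longleftrightarrow> z \<in> curve_point ` {Ti<..}" by blast
qed

lemma viscosity_deriv: "\<theta> > Ti \<Longrightarrow> (viscosity has_real_derivative viscosity' \<theta>) (at \<theta>)"
  unfolding viscosity_def[abs_def] viscosity'_def using profileD(1)[of \<theta>] kappa_pos
  by (auto intro!: derivative_eq_intros coeff_profile_deriv(1) simp: power2_eq_square)

lemma Ck_on_viscosity: "Ck_on n viscosity {Ti<..}"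
proof (rule param_smooth_imp_Ck_on)
  show "param_smooth n {Ti<..} (\<lambda>x. viscosity)"
    unfolding viscosity_def[abs_def] using profileD(1) kappa_pos coeff_profile_smooth[of n]
    by (intro param_smooth_divide param_smooth_mult param_smooth_const) (auto simp: less_imp_neq[symmetric])
qed

lemma viscosity'_sonic: "viscosity' sonic < 0"
  using coeff'_pos_at_sonic profileD(1)[OF sonic_facts(1)] kappa_pos
  by (simp add: viscosity'_def sonic_def[symmetric])

text \<open>The velocity could vanish only where the speed is stationary, at the sonic temperature, and there
the viscosity has a nonzero derivative. Injectivity: the same viscosity and speed mean the same equation
for the profile, hence the same profile and the same end state.\<close>

lemma simple_curve: "simple_Ck_curve n (curve_point ` {Ti<..})"
  unfolding simple_Ck_curve_def
proof (intro exI[of _ "{Ti<..}"] exI[of _ curve_point] conjI ballI refl)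
  show "Ck_on n curve_point {Ti<..}"
    unfolding curve_point_def[abs_def] by (rule Ck_on_Pair[OF Ck_on_viscosity Ck_on_speed])
  show "{Ti<..} \<noteq> ({} :: real set)" using sonic_facts(1) by blast
  show "inj_on curve_point {Ti<..}"
  proof (rule inj_onI)
    fix \<theta> \<theta>' assume t: "\<theta> \<in> {Ti<..}" "\<theta>' \<in> {Ti<..}" "curve_point \<theta> = curve_point \<theta>'"
    hence "coeff \<theta> = coeff \<theta>'" "speed \<theta> = speed \<theta>'"
      using kappa_pos profileD(1)[of \<theta>] profileD(1)[of \<theta>'] by (auto simp: curve_point_def viscosity_def)
    thus "\<theta> = \<theta>'"
      using special_unique_end[of "coeff \<theta>" \<theta> "profile \<theta>" \<theta>' "profile \<theta>'"]
        special_profile[of \<theta>] special_profile[of \<theta>'] t by auto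
  qed
  fix \<theta> assume t: "\<theta> \<in> {Ti<..}"
  hence th0: "\<theta> > 0" using Ti by auto
  have "(curve_point has_vector_derivative (viscosity' \<theta>, speed' \<theta>)) (at \<theta>)"
    unfolding curve_point_def[abs_def] using t th0
    by (intro has_vector_derivative_Pair)
       (auto intro!: viscosity_deriv speed_deriv simp flip: has_real_derivative_iff_has_vector_derivative)
  moreover have "(viscosity' \<theta>, speed' \<theta>) \<noteq> 0"
  proof
    assume "(viscosity' \<theta>, speed' \<theta>) = 0"
    hence z: "viscosity' \<theta> = 0" "speed' \<theta> = 0" by (auto simp: zero_prod_def)
    have "\<theta>\<^sup>2 = 2 * q0" using z(2) th0 by (simp add: speed'_def field_simps)
    hence "\<theta> = sonic" unfolding sonic_def using th0 real_sqrt_unique by (metis less_imp_le)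
    thus False using z(1) viscosity'_sonic by simp
  qed
  ultimately show "vector_derivative curve_point (at \<theta>) \<noteq> 0" by (simp add: vector_derivative_at)
qed auto

text \<open>By continuity of \<open>coeff'\<close>, the derivative of the viscosity is negative on a whole neighbourhood of the sonic
temperature.\<close>

lemma local_branch:
  obtains r \<Theta> b1 b2 where "r > 0" "Ti < sonic - r" "b1 < viscosity sonic" "viscosity sonic < b2"
    "\<And>\<theta>. \<theta> \<in> {sonic - r<..<sonic + r} \<Longrightarrow> \<Theta> (viscosity \<theta>) = \<theta>"
    "\<And>b. b \<in> {b1<..<b2} \<Longrightarrow> \<Theta> b \<in> {sonic - r<..<sonic + r} \<and> viscosity (\<Theta> b) = b \<and>
       viscosity' (\<Theta> b) < 0 \<and> (\<Theta> has_real_derivative inverse (viscosity' (\<Theta> b))) (at b)"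
proof -
  have "isCont coeff' sonic"
    using continuous_on_coeff' sonic_facts(1) by (simp add: continuous_on_eq_continuous_at)
  hence "\<forall>\<^sub>F \<theta> in at sonic. coeff' \<theta> > 0"
    using coeff'_pos_at_sonic unfolding isCont_def sonic_def[symmetric] by (rule order_tendstoD)
  then obtain d where d: "d > 0" "\<And>\<theta>. \<theta> \<noteq> sonic \<Longrightarrow> dist \<theta> sonic < d \<Longrightarrow> coeff' \<theta> > 0"
    unfolding eventually_at by auto
  define r where "r = min (d / 2) ((sonic - Ti) / 2)"
  have r: "r > 0" "r < d" "Ti < sonic - r"
    using d(1) sonic_facts(1) by (auto simp: r_def min_def field_simps)
  have neg: "viscosity' \<theta> < 0" "\<theta> > Ti" if "\<theta> \<in> {sonic - r..sonic + r}" for \<theta>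
  proof -
    show "\<theta> > Ti" using that r by auto
    have "coeff' \<theta> > 0"
      using d(2)[of \<theta>] that r coeff'_pos_at_sonic
      by (cases "\<theta> = sonic") (auto simp: dist_real_def sonic_def[symmetric])
    thus "viscosity' \<theta> < 0" using profileD(1)[OF \<open>\<theta> > Ti\<close>] kappa_pos by (simp add: viscosity'_def)
  qed
  \<comment> \<open>Increasing functions that start at \<open>0\<close> are inverted by \<open>increasing_inverse\<close>; hence the reflection.\<close>
  define l where "l = sonic - r"
  define X where "X = (\<lambda>t. viscosity l - viscosity (l + t))"
  define M where "M = 2 * r"
  have dX: "(X has_real_derivative - viscosity' (l + t)) (at t)" if "0 \<le> t" "t \<le> M" for t
  proof -
    have "((\<lambda>t. viscosity (l + t)) has_real_derivative viscosity' (l + t) * 1) (at t)"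
      by (rule DERIV_chain2[OF viscosity_deriv])
         (use neg(2)[of "l + t"] that in \<open>auto intro!: derivative_eq_intros simp: l_def M_def\<close>)
    thus ?thesis unfolding X_def by (auto intro!: derivative_eq_intros)
  qed
  have cX: "continuous_on {0..M} X"
    by (rule DERIV_continuous_on) (rule has_field_derivative_at_within[OF dX], auto)
  have M0: "0 \<le> M" using r by (simp add: M_def)
  have X0: "X 0 = 0" by (simp add: X_def)
  have pos: "- viscosity' (l + t) > 0" if "0 < t" "t < M" for t
    using neg(1)[of "l + t"] that by (auto simp: l_def M_def)
  obtain g where g: "continuous_on {0..X M} g" "\<And>t. t \<in> {0..M} \<Longrightarrow> g (X t) = t"
    "\<And>t. t \<in> {0..M} \<Longrightarrow> X t \<in> {0..X M}"
    "\<And>x. x \<in> {0..X M} \<Longrightarrow> g x \<in> {0..M} \<and> X (g x) = x"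
    "\<And>x. 0 < x \<Longrightarrow> x < X M \<Longrightarrow>
       0 < g x \<and> g x < M \<and> (g has_real_derivative inverse (- viscosity' (l + g x))) (at x)"
    using increasing_inverse[OF M0 cX X0 dX[OF less_imp_le less_imp_le] pos] by blast
  define \<Theta> where "\<Theta> = (\<lambda>b. l + g (viscosity l - b))"
  have inv: "\<Theta> (viscosity \<theta>) = \<theta>" if "\<theta> \<in> {sonic - r<..<sonic + r}" for \<theta>
    using g(2)[of "\<theta> - l"] that by (auto simp: \<Theta>_def X_def l_def M_def)
  have range: "\<Theta> b \<in> {sonic - r<..<sonic + r} \<and> viscosity (\<Theta> b) = b \<and>
       viscosity' (\<Theta> b) < 0 \<and> (\<Theta> has_real_derivative inverse (viscosity' (\<Theta> b))) (at b)"
    if b: "b \<in> {viscosity l - X M<..<viscosity l}" for b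
  proof -
    define x where "x = viscosity l - b"
    have x: "0 < x" "x < X M" using b by (auto simp: x_def)
    note gx = g(5)[OF x]
    have \<Theta>: "\<Theta> b = l + g x" by (simp add: \<Theta>_def x_def)
    have in_r: "\<Theta> b \<in> {sonic - r<..<sonic + r}" using gx by (auto simp: \<Theta> l_def M_def)
    have "viscosity (\<Theta> b) = b"
      using g(4)[of x] x by (auto simp: \<Theta> X_def x_def)
    moreover have n: "viscosity' (\<Theta> b) < 0" using neg(1)[of "\<Theta> b"] in_r by auto
    moreover have "(\<Theta> has_real_derivative inverse (viscosity' (\<Theta> b))) (at b)"
    proof -
      have "((\<lambda>b. g (viscosity l - b)) has_real_derivative inverse (- viscosity' (l + g x)) * (- 1)) (at b)"
        by (rule DERIV_chain2[of g _ "\<lambda>b. viscosity l - b"])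
           (use gx in \<open>auto intro!: derivative_eq_intros simp: x_def\<close>)
      hence "(\<Theta> has_real_derivative 0 + inverse (- viscosity' (l + g x)) * (- 1)) (at b)"
        unfolding \<Theta>_def by (intro DERIV_add DERIV_const)
      thus ?thesis by (simp add: \<Theta>)
    qed
    ultimately show ?thesis using in_r by blast
  qed
  have "0 < g (X r) \<and> g (X r) < M" using g(2)[of r] r by (simp add: M_def)
  moreover have "X r \<in> {0..X M}" using g(3)[of r] r by (simp add: M_def)
  moreover have "g 0 = 0" "g (X M) = M" using g(2)[of 0] g(2)[of M] M0 X0 by auto
  ultimately have "0 < X r" "X r < X M" by (auto simp: less_le)
  hence "viscosity sonic < viscosity l" "viscosity l - X M < viscosity sonic"
    by (auto simp: X_def l_def)
  thus ?thesis using inv range r by (intro that[of r "viscosity l - X M" "viscosity l" \<Theta>]) auto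
qed

text \<open>Together with \<open>local_branch\<close> this makes \<open>(B)\<close> a graph near the critical point: points of the curve with a
speed close to the minimal one have a burnt temperature close to the sonic one.\<close>

lemma speed_far_from_sonic:
  assumes "r > 0" "\<theta> > 0" "\<theta> \<notin> {sonic - r<..<sonic + r}"
  shows "speed \<theta> - sonic \<ge> r\<^sup>2 / (2 * (sonic + r))"
proof -
  have "r\<^sup>2 / (sonic + r) \<le> (\<theta> - sonic)\<^sup>2 / \<theta>"
  proof (cases "\<theta> \<ge> sonic + r")
    case True
    define t where "t = \<theta> - sonic"
    have t: "t \<ge> r" "\<theta> = sonic + t" using True by (auto simp: t_def)
    have "r\<^sup>2 * (sonic + t) \<le> t\<^sup>2 * (sonic + r)"
    proof -
      have "t\<^sup>2 * (sonic + r) - r\<^sup>2 * (sonic + t) = (t - r) * (sonic * (t + r) + t * r)"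
        by (simp add: algebra_simps power2_eq_square)
      moreover have "(t - r) * (sonic * (t + r) + t * r) \<ge> 0" using t assms sonic_facts(2) by simp
      ultimately show ?thesis by linarith
    qed
    thus ?thesis using t assms sonic_facts(2) by (simp add: field_simps)
  next
    case False
    hence "\<theta> \<le> sonic - r" using assms by auto
    hence "r\<^sup>2 \<le> (sonic - \<theta>)\<^sup>2" using assms by (intro power_mono) auto
    hence "r\<^sup>2 / (sonic + r) \<le> (sonic - \<theta>)\<^sup>2 / \<theta>"
      using assms \<open>\<theta> \<le> sonic - r\<close> by (intro frac_le) auto
    thus ?thesis by (simp add: power2_commute)
  qed
  moreover have "r\<^sup>2 / (2 * (sonic + r)) = (r\<^sup>2 / (sonic + r)) / 2"
    "(\<theta> - sonic)\<^sup>2 / (2 * \<theta>) = ((\<theta> - sonic)\<^sup>2 / \<theta>) / 2"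
    by (simp_all only: divide_divide_eq_left mult.commute)
  ultimately show ?thesis
    unfolding speed_minus_sonic[OF assms(2)] by (simp only:) (rule divide_right_mono, simp_all)
qed

text \<open>With \<open>\<Theta>\<close> the local inverse of the viscosity, the function is \<open>speed \<circ> \<Theta>\<close>; its first derivative is
\<open>speed' (\<Theta> b) / viscosity' (\<Theta> b)\<close>, and \<open>speed'\<close> has a simple zero at the sonic temperature.\<close>

lemma curve_quadratic_minimum:
  "\<exists>c_tilde. locally_graph_of (curve_point ` {Ti<..}) (viscosity sonic) (c_cj q0) c_tilde \<and>
     quadratic_minimum c_tilde (viscosity sonic)"
proof -
  obtain r \<Theta> b1 b2 where r: "r > 0" "Ti < sonic - r" and b: "b1 < viscosity sonic" "viscosity sonic < b2"
    and inv: "\<And>\<theta>. \<theta> \<in> {sonic - r<..<sonic + r} \<Longrightarrow> \<Theta> (viscosity \<theta>) = \<theta>"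
    and range: "\<And>b. b \<in> {b1<..<b2} \<Longrightarrow> \<Theta> b \<in> {sonic - r<..<sonic + r} \<and> viscosity (\<Theta> b) = b \<and>
       viscosity' (\<Theta> b) < 0 \<and> (\<Theta> has_real_derivative inverse (viscosity' (\<Theta> b))) (at b)"
    by (rule local_branch) blast
  define bc where "bc = viscosity sonic"
  have bc: "bc \<in> {b1<..<b2}" using b by (simp add: bc_def)
  have \<Theta>bc: "\<Theta> bc = sonic" using inv[of sonic] r by (simp add: bc_def)
  define f where "f = (\<lambda>b. speed (\<Theta> b))"
  define f' where "f' = (\<lambda>b. speed' (\<Theta> b) * inverse (viscosity' (\<Theta> b)))"
  have big: "\<Theta> b > Ti" "\<Theta> b > 0" if "b \<in> {b1<..<b2}" for b
    using range[OF that] r Ti by auto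
  have df: "(f has_real_derivative f' b) (at b)" if "b \<in> {b1<..<b2}" for b
    unfolding f_def f'_def
    by (rule DERIV_chain2[OF speed_deriv]) (use range[OF that] big[OF that] in auto)
  have d\<Theta>: "(\<Theta> has_real_derivative inverse (viscosity' sonic)) (at bc)"
    using range[OF bc] by (simp add: \<Theta>bc)
  have ds: "(speed' has_real_derivative 2 * q0 / sonic ^ 3) (at sonic)"
    unfolding speed'_def[abs_def] using sonic_facts(2)
    by (auto intro!: derivative_eq_intros simp: field_simps power2_eq_square power3_eq_cube)
  have "((\<lambda>b. speed' (\<Theta> b)) has_real_derivative 2 * q0 / sonic ^ 3 * inverse (viscosity' sonic)) (at bc)"
    by (rule DERIV_chain2[OF _ d\<Theta>]) (simp add: \<Theta>bc ds)
  moreover have "speed' (\<Theta> bc) = 0" using sonic_facts q0 by (simp add: \<Theta>bc speed'_def)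
  moreover have "isCont (\<lambda>b. inverse (viscosity' (\<Theta> b))) bc"
  proof -
    have "isCont coeff' sonic" "isCont coeff sonic"
      using continuous_on_coeff' continuous_on_coeff sonic_facts(1)
      by (simp_all add: continuous_on_eq_continuous_at)
    hence "isCont viscosity' sonic"
      unfolding viscosity'_def[abs_def] using profileD(1)[OF sonic_facts(1)] kappa_pos
      by (intro continuous_intros) auto
    hence "isCont (\<lambda>b. viscosity' (\<Theta> b)) bc"
      by (intro isCont_o2[OF DERIV_isCont[OF d\<Theta>]]) (simp add: \<Theta>bc)
    thus ?thesis using viscosity'_sonic by (intro continuous_intros) (auto simp: \<Theta>bc)
  qed
  ultimately have df': "(f' has_real_derivative
      2 * q0 / sonic ^ 3 * inverse (viscosity' sonic) * inverse (viscosity' (\<Theta> bc))) (at bc)"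
    unfolding f'_def by (rule DERIV_mult_at_zero)
  have der: "deriv f b = f' b" if "b \<in> {b1<..<b2}" for b by (rule DERIV_imp_deriv[OF df[OF that]])
  have df'': "(deriv f has_real_derivative
      2 * q0 / sonic ^ 3 * inverse (viscosity' sonic) * inverse (viscosity' (\<Theta> bc))) (at bc)"
    by (rule has_field_derivative_transform_within_open[OF df' _ bc]) (use der in auto)
  have "quadratic_minimum f bc" unfolding quadratic_minimum_def
  proof (intro conjI)
    have "\<forall>\<^sub>F b in nhds bc. b \<in> {b1<..<b2}" using bc by (intro eventually_nhds_in_open) auto
    thus "\<forall>\<^sub>F b in nhds bc. f differentiable at b"
      by eventually_elim (use df in \<open>auto simp: real_differentiable_def\<close>)
    show "deriv f bc = 0" using der[OF bc] \<open>speed' (\<Theta> bc) = 0\<close> by (simp add: f'_def)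
    show "deriv f differentiable at bc" using df'' by (auto simp: real_differentiable_def)
    show "deriv (deriv f) bc > 0"
    proof -
      have "0 < 2 * q0 / sonic ^ 3" using q0 sonic_facts(2) by simp
      moreover have "0 < inverse (viscosity' sonic) * inverse (viscosity' sonic)"
        using viscosity'_sonic by (intro mult_neg_neg) auto
      ultimately show ?thesis
        unfolding DERIV_imp_deriv[OF df''] \<Theta>bc mult.assoc by (rule mult_pos_pos)
    qed
  qed
  moreover have "locally_graph_of (curve_point ` {Ti<..}) bc (c_cj q0) f"
  proof -
    define \<delta> where "\<delta> = r\<^sup>2 / (2 * (sonic + r))"
    have \<delta>: "\<delta> > 0" using r sonic_facts(2) by (simp add: \<delta>_def)
    have fbc: "f bc = c_cj q0" by (simp add: f_def \<Theta>bc speed_sonic c_cj_eq)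
    have "(f \<longlongrightarrow> f bc) (at bc)" using DERIV_isCont[OF df[OF bc]] by (simp add: isCont_def)
    then obtain e1 where e1: "e1 > 0" "\<And>b. b \<noteq> bc \<Longrightarrow> dist b bc < e1 \<Longrightarrow> dist (f b) (f bc) < \<delta>"
      using \<delta> unfolding Lim_at by (metis zero_less_dist_iff)
    obtain e2 where e2: "e2 > 0" "ball bc e2 \<subseteq> {b1<..<b2}"
      using bc open_contains_ball_eq[OF open_greaterThanLessThan] by blast
    have "\<forall>x\<in>ball bc (min e1 e2). f x \<in> ball (c_cj q0) \<delta> \<and>
        (\<forall>y\<in>ball (c_cj q0) \<delta>. (x, y) \<in> curve_point ` {Ti<..} \<longleftrightarrow> y = f x)"
    proof (intro ballI conjI)
      fix x assume x: "x \<in> ball bc (min e1 e2)"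
      hence xb: "x \<in> {b1<..<b2}" using e2(2) by auto
      show "f x \<in> ball (c_cj q0) \<delta>"
        using x e1(2)[of x] \<delta> fbc by (cases "x = bc") (auto simp: dist_commute)
      fix y assume y: "y \<in> ball (c_cj q0) \<delta>"
      show "(x, y) \<in> curve_point ` {Ti<..} \<longleftrightarrow> y = f x"
      proof
        assume "(x, y) \<in> curve_point ` {Ti<..}"
        then obtain \<theta> where \<theta>: "\<theta> > Ti" "x = viscosity \<theta>" "y = speed \<theta>" by (auto simp: curve_point_def)
        have "\<theta> \<in> {sonic - r<..<sonic + r}"
        proof (rule ccontr)
          assume "\<theta> \<notin> {sonic - r<..<sonic + r}"
          from speed_far_from_sonic[OF r(1) _ this] \<theta> Ti have "speed \<theta> - sonic \<ge> \<delta>" by (simp add: \<delta>_def)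
          thus False using y \<theta> by (auto simp: c_cj_eq dist_real_def)
        qed
        thus "y = f x" using inv \<theta> by (simp add: f_def)
      next
        assume "y = f x"
        hence "(x, y) = curve_point (\<Theta> x)" using range[OF xb] by (simp add: curve_point_def f_def)
        thus "(x, y) \<in> curve_point ` {Ti<..}" using big[OF xb] by auto
      qed
    qed
    moreover have "0 < min e1 e2" using e1(1) e2(1) by simp
    ultimately show ?thesis unfolding locally_graph_of_def using \<delta> by blast
  qed
  ultimately show ?thesis unfolding bc_def by blast
qed

section \<open>Chapman-Jouguet waves\<close>

text \<open>For \<open>b\<close> above the critical value the orbit exceeds the sonic temperature at \<open>x = 1\<close>. There the excess is
\<open>- (T - sonic)\<^sup>2 / 2 < 0\<close>, so \<open>T\<close> decreases near \<open>x = 1\<close> and its maximum lies inside the zone. Behind the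
zone \<open>T\<close> relaxes to the double root \<open>sonic\<close> as the reciprocal of an affine function.\<close>

lemma bump_wave_exists:
  assumes \<beta>: "0 < \<beta>" "\<beta> < viscosity sonic"
  shows "\<exists>L T Z. chapman_jouguet_bump_wave q0 K \<alpha> Ti \<phi> \<beta> L T Z"
proof -
  note D = profileD[OF sonic_facts(1)]
  define b where "b = 1 / (\<beta> * \<kappa>)"
  have b: "b > 0" "coeff sonic < b" and \<beta>b: "\<beta> = 1 / (b * \<kappa>)"
    using \<beta> kappa_pos D(1) by (auto simp: b_def viscosity_def field_simps)
  obtain S where S: "orbit b (speed sonic) S" "S 0 = Ti" "\<And>x. 0 < x \<Longrightarrow> x \<le> 1 \<Longrightarrow> profile sonic x < S x"
    by (rule overdriven_orbit_exists[OF special_profile[OF sonic_facts(1)] b(2)]) blast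
  have gt: "S x > Ti" if "0 < x" "x \<le> 1" for x
    using S(3)[OF that] special_range(3)[OF special_profile[OF sonic_facts(1)], of x] that by auto
  have h: "S 1 > sonic" using S(3)[of 1] D(6) by simp
  note cS = orbitD(1)[OF S(1)]
  \<comment> \<open>\<open>U\<close> solves \<open>U' = - m * (U - sonic)\<^sup>2\<close> with \<open>U 0 = S 1\<close>.\<close>
  define A m where "A = 1 / (S 1 - sonic)" and "m = b * \<kappa> / 2"
  have A: "A > 0" and m: "m > 0" using h b kappa_pos by (auto simp: A_def m_def)
  define U where "U = (\<lambda>r. sonic + 1 / (A + m * r))"
  have den: "A + m * r > 0" if "r \<ge> 0" for r using A m that by (simp add: add_pos_nonneg)
  have U0: "U 0 = S 1" by (simp add: U_def A_def)
  have U_le: "U r \<le> S 1" if "r \<ge> 0" for r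
  proof -
    have "1 / (A + m * r) \<le> 1 / A" using A m that by (intro divide_left_mono mult_pos_pos den) auto
    thus ?thesis using U0 by (simp add: U_def)
  qed
  have U_less: "U 1 < S 1"
  proof -
    have "1 / (A + m * 1) < 1 / A" using A m by (intro divide_strict_left_mono mult_pos_pos den) auto
    thus ?thesis using U0 by (simp add: U_def)
  qed
  have cU: "continuous_on {0..} U" unfolding U_def
    by (intro continuous_intros) (use den in \<open>auto simp: less_imp_neq[symmetric]\<close>)
  have U_gt: "U r > Ti" if "r \<ge> 0" for r
  proof -
    have "1 / (A + m * r) > 0" using den[OF that] by simp
    thus ?thesis unfolding U_def using sonic_facts(1) by linarith
  qed
  have dU: "(U has_real_derivative (b * \<kappa>) * (c_cj q0 * U r - (U r)\<^sup>2 / 2 - q0)) (at r)" if "r > 0" for r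
  proof -
    have n: "A + m * r \<noteq> 0" using den[of r] that by simp
    have "(U has_real_derivative - (m / (A + m * r)\<^sup>2)) (at r)"
      unfolding U_def using n by (auto intro!: derivative_eq_intros simp: power2_eq_square)
    moreover have "(b * \<kappa>) * (c_cj q0 * U r - (U r)\<^sup>2 / 2 - q0) = - (m / (A + m * r)\<^sup>2)"
    proof -
      have "c_cj q0 * U r - (U r)\<^sup>2 / 2 - q0 = - ((U r - sonic)\<^sup>2 / 2)"
        using sonic_facts(3) by (simp add: c_cj_eq power2_diff field_simps)
      also have "(U r - sonic)\<^sup>2 = 1 / (A + m * r)\<^sup>2" by (simp add: U_def power_one_over)
      finally show ?thesis by (simp add: m_def)
    qed
    ultimately show ?thesis by simp
  qed
  have lim: "(U \<longlongrightarrow> sonic) at_top" unfolding U_def using m by real_asymp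
  have S_cj: "orbit b (c_cj q0) S" using S(1) by (simp add: speed_sonic c_cj_eq)
  obtain L T Z where w: "traveling_wave q0 K \<alpha> Ti \<phi> \<beta> (c_cj q0) L T Z"
    "\<And>\<xi>. \<xi> \<le> - L \<Longrightarrow> T \<xi> = U (- L - \<xi>)" "(T \<longlongrightarrow> sonic) at_bot"
    "\<And>\<xi>. - L \<le> \<xi> \<Longrightarrow> \<xi> \<le> 0 \<Longrightarrow> \<exists>x\<in>{0..1}. T \<xi> = S x"
    "\<And>x. 0 < x \<Longrightarrow> x < 1 \<Longrightarrow> \<exists>\<xi>\<in>{- L<..<0}. T \<xi> = S x"
    using orbit_imp_wave[OF S_cj b(1) S(2) gt order_refl U0 cU U_gt dU lim]
    unfolding \<beta>b[symmetric] by blast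
  obtain xm where xm: "xm \<in> {0..1}" "\<And>x. x \<in> {0..1} \<Longrightarrow> S x \<le> S xm"
    using continuous_attains_sup[of "{0..1}" S] cS by auto
  have bump: "\<exists>x\<in>{0..1}. S 1 < S x"
  proof -
    define e where "e = (\<lambda>x. excess sonic (S x) x)"
    have e1: "e 1 < 0"
    proof -
      have "p \<noteq> 0" using p_ge_1 by simp
      hence "e 1 = - ((S 1 - sonic)\<^sup>2 / 2)"
        using sonic_facts(3) by (simp add: e_def excess_def power2_diff field_simps)
      thus ?thesis using h by simp
    qed
    have ce: "continuous_on {0..1} e" unfolding e_def by (rule continuous_on_excess[OF cS])
    then obtain d where d: "d > 0" "\<And>x. x \<in> {0..1} \<Longrightarrow> dist x 1 < d \<Longrightarrow> dist (e x) (e 1) < - e 1"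
      unfolding continuous_on_iff using e1
      by (elim ballE[of _ _ 1] allE[of _ "- e 1"]) auto
    define a where "a = max (1 / 2) (1 - d / 2)"
    have a: "0 < a" "a < 1" "1 - d < a" using d(1) by (auto simp: a_def)
    have "S 1 < S a"
    proof (rule DERIV_neg_imp_decreasing_open[OF a(2)])
      show "continuous_on {a..1} S" by (rule continuous_on_subset[OF cS]) (use a in auto)
      fix x assume x: "a < x" "x < 1"
      have "e x < 0" using d(2)[of x] x a by (auto simp: dist_real_def)
      hence "b * excess (speed sonic) (S x) x / rate (S x) < 0"
        using b(1) rate_pos[of "S x"]
        by (simp add: e_def speed_sonic divide_neg_pos mult_pos_neg)
      thus "\<exists>y. (S has_real_derivative y) (at x) \<and> y < 0"
        using orbitD(2)[OF S(1), of x] x a by auto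
    qed
    thus ?thesis using a by (intro bexI[of _ a]) auto
  qed
  have top: "S 1 < S xm" using bump xm(2) by force
  have "0 < xm" "xm < 1"
    using top xm(1) S(2) gt[of 1] by (cases "xm = 0"; cases "xm = 1"; auto)+
  from w(5)[OF this] obtain \<xi>m where \<xi>m: "\<xi>m \<in> {- L<..<0}" "T \<xi>m = S xm" by blast
  have T0: "T 0 = Ti" "\<And>\<xi>. \<xi> > 0 \<Longrightarrow> T \<xi> < Ti" "L > 0" using w(1) by (auto simp: traveling_wave_def)
  have max: "T \<xi> \<le> T \<xi>m" for \<xi>
  proof -
    consider "\<xi> > 0" | "- L \<le> \<xi>" "\<xi> \<le> 0" | "\<xi> \<le> - L" by linarith
    thus ?thesis
    proof cases
      case 1
      thus ?thesis using T0(2)[of \<xi>] xm(2)[of 0] S(2) \<xi>m(2) by simp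
    next
      case 2
      thus ?thesis using w(4)[of \<xi>] xm(2) \<xi>m(2) by auto
    next
      case 3
      thus ?thesis using w(2)[of \<xi>] U_le[of "- L - \<xi>"] top \<xi>m(2) by simp
    qed
  qed
  have theta: "(\<lambda>\<xi>. T \<xi> - sonic) \<in> \<Theta>[at_bot](\<lambda>\<xi>. \<bar>\<xi>\<bar> powr - 1)"
  proof (subst landau_theta.in_cong)
    show "\<forall>\<^sub>F \<xi> in at_bot. T \<xi> - sonic = 1 / (A + m * (- L - \<xi>))"
      using eventually_le_at_bot[of "- L"] by eventually_elim (simp add: w(2) U_def)
    show "(\<lambda>\<xi>. 1 / (A + m * (- L - \<xi>))) \<in> \<Theta>[at_bot](\<lambda>\<xi>. \<bar>\<xi>\<bar> powr - 1)" using m by real_asymp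
  qed
  have "chapman_jouguet_bump_wave q0 K \<alpha> Ti \<phi> \<beta> L T Z"
    unfolding chapman_jouguet_bump_wave_def chapman_jouguet_wave_def sonic_def[symmetric]
  proof (intro conjI)
    show "\<not> mono T" using T0(1) T0(2)[of 1] monoD[of T 0 1] by auto
    have "T (- L - 1) < T \<xi>m" using w(2)[of "- L - 1"] U_less top \<xi>m(2) by simp
    thus "\<not> antimono T" using antimonoD[of T "- L - 1" \<xi>m] \<xi>m(1) by auto
    show "\<exists>\<xi>m\<in>{- L<..<0}. \<forall>\<xi>. T \<xi> \<le> T \<xi>m" using max \<xi>m(1) by blast
    show "\<exists>p>0. (\<lambda>\<xi>. T \<xi> - sonic) \<in> \<Theta>[at_bot](\<lambda>\<xi>. \<bar>\<xi>\<bar> powr - p)"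
      using theta by (intro exI[of _ 1]) simp
  qed (use w in auto)
  thus ?thesis by blast
qed

lemma chapman_jouguet_special_exists:
  "\<exists>L T Z. chapman_jouguet_special_wave q0 K \<alpha> Ti \<phi> (viscosity sonic) L T Z"
proof -
  obtain L T Z where w: "traveling_wave q0 K \<alpha> Ti \<phi> (viscosity sonic) (speed sonic) L T Z"
    "\<And>\<xi>. \<xi> \<le> - L \<Longrightarrow> T \<xi> = sonic"
    using end_state_wave_iff[OF sonic_facts(1), of "viscosity sonic"] by blast
  have "\<forall>\<^sub>F \<xi> in at_bot. sonic = T \<xi>"
    using eventually_le_at_bot[of "- L"] by eventually_elim (simp add: w(2))
  with tendsto_const[of sonic] have "(T \<longlongrightarrow> sonic) at_bot" by (rule Lim_transform_eventually)
  thus ?thesis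
    unfolding chapman_jouguet_special_wave_def chapman_jouguet_wave_def sonic_def[symmetric] c_cj_eq
    using w by (auto simp: speed_sonic)
qed

end

theorem theorem1p3:
  fixes q0 K \<alpha> Ti :: real and \<phi> :: "real \<Rightarrow> real" and k :: nat
  assumes "q0 > 0" and "K > 0" and "0 \<le> \<alpha>" and "\<alpha> < 1"
    and "0 < Ti" and "Ti < sqrt (2 * q0)"
    and "ignition_kinetics Ti \<phi>"
    and "k = nat \<lfloor>1 / (1 - \<alpha>)\<rfloor>"
  shows "(\<forall>c\<ge>c_cj q0. \<exists>!\<beta>. is_beta0 q0 K \<alpha> Ti \<phi> c \<beta>) \<and>
    (\<forall>c. c_cj q0 \<le> c \<and> c < c_star q0 Ti \<longrightarrow> (\<exists>!\<beta>. is_beta1 q0 K \<alpha> Ti \<phi> c \<beta>)) \<and>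
    (\<exists>!\<beta>cj. \<beta>cj > 0 \<and>
       \<beta>cj = beta0 q0 K \<alpha> Ti \<phi> (c_cj q0) \<and> \<beta>cj = beta1 q0 K \<alpha> Ti \<phi> (c_cj q0)) \<and>
    (\<forall>\<beta>cj. \<beta>cj > 0 \<and>
       \<beta>cj = beta0 q0 K \<alpha> Ti \<phi> (c_cj q0) \<and> \<beta>cj = beta1 q0 K \<alpha> Ti \<phi> (c_cj q0) \<longrightarrow>
         (\<exists>L T Z. chapman_jouguet_special_wave q0 K \<alpha> Ti \<phi> \<beta>cj L T Z) \<and>
         simple_Ck_curve k (curve_B q0 K \<alpha> Ti \<phi> \<beta>cj) \<and>
         (\<exists>c_tilde. locally_graph_of (curve_B q0 K \<alpha> Ti \<phi> \<beta>cj) \<beta>cj (c_cj q0) c_tilde \<and>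
            quadratic_minimum c_tilde \<beta>cj) \<and>
         (\<forall>\<beta>. 0 < \<beta> \<and> \<beta> < \<beta>cj \<longrightarrow>
            (\<exists>L T Z. chapman_jouguet_bump_wave q0 K \<alpha> Ti \<phi> \<beta> L T Z)))"
proof -
  interpret reactive_flow q0 K \<alpha> Ti \<phi>
    using assms(1-7) by unfold_locales
  have b0: "beta0 q0 K \<alpha> Ti \<phi> (c_cj q0) = viscosity sonic"
    by (simp add: beta0_eq T_at_sonic)
  have b1: "beta1 q0 K \<alpha> Ti \<phi> (c_cj q0) = viscosity sonic"
    by (simp add: beta1_eq T_at_sonic c_cj_less_c_star)
  show ?thesis unfolding b0 b1
    using viscosity_pos[OF sonic_facts(1)] chapman_jouguet_special_exists bump_wave_exists
      simple_curve[of k] curve_quadratic_minimum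
    by (auto simp: is_beta0_iff is_beta1_iff curve_B_eq)
qed

end
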